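(* Let $1<q<\infty$ and $0\le b<\frac1{q'}$, where $\frac1q+\frac1{q'}=1$. Then there is a constant $C>0$ such that $$\|\mathbf{1}_I\cdot f\|_{\mathcal{F}L^{b,q}(\mathbb{R})}\le C\,\|f\|_{\mathcal{F}L^{b,q}(\mathbb{R})}$$ for every interval $I\subset\mathbb{R}$ and every $f\in\mathcal{F}L^{b,q}(\mathbb{R})$, where $C$ is independent of $I$ (and $f$).
   Context: $\mathbf{1}_I$ is the indicator function of $I$. For $1\le q\le\infty$ and $b\in\mathbb{R}$, the Fourier–Lebesgue space $\mathcal{F}L^{b,q}(\mathbb{R})$ is defined by the norm $\|f\|_{\mathcal{F}L^{b,q}}=\|\langle\tau\rangle^b\widehat f(\tau)\|_{L^q_\tau(\mathbb{R})}$, where $\langle\tau\rangle=(1+|\tau|^2)^{1/2}$ and $\widehat f$ is the Fourier transform of $f$. When $f$ is not a function, $\mathbf{1}_I\cdot f$ is understood via continuous extension from Schwartz functions, which are dense in $\mathcal{F}L^{b,q}(\mathbb{R})$ for $q<\infty$. *)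

theory Defs
  imports "HOL-Analysis.Analysis"
begin

definition schwartz_deriv :: "nat \<Rightarrow> (real \<Rightarrow> complex) \<Rightarrow> real \<Rightarrow> complex" where
  "schwartz_deriv k \<phi> = ((\<lambda>f x. vector_derivative f (at x)) ^^ k) \<phi>"

definition schwartz :: "(real \<Rightarrow> complex) set" where
  "schwartz = {\<phi>. (\<forall>k x. schwartz_deriv k \<phi> differentiable (at x)) \<and>
                  (\<forall>j k. bounded (range (\<lambda>x. x ^ j *\<^sub>R schwartz_deriv k \<phi> x)))}"

definition schwartz_seminorm :: "nat \<Rightarrow> nat \<Rightarrow> (real \<Rightarrow> complex) \<Rightarrow> real" where
  "schwartz_seminorm j k \<phi> = (SUP x. norm (x ^ j *\<^sub>R schwartz_deriv k \<phi> x))"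

text \<open>
  Functionals on Schwartz functions are represented as HOL functions on all of
  \<^typ>\<open>real \<Rightarrow> complex\<close> that vanish off \<^const>\<open>schwartz\<close>, so that equality of
  HOL functions is equality of functionals and pointwise subtraction is subtraction.
\<close>

type_synonym functional = "(real \<Rightarrow> complex) \<Rightarrow> complex"

definition tempered_distribution :: "functional \<Rightarrow> bool" where
  "tempered_distribution u \<longleftrightarrow>
     (\<forall>\<phi>. \<phi> \<notin> schwartz \<longrightarrow> u \<phi> = 0) \<and>
     (\<forall>\<phi>\<in>schwartz. \<forall>\<psi>\<in>schwartz. u (\<lambda>x. \<phi> x + \<psi> x) = u \<phi> + u \<psi>) \<and>
     (\<forall>c. \<forall>\<phi>\<in>schwartz. u (\<lambda>x. c * \<phi> x) = c * u \<phi>) \<and>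
     (\<exists>C N. \<forall>\<phi>\<in>schwartz.
        norm (u \<phi>) \<le> C * (\<Sum>j\<le>N. \<Sum>k\<le>N. schwartz_seminorm j k \<phi>))"

definition dist_of :: "(real \<Rightarrow> complex) \<Rightarrow> functional" where
  "dist_of F = (\<lambda>\<phi>. if \<phi> \<in> schwartz then (\<integral>x. F x * \<phi> x \<partial>lborel) else 0)"

definition is_function :: "functional \<Rightarrow> (real \<Rightarrow> complex) \<Rightarrow> bool" where
  "is_function u F \<longleftrightarrow>
     F \<in> borel_measurable borel \<and>
     (\<forall>\<phi>\<in>schwartz. integrable lborel (\<lambda>x. F x * \<phi> x)) \<and>
     u = dist_of F"

text \<open>Convention: no normalising factor; another normalisation yields an equivalent norm.\<close>

definition fourier :: "(real \<Rightarrow> complex) \<Rightarrow> real \<Rightarrow> complex" where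
  "fourier \<phi> \<tau> = (\<integral>x. cis (- (\<tau> * x)) * \<phi> x \<partial>lborel)"

definition fourier_dist :: "functional \<Rightarrow> functional" where
  "fourier_dist u = (\<lambda>\<phi>. if \<phi> \<in> schwartz then u (fourier \<phi>) else 0)"

definition japanese_bracket :: "real \<Rightarrow> real" where
  "japanese_bracket \<tau> = (1 + \<bar>\<tau>\<bar>\<^sup>2) powr (1 / 2)"

definition FL :: "real \<Rightarrow> real \<Rightarrow> functional set" where
  "FL b q = {u. tempered_distribution u \<and>
     (\<exists>g. is_function (fourier_dist u) g \<and>
          integrable lborel (\<lambda>\<tau>. (japanese_bracket \<tau> powr b * norm (g \<tau>)) powr q))}"

text \<open>
  The function representing the Fourier transform is unique almost everywhere, so the
  choice below is immaterial. The value is meaningful only for members of \<^const>\<open>FL\<close>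
  (a divergent Bochner integral is 0), hence the membership conditions further on.
\<close>

definition FL_norm :: "real \<Rightarrow> real \<Rightarrow> functional \<Rightarrow> real" where
  "FL_norm b q u =
     (let g = (SOME g. is_function (fourier_dist u) g) in
      (\<integral>\<tau>. (japanese_bracket \<tau> powr b * norm (g \<tau>)) powr q \<partial>lborel) powr (1 / q))"

definition FL_tendsto :: "real \<Rightarrow> real \<Rightarrow> (nat \<Rightarrow> functional) \<Rightarrow> functional \<Rightarrow> bool" where
  "FL_tendsto b q u v \<longleftrightarrow>
     (\<forall>n. u n \<in> FL b q) \<and> v \<in> FL b q \<and>
     (\<lambda>n. FL_norm b q (\<lambda>\<phi>. u n \<phi> - v \<phi>)) \<longlonglongrightarrow> 0"

definition cut :: "real set \<Rightarrow> (real \<Rightarrow> complex) \<Rightarrow> real \<Rightarrow> complex" where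
  "cut I F = (\<lambda>x. indicator I x * F x)"

text \<open>
  The product of the indicator function of \<open>I\<close> with \<open>f\<close>: the pointwise product if \<open>f\<close>
  is a function, and otherwise the value at \<open>f\<close> of the continuous extension to
  \<^term>\<open>FL b q\<close> of the pointwise product on Schwartz functions.
\<close>

definition cutoff :: "real \<Rightarrow> real \<Rightarrow> real set \<Rightarrow> functional \<Rightarrow> functional" where
  "cutoff b q I f =
     (if \<exists>F. is_function f F then dist_of (cut I (SOME F. is_function f F))
      else (THE h. h \<in> FL b q \<and>
              (\<forall>\<phi>. (\<forall>n. \<phi> n \<in> schwartz) \<longrightarrow>
                   FL_tendsto b q (\<lambda>n. dist_of (\<phi> n)) f \<longrightarrow>
                   FL_tendsto b q (\<lambda>n. dist_of (cut I (\<phi> n))) h)))"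

end

theory Submission
  imports Defs "HOL-Probability.Characteristic_Functions" "HOL-Probability.Sinc_Integral"
    "HOL-Real_Asymp.Real_Asymp" "HOL-Complex_Analysis.Complex_Analysis"
begin

text \<open>
  Multiplication by an indicator function acts on the Fourier side as a singular integral operator.
  If \<open>f\<close> has Fourier transform \<open>g\<close> and \<open>I\<close> is the half-line \<open>(0,\<infinity>)\<close>, the transform of the
  cut-off is \<open>g / 2\<close> plus a multiple of the Hilbert transform of \<open>g\<close>. For the half-line \<open>(a,\<infinity>)\<close> the
  operator is conjugated by the phase \<open>exp (i a \<tau>)\<close>, which the norm does not see, and the indicator of an
  arbitrary interval agrees, off two points, with \<open>c0 + c1 1_(a,\<infinity>) + c2 1_(b,\<infinity>)\<close> with coefficients in
  \<open>[-1,1]\<close>. The theorem, with a constant independent of \<open>I\<close>, therefore follows from the boundedness of the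
  Hilbert transform on \<open>L^q\<close> with the weight \<open>\<langle>\<tau>\<rangle>^(bq)\<close>, together with an argument that passes
  from Schwartz functions to all of the space.

  \<^emph>\<open>The Hilbert transform.\<close> It is regularised to the Cauchy transform \<open>F\<close> on a line in the right half
  plane. For \<open>1 < p \<le> 2\<close> and a nonnegative density, \<open>F\<close> has positive real part, so \<open>F^p\<close> is holomorphic
  and Cauchy's theorem makes its integral over the line vanish. The inequality
  \<open>|z|^p \<le> A (Re z)^p - B Re (z^p)\<close> for \<open>Re z > 0\<close> then bounds the \<open>L^p\<close> norm of \<open>F\<close> by that of its real part,
  which is a Poisson integral (\<open>cauchy_Lp_supported\<close>). Exponents above 2 follow because the
  transform is, up to conjugation, its own adjoint (\<open>cauchy_Lp_dual\<close>).

  \<^emph>\<open>The weight.\<close> Commuting \<open>(1 + |\<tau>|)^b\<close> with the transform leaves an absolutely convergent integral with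
  kernel at most \<open>(1 + |\<sigma>|)^(-b) max (1 + |\<tau>|) (1 + |\<sigma>|)^(b-1)\<close>. Schur's test with a power of \<open>1 + |\<tau>|\<close> handles
  it, and a suitable power exists because \<open>b < 1 - 1/q\<close> (\<open>commutator_Lp\<close>). The result for Schwartz
  functions is \<open>interval_cut_bound\<close>.

  \<^emph>\<open>From Schwartz functions to all distributions.\<close> By density and completeness the cut-off extends to
  an operator that sends \<open>g\<close> to some \<open>G\<close> (\<open>interval_cut_extension\<close>). The extension is determined by its transpose: pairing \<open>G\<close>
  with the inverse transform of a Schwartz function \<open>\<psi>\<close> is the same as pairing \<open>g\<close> with the inverse transform of
  \<open>1_I \<psi>\<close>, which is \<open>O(1/|\<tau>|)\<close> and so pairs with \<open>L^q\<close> (\<open>extension_pairing\<close>). If \<open>f\<close> is a function \<open>F\<close>,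
  the product \<open>1_I F\<close> satisfies the same identity, because \<open>1_I\<close> is a limit of smooth steps whose derivatives stay
  bounded in \<open>L^1\<close> (\<open>function_cut_pairing\<close>). So the pointwise product coincides with the
  continuous extension, and nothing concentrated at the endpoints of \<open>I\<close> can arise.
\<close>

section \<open>Schwartz functions\<close>

abbreviation vderiv :: "(real \<Rightarrow> complex) \<Rightarrow> real \<Rightarrow> complex" where
  "vderiv \<phi> \<equiv> (\<lambda>x. vector_derivative \<phi> (at x))"

text \<open>
  A set of rapidly decreasing functions that is closed under differentiation contains all iterated
  derivatives of its members. Exhibiting such a set replaces inductions on the order of the derivative in all
  closure properties.
\<close>

lemma schwartz_coinduct:
  assumes "\<phi> \<in> S"
    and deriv: "\<And>u. u \<in> S \<Longrightarrow> \<exists>v\<in>S. \<forall>x. (u has_vector_derivative v x) (at x)"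
    and bdd: "\<And>u j. u \<in> S \<Longrightarrow> \<exists>C. \<forall>x. \<bar>x\<bar> ^ j * norm (u x) \<le> C"
  shows "\<phi> \<in> schwartz"
proof -
  have S: "schwartz_deriv k \<phi> \<in> S" for k
  proof (induction k)
    case 0
    then show ?case using assms(1) by (simp add: schwartz_deriv_def)
  next
    case (Suc k)
    obtain v where v: "v \<in> S" "\<forall>x. (schwartz_deriv k \<phi> has_vector_derivative v x) (at x)"
      using deriv[OF Suc] by blast
    have "schwartz_deriv (Suc k) \<phi> = v"
      using v(2) by (auto simp: schwartz_deriv_def intro!: ext vector_derivative_at)
    with v show ?case by simp
  qed
  have "schwartz_deriv k \<phi> differentiable (at x)" for k x
    using deriv[OF S[of k]] by (auto simp: has_vector_derivative_def differentiable_def)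
  moreover have "bounded (range (\<lambda>x. x ^ j *\<^sub>R schwartz_deriv k \<phi> x))" for j k
    using bdd[OF S[of k], of j] by (auto simp: bounded_iff power_abs)
  ultimately show ?thesis by (auto simp: schwartz_def)
qed

lemma schwartz_deriv_vderiv: "schwartz_deriv k (vderiv \<phi>) = schwartz_deriv (Suc k) \<phi>"
  by (simp add: schwartz_deriv_def funpow_Suc_right del: funpow.simps)

lemma schwartz_vderiv: "\<phi> \<in> schwartz \<Longrightarrow> vderiv \<phi> \<in> schwartz"
  unfolding schwartz_def mem_Collect_eq schwartz_deriv_vderiv by blast

lemma schwartz_has_vderiv: "\<phi> \<in> schwartz \<Longrightarrow> (\<phi> has_vector_derivative vderiv \<phi> x) (at x)"
proof -
  assume "\<phi> \<in> schwartz"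
  then have "schwartz_deriv 0 \<phi> differentiable (at x)" by (simp add: schwartz_def)
  then show ?thesis
    by (simp add: schwartz_deriv_def vector_derivative_works)
qed

lemma schwartz_bound: "\<phi> \<in> schwartz \<Longrightarrow> \<exists>C. \<forall>x. \<bar>x\<bar> ^ j * norm (\<phi> x) \<le> C"
proof -
  assume "\<phi> \<in> schwartz"
  then have "bounded (range (\<lambda>x. x ^ j *\<^sub>R schwartz_deriv 0 \<phi> x))" unfolding schwartz_def by blast
  then show ?thesis by (auto simp: schwartz_deriv_def bounded_iff power_abs)
qed

lemma schwartz_boundE:
  assumes "\<phi> \<in> schwartz"
  obtains C where "C \<ge> 0" "\<And>x. \<bar>x\<bar> ^ j * norm (\<phi> x) \<le> C"
proof -
  obtain C where "\<forall>x. \<bar>x\<bar> ^ j * norm (\<phi> x) \<le> C" using schwartz_bound[OF assms] by blast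
  then show thesis by (intro that[of "max C 0"]) (auto simp: le_max_iff_disj)
qed

lemma schwartz_add:
  assumes "\<phi> \<in> schwartz" "\<psi> \<in> schwartz" shows "(\<lambda>x. \<phi> x + \<psi> x) \<in> schwartz"
proof (rule schwartz_coinduct[where S = "{u. \<exists>\<phi>\<in>schwartz. \<exists>\<psi>\<in>schwartz. u = (\<lambda>x. \<phi> x + \<psi> x)}"])
  fix u :: "real \<Rightarrow> complex"
  assume "u \<in> {u. \<exists>\<phi>\<in>schwartz. \<exists>\<psi>\<in>schwartz. u = (\<lambda>x. \<phi> x + \<psi> x)}"
  then obtain \<phi> \<psi> where u: "\<phi> \<in> schwartz" "\<psi> \<in> schwartz" "u = (\<lambda>x. \<phi> x + \<psi> x)" by blast
  have "\<forall>x. (u has_vector_derivative vderiv \<phi> x + vderiv \<psi> x) (at x)"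
    unfolding u(3) by (intro allI has_vector_derivative_add schwartz_has_vderiv u)
  moreover have "(\<lambda>x. vderiv \<phi> x + vderiv \<psi> x) \<in> {u. \<exists>\<phi>\<in>schwartz. \<exists>\<psi>\<in>schwartz. u = (\<lambda>x. \<phi> x + \<psi> x)}"
    by (intro CollectI bexI[where x = "vderiv \<phi>"] bexI[where x = "vderiv \<psi>"] refl schwartz_vderiv u)
  ultimately show "\<exists>v\<in>{u. \<exists>\<phi>\<in>schwartz. \<exists>\<psi>\<in>schwartz. u = (\<lambda>x. \<phi> x + \<psi> x)}. \<forall>x. (u has_vector_derivative v x) (at x)"
    by (rule rev_bexI[rotated])
  fix j
  obtain C where C: "\<And>x. \<bar>x\<bar> ^ j * norm (\<phi> x) \<le> C" using schwartz_boundE[OF u(1)] by blast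
  obtain C' where C': "\<And>x. \<bar>x\<bar> ^ j * norm (\<psi> x) \<le> C'" using schwartz_boundE[OF u(2)] by blast
  have "\<bar>x\<bar> ^ j * norm (u x) \<le> C + C'" for x
  proof -
    have "\<bar>x\<bar> ^ j * norm (u x) \<le> \<bar>x\<bar> ^ j * (norm (\<phi> x) + norm (\<psi> x))"
      by (intro mult_left_mono) (auto simp: u norm_triangle_ineq)
    also have "\<dots> \<le> C + C'" using C[of x] C'[of x] by (simp add: algebra_simps)
    finally show ?thesis .
  qed
  then show "\<exists>C. \<forall>x. \<bar>x\<bar> ^ j * norm (u x) \<le> C" by blast
qed (intro CollectI bexI[where x = \<phi>] bexI[where x = \<psi>] refl assms)

text \<open>
  The invariant set is the image of the Schwartz space under \<open>T\<close>; this covers scalar multiples,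
  modulations, reflections and the Fourier transform.
\<close>

lemma schwartz_image:
  assumes "\<phi> \<in> schwartz"
    and "\<And>\<phi>. \<phi> \<in> schwartz \<Longrightarrow> \<exists>\<psi>\<in>schwartz. \<forall>x. (T \<phi> has_vector_derivative T \<psi> x) (at x)"
    and "\<And>\<phi> j. \<phi> \<in> schwartz \<Longrightarrow> \<exists>C. \<forall>x. \<bar>x\<bar> ^ j * norm (T \<phi> x) \<le> C"
  shows "T \<phi> \<in> schwartz"
proof (rule schwartz_coinduct[where S = "T ` schwartz"])
  show "T \<phi> \<in> T ` schwartz" using assms(1) by (rule imageI)
  fix u assume "u \<in> T ` schwartz"
  then obtain \<psi> where u: "u = T \<psi>" "\<psi> \<in> schwartz" by (rule imageE)
  show "\<exists>v\<in>T ` schwartz. \<forall>x. (u has_vector_derivative v x) (at x)"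
    using assms(2)[OF u(2)] unfolding u(1) by (rule bexE) (rule bexI[OF _ imageI])
  show "\<exists>C. \<forall>x. \<bar>x\<bar> ^ j * norm (u x) \<le> C" for j
    using assms(3)[OF u(2)] unfolding u(1) .
qed

lemma schwartz_cmult:
  assumes "\<phi> \<in> schwartz" shows "(\<lambda>x. c * \<phi> x) \<in> schwartz"
proof (rule schwartz_image[where T = "\<lambda>\<phi> x. c * \<phi> x", OF assms])
  fix \<phi> :: "real \<Rightarrow> complex" and j assume p: "\<phi> \<in> schwartz"
  show "\<exists>\<psi>\<in>schwartz. \<forall>x. ((\<lambda>x. c * \<phi> x) has_vector_derivative c * \<psi> x) (at x)"
    by (rule bexI[of _ "vderiv \<phi>"]) (use p in \<open>blast intro: has_vector_derivative_mult_right schwartz_has_vderiv schwartz_vderiv\<close>)+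
  obtain C where C: "\<And>x. \<bar>x\<bar> ^ j * norm (\<phi> x) \<le> C" using schwartz_boundE[OF p] by blast
  have "\<bar>x\<bar> ^ j * norm (c * \<phi> x) \<le> norm c * C" for x
    using mult_left_mono[OF C[of x], of "norm c"] by (simp add: norm_mult algebra_simps)
  then show "\<exists>C. \<forall>x. \<bar>x\<bar> ^ j * norm (c * \<phi> x) \<le> C" by blast
qed

lemma schwartz_diff:
  assumes "\<phi> \<in> schwartz" "\<psi> \<in> schwartz" shows "(\<lambda>x. \<phi> x - \<psi> x) \<in> schwartz"
  using schwartz_add[OF assms(1) schwartz_cmult[OF assms(2), of "-1"]] by simp

lemma has_vector_derivative_cis [derivative_intros]:
  "((\<lambda>x. cis (a * x)) has_vector_derivative \<i> * a * cis (a * x)) (at x within A)"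
proof -
  have "((\<lambda>z. exp (\<i> * of_real a * z)) has_field_derivative exp (\<i> * of_real a * of_real x) * (\<i> * of_real a)) (at (of_real x))"
    by (auto intro!: derivative_eq_intros)
  from has_vector_derivative_real_field[OF this, of A] show ?thesis
    by (simp add: cis_conv_exp mult_ac)
qed

lemma schwartz_modulate:
  assumes "\<phi> \<in> schwartz" shows "(\<lambda>x. cis (a * x) * \<phi> x) \<in> schwartz"
proof (rule schwartz_image[where T = "\<lambda>\<phi> x. cis (a * x) * \<phi> x", OF assms])
  fix \<phi> :: "real \<Rightarrow> complex" and j assume p: "\<phi> \<in> schwartz"
  show "\<exists>\<psi>\<in>schwartz. \<forall>x. ((\<lambda>x. cis (a * x) * \<phi> x) has_vector_derivative cis (a * x) * \<psi> x) (at x)"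
  proof (rule bexI[of _ "\<lambda>x. vderiv \<phi> x + (\<i> * a) * \<phi> x"], rule allI)
    fix x
    show "((\<lambda>x. cis (a * x) * \<phi> x) has_vector_derivative cis (a * x) * (vderiv \<phi> x + (\<i> * a) * \<phi> x)) (at x)"
      using has_vector_derivative_mult[OF has_vector_derivative_cis[of a x UNIV] schwartz_has_vderiv[OF p, of x]]
      by (simp add: algebra_simps)
  qed (intro schwartz_add schwartz_cmult schwartz_vderiv p)
  show "\<exists>C. \<forall>x. \<bar>x\<bar> ^ j * norm (cis (a * x) * \<phi> x) \<le> C"
    using schwartz_bound[OF p, of j] by (simp add: norm_mult)
qed

lemma schwartz_reflect:
  assumes "\<phi> \<in> schwartz" shows "(\<lambda>x. \<phi> (- x)) \<in> schwartz"
proof (rule schwartz_image[where T = "\<lambda>\<phi> x. \<phi> (- x)", OF assms])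
  fix \<phi> :: "real \<Rightarrow> complex" and j assume p: "\<phi> \<in> schwartz"
  show "\<exists>\<psi>\<in>schwartz. \<forall>x. ((\<lambda>x. \<phi> (- x)) has_vector_derivative \<psi> (- x)) (at x)"
  proof (rule bexI[of _ "\<lambda>x. (-1) * vderiv \<phi> x"], rule allI)
    fix x
    show "((\<lambda>x. \<phi> (- x)) has_vector_derivative (-1) * vderiv \<phi> (- x)) (at x)"
    proof -
      have "(uminus has_vector_derivative (-1)) (at x)"
        using has_vector_derivative_minus[OF has_vector_derivative_id] by simp
      from vector_diff_chain_at[OF this schwartz_has_vderiv[OF p, of "-x"]] show ?thesis by (simp add: o_def)
    qed
  qed (intro schwartz_cmult schwartz_vderiv p)
  show "\<exists>C. \<forall>x. \<bar>x\<bar> ^ j * norm (\<phi> (- x)) \<le> C"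
    using schwartz_bound[OF p, of j] by (metis abs_minus_cancel)
qed

text \<open>
  Since \<open>(x \<phi>)' = x \<phi>' + \<phi>\<close>, the set closed under differentiation consists of the sums \<open>x \<phi> + \<psi>\<close>.
\<close>

lemma schwartz_times_x:
  assumes "\<phi> \<in> schwartz" shows "(\<lambda>x. of_real x * \<phi> x) \<in> schwartz"
proof (rule schwartz_coinduct[where S = "{u. \<exists>\<phi>\<in>schwartz. \<exists>\<psi>\<in>schwartz. u = (\<lambda>x. of_real x * \<phi> x + \<psi> x)}"])
  let ?S = "{u. \<exists>\<phi>\<in>schwartz. \<exists>\<psi>\<in>schwartz. u = (\<lambda>x. of_real x * \<phi> x + \<psi> x)}"
  show "(\<lambda>x. of_real x * \<phi> x) \<in> ?S"
    by (intro CollectI bexI[where x = \<phi>] bexI[where x = "\<lambda>x. 0 * \<phi> x"] schwartz_cmult assms) simp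
  fix u :: "real \<Rightarrow> complex" assume "u \<in> ?S"
  then obtain \<phi> \<psi> where u: "\<phi> \<in> schwartz" "\<psi> \<in> schwartz" "u = (\<lambda>x. of_real x * \<phi> x + \<psi> x)" by blast
  show "\<exists>v\<in>?S. \<forall>x. (u has_vector_derivative v x) (at x)"
  proof (rule bexI[of _ "\<lambda>x. of_real x * vderiv \<phi> x + (\<phi> x + vderiv \<psi> x)"], rule allI)
    fix x
    have d: "((\<lambda>x. complex_of_real x) has_vector_derivative 1) (at x)"
      by (rule has_vector_derivative_of_real[OF DERIV_ident, simplified])
    show "(u has_vector_derivative of_real x * vderiv \<phi> x + (\<phi> x + vderiv \<psi> x)) (at x)"
      using has_vector_derivative_add[OF has_vector_derivative_mult[OF d schwartz_has_vderiv[OF u(1), of x]] schwartz_has_vderiv[OF u(2), of x]]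
      unfolding u(3) by (simp add: algebra_simps)
  qed (intro CollectI bexI[where x = "vderiv \<phi>"] bexI[where x = "\<lambda>x. \<phi> x + vderiv \<psi> x"] refl schwartz_add schwartz_vderiv u)
  fix j
  obtain C where C: "\<And>x. \<bar>x\<bar> ^ Suc j * norm (\<phi> x) \<le> C" using schwartz_boundE[OF u(1)] by blast
  obtain C' where C': "\<And>x. \<bar>x\<bar> ^ j * norm (\<psi> x) \<le> C'" using schwartz_boundE[OF u(2)] by blast
  have "\<bar>x\<bar> ^ j * norm (u x) \<le> C + C'" for x
  proof -
    have "\<bar>x\<bar> ^ j * norm (u x) \<le> \<bar>x\<bar> ^ j * (\<bar>x\<bar> * norm (\<phi> x) + norm (\<psi> x))"
      by (intro mult_left_mono) (auto simp: u norm_mult intro!: norm_triangle_mono)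
    also have "\<dots> \<le> C + C'" using C[of x] C'[of x] by (simp add: algebra_simps)
    finally show ?thesis .
  qed
  then show "\<exists>C. \<forall>x. \<bar>x\<bar> ^ j * norm (u x) \<le> C" by blast
qed

lemma schwartz_continuous: "\<phi> \<in> schwartz \<Longrightarrow> continuous_on A \<phi>"
  by (intro continuous_at_imp_continuous_on ballI has_vector_derivative_continuous[OF schwartz_has_vderiv])

lemma schwartz_measurable [measurable (raw)]: "\<phi> \<in> schwartz \<Longrightarrow> \<phi> \<in> borel_measurable borel"
  by (simp add: borel_measurable_continuous_onI schwartz_continuous)

lemma integrable_inverse_1_plus_square: "integrable lborel (\<lambda>x::real. inverse (1 + x\<^sup>2))"
  using integrable_inverse_1_plus_square by (simp add: set_integrable_def)

lemma integral_inverse_1_plus_square: "(\<integral>x. inverse (1 + (x::real)\<^sup>2) \<partial>lborel) = pi"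
  using LBINT_inverse_1_plus_square
  by (simp add: interval_lebesgue_integral_def set_lebesgue_integral_def einterval_def)

lemma schwartz_decay:
  assumes "\<phi> \<in> schwartz"
  obtains C where "C \<ge> 0" "\<And>x. norm (\<phi> x) \<le> C * inverse (1 + x\<^sup>2)"
proof -
  obtain C where C: "C \<ge> 0" "\<And>x. \<bar>x\<bar> ^ 2 * norm (\<phi> x) \<le> C" using schwartz_boundE[OF assms] by blast
  obtain C' where C': "C' \<ge> 0" "\<And>x. \<bar>x\<bar> ^ 0 * norm (\<phi> x) \<le> C'" using schwartz_boundE[OF assms] by blast
  have "norm (\<phi> x) * (1 + x\<^sup>2) \<le> C + C'" for x using C(2)[of x] C'(2)[of x] by (simp add: algebra_simps)
  then show thesis using C(1) C'(1)
    by (intro that[of "C + C'"]) (auto simp: field_simps add_pos_nonneg)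
qed

lemma schwartz_integrable: "\<phi> \<in> schwartz \<Longrightarrow> integrable lborel \<phi>"
proof -
  assume p: "\<phi> \<in> schwartz"
  obtain C where C: "\<And>x. norm (\<phi> x) \<le> C * inverse (1 + x\<^sup>2)" using schwartz_decay[OF p] by blast
  show ?thesis
    by (rule Bochner_Integration.integrable_bound[OF integrable_mult_right[OF integrable_inverse_1_plus_square, of C]])
      (use schwartz_measurable[OF p] in \<open>auto intro!: AE_I2 order_trans[OF C]\<close>)
qed

lemma schwartz_tendsto_0:
  assumes "\<phi> \<in> schwartz" shows "(\<phi> \<longlongrightarrow> 0) at_top" "(\<phi> \<longlongrightarrow> 0) at_bot"
proof -
  obtain C where C: "\<And>x. norm (\<phi> x) \<le> C * inverse (1 + x\<^sup>2)" using schwartz_decay[OF assms] by blast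
  have "((\<lambda>x::real. C * inverse (1 + x\<^sup>2)) \<longlongrightarrow> 0) at_top" "((\<lambda>x::real. C * inverse (1 + x\<^sup>2)) \<longlongrightarrow> 0) at_bot"
    by real_asymp+
  then show "(\<phi> \<longlongrightarrow> 0) at_top" "(\<phi> \<longlongrightarrow> 0) at_bot"
    by (auto intro!: Lim_null_comparison[where g = "\<lambda>x. C * inverse (1 + x\<^sup>2)"] always_eventually C)
qed

lemma schwartz_integral_vderiv:
  assumes "\<phi> \<in> schwartz" shows "(\<integral>x. vderiv \<phi> x \<partial>lborel) = 0"
proof -
  have "(LBINT x=-\<infinity>..\<infinity>. vderiv \<phi> x) = 0 - 0"
  proof (rule interval_integral_FTC_integrable)
    show "set_integrable lborel (einterval (- \<infinity>) \<infinity>) (vderiv \<phi>)"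
      using schwartz_integrable[OF schwartz_vderiv[OF assms]] by (simp add: set_integrable_def einterval_def)
    show "isCont (vderiv \<phi>) x" for x
      using schwartz_has_vderiv[OF schwartz_vderiv[OF assms]] by (rule has_vector_derivative_continuous)
    show "((\<phi> \<circ> real_of_ereal) \<longlongrightarrow> 0) (at_right (- \<infinity>))"
      unfolding at_right_MInf filterlim_filtermap o_def using schwartz_tendsto_0[OF assms] by simp
    show "((\<phi> \<circ> real_of_ereal) \<longlongrightarrow> 0) (at_left \<infinity>)"
      unfolding at_left_PInf filterlim_filtermap o_def using schwartz_tendsto_0[OF assms] by simp
  qed (simp_all add: schwartz_has_vderiv assms)
  then show ?thesis by (simp add: interval_lebesgue_integral_def set_lebesgue_integral_def einterval_def)
qed

section \<open>The Fourier transform on Schwartz functions\<close>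

definition ifourier :: "(real \<Rightarrow> complex) \<Rightarrow> real \<Rightarrow> complex" where
  "ifourier \<psi> x = fourier \<psi> (- x) / (2 * pi)"

lemma measurable_cis [measurable]: "cis \<in> borel_measurable borel"
  by (intro borel_measurable_continuous_onI continuous_on_cis continuous_on_id)

lemma integrable_cis_mult:
  "integrable lborel \<phi> \<Longrightarrow> integrable lborel (\<lambda>x. cis (- (\<tau> * x)) * \<phi> x)"
  by (rule Bochner_Integration.integrable_bound[of lborel \<phi>]) (auto simp: norm_mult)

lemma norm_fourier_le: "norm (fourier \<phi> \<tau>) \<le> (\<integral>x. norm (\<phi> x) \<partial>lborel)"
  unfolding fourier_def
  by (rule order_trans[OF integral_norm_bound]) (simp add: norm_mult)

lemma fourier_add:
  "integrable lborel \<phi> \<Longrightarrow> integrable lborel \<psi> \<Longrightarrow> fourier (\<lambda>x. \<phi> x + \<psi> x) \<tau> = fourier \<phi> \<tau> + fourier \<psi> \<tau>"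
  unfolding fourier_def by (simp add: distrib_left integrable_cis_mult)

lemma fourier_diff:
  "integrable lborel \<phi> \<Longrightarrow> integrable lborel \<psi> \<Longrightarrow> fourier (\<lambda>x. \<phi> x - \<psi> x) \<tau> = fourier \<phi> \<tau> - fourier \<psi> \<tau>"
  unfolding fourier_def by (simp add: right_diff_distrib integrable_cis_mult)

lemma fourier_cmult: "fourier (\<lambda>x. c * \<phi> x) \<tau> = c * fourier \<phi> \<tau>"
proof -
  have "fourier (\<lambda>x. c * \<phi> x) \<tau> = (\<integral>x. c * (cis (- (\<tau> * x)) * \<phi> x) \<partial>lborel)"
    unfolding fourier_def by (simp add: mult_ac)
  then show ?thesis by (simp add: fourier_def)
qed

lemma fourier_measurable [measurable]:
  assumes [measurable]: "\<phi> \<in> borel_measurable borel" shows "fourier \<phi> \<in> borel_measurable borel"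
  unfolding fourier_def by measurable

text \<open>
  The derivative of \<open>cis (- \<tau> x) \<phi> x\<close> is again Schwartz and has integral 0.
\<close>

lemma fourier_vderiv:
  assumes "\<phi> \<in> schwartz" shows "fourier (vderiv \<phi>) \<tau> = \<i> * \<tau> * fourier \<phi> \<tau>"
proof -
  let ?u = "\<lambda>x. cis (- \<tau> * x) * \<phi> x"
  have d: "vderiv ?u x = cis (- (\<tau> * x)) * vderiv \<phi> x - \<i> * \<tau> * (cis (- (\<tau> * x)) * \<phi> x)" for x
    using vector_derivative_at[OF has_vector_derivative_mult[OF has_vector_derivative_cis[of "- \<tau>" x UNIV] schwartz_has_vderiv[OF assms, of x]]]
    by (simp add: algebra_simps)
  have "0 = (\<integral>x. vderiv ?u x \<partial>lborel)"
    by (rule schwartz_integral_vderiv[OF schwartz_modulate[OF assms], symmetric])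
  also have "\<dots> = fourier (vderiv \<phi>) \<tau> - \<i> * \<tau> * fourier \<phi> \<tau>"
    unfolding d fourier_def
    by (subst Bochner_Integration.integral_diff)
       (simp_all add: integrable_cis_mult schwartz_integrable schwartz_vderiv assms)
  finally show ?thesis by simp
qed

text \<open>
  A quadratic bound of the remainder of an integrand can be integrated. In this way integrals that depend
  on a parameter, real or complex, are differentiated under the integral sign.
\<close>

lemma has_derivative_quadratic:
  fixes F :: "'a::real_normed_vector \<Rightarrow> 'b::real_normed_vector"
  assumes "bounded_linear D" "0 < e"
    and b: "\<And>y. dist y x < e \<Longrightarrow> norm (F y - F x - D (y - x)) \<le> C * norm (y - x) ^ 2"
  shows "(F has_derivative D) (at x)"
proof (rule has_derivativeI_sandwich[OF assms(2,1), where s = UNIV and H = "\<lambda>y. C * norm (y - x)"])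
  fix y assume "y \<in> UNIV" and y: "y \<noteq> x" "dist y x < e"
  then have "norm (F y - F x - D (y - x)) / norm (y - x) \<le> C * norm (y - x) ^ 2 / norm (y - x)"
    by (intro divide_right_mono b) auto
  then show "norm (F y - F x - D (y - x)) / norm (y - x) \<le> C * norm (y - x)"
    using y by (simp add: power2_eq_square)
next
  show "((\<lambda>y. C * norm (y - x)) \<longlongrightarrow> 0) (at x)"
    by (auto intro!: tendsto_eq_intros)
qed

lemma norm_cis_remainder: "norm (cis t - 1 - \<i> * t) \<le> t\<^sup>2"
proof -
  have "2 * norm (cis t - 1 - \<i> * t) \<le> t\<^sup>2"
    using iexp_approx1[of t 1] by (simp add: cis_conv_exp power2_eq_square algebra_simps)
  then show ?thesis using norm_ge_zero[of "cis t - 1 - \<i> * t"] by linarith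
qed

text \<open>
  The quadratic remainder of \<open>cis\<close> brings down a factor \<open>x^2\<close>, against which \<open>\<phi>\<close> is still integrable.
\<close>

lemma fourier_has_vderiv:
  assumes "\<phi> \<in> schwartz"
  shows "(fourier \<phi> has_vector_derivative fourier (\<lambda>x. - \<i> * (of_real x * \<phi> x)) \<tau>) (at \<tau>)"
  unfolding has_vector_derivative_def
proof (rule has_derivative_quadratic)
  let ?\<psi> = "\<lambda>x. - \<i> * (of_real x * \<phi> x)"
  have i1: "integrable lborel \<phi>" and i2: "integrable lborel ?\<psi>"
    and i3: "integrable lborel (\<lambda>x. of_real x * (of_real x * \<phi> x))"
    by (intro schwartz_integrable schwartz_cmult schwartz_times_x assms)+
  fix y :: real
  have "fourier \<phi> y - fourier \<phi> \<tau> - (y - \<tau>) *\<^sub>R fourier ?\<psi> \<tau> =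
      (\<integral>x. cis (- (y * x)) * \<phi> x - cis (- (\<tau> * x)) * \<phi> x - (y - \<tau>) *\<^sub>R (cis (- (\<tau> * x)) * ?\<psi> x) \<partial>lborel)"
    unfolding fourier_def using integrable_cis_mult[OF i1] integrable_cis_mult[OF i2, of \<tau>]
    by (subst Bochner_Integration.integral_diff Bochner_Integration.integral_scaleR_right
        | intro Bochner_Integration.integrable_diff integrable_scaleR_right | simp)+
  also have "norm \<dots> \<le> (\<integral>x. (y - \<tau>)\<^sup>2 * norm (of_real x * (of_real x * \<phi> x)) \<partial>lborel)"
  proof (rule Bochner_Integration.integral_norm_bound_integral)
    fix x
    have "cis (- (y * x)) = cis (- (\<tau> * x)) * cis (- ((y - \<tau>) * x))"
      by (simp add: cis_mult algebra_simps)
    then have "cis (- (y * x)) * \<phi> x - cis (- (\<tau> * x)) * \<phi> x - (y - \<tau>) *\<^sub>R (cis (- (\<tau> * x)) * ?\<psi> x)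
      = cis (- (\<tau> * x)) * (cis (- ((y - \<tau>) * x)) - 1 - \<i> * (- ((y - \<tau>) * x))) * \<phi> x"
      by (simp add: algebra_simps scaleR_conv_of_real)
    then have "norm (cis (- (y * x)) * \<phi> x - cis (- (\<tau> * x)) * \<phi> x - (y - \<tau>) *\<^sub>R (cis (- (\<tau> * x)) * ?\<psi> x))
       = norm (cis (- ((y - \<tau>) * x)) - 1 - \<i> * (- ((y - \<tau>) * x))) * norm (\<phi> x)"
      by (simp add: norm_mult)
    also have "\<dots> \<le> (- ((y - \<tau>) * x))\<^sup>2 * norm (\<phi> x)"
      using norm_cis_remainder[of "- ((y - \<tau>) * x)"] by (intro mult_right_mono) simp_all
    finally show "norm (cis (- (y * x)) * \<phi> x - cis (- (\<tau> * x)) * \<phi> x - (y - \<tau>) *\<^sub>R (cis (- (\<tau> * x)) * ?\<psi> x))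
      \<le> (y - \<tau>)\<^sup>2 * norm (of_real x * (of_real x * \<phi> x))"
      by (simp add: norm_mult power_mult_distrib power2_eq_square mult_ac)
  next
    show "integrable lborel (\<lambda>x. (y - \<tau>)\<^sup>2 * norm (of_real x * (of_real x * \<phi> x)))"
      using i3 by (intro integrable_mult_right integrable_norm)
    show "integrable lborel (\<lambda>x. cis (- (y * x)) * \<phi> x - cis (- (\<tau> * x)) * \<phi> x - (y - \<tau>) *\<^sub>R (cis (- (\<tau> * x)) * ?\<psi> x))"
      by (intro Bochner_Integration.integrable_diff integrable_scaleR_right integrable_cis_mult i1 i2)
  qed
  finally show "norm (fourier \<phi> y - fourier \<phi> \<tau> - (y - \<tau>) *\<^sub>R fourier ?\<psi> \<tau>)
     \<le> (\<integral>x. norm (of_real x * (of_real x * \<phi> x)) \<partial>lborel) * norm (y - \<tau>) ^ 2"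
    by (simp add: mult_ac)
qed (auto intro: bounded_linear_scaleR_left zero_less_one)

text \<open>
  The transform turns multiplication by \<open>- i x\<close> into differentiation, so its image is closed under
  derivatives; each power of \<open>\<tau>\<close> in front of it is paid for by one derivative of \<open>\<phi>\<close>.
\<close>

lemma schwartz_fourier:
  assumes "\<phi> \<in> schwartz" shows "fourier \<phi> \<in> schwartz"
proof (rule schwartz_image[where T = fourier, OF assms])
  fix \<phi> :: "real \<Rightarrow> complex" and j assume p: "\<phi> \<in> schwartz"
  show "\<exists>\<psi>\<in>schwartz. \<forall>x. (fourier \<phi> has_vector_derivative fourier \<psi> x) (at x)"
    by (intro bexI[of _ "\<lambda>x. - \<i> * (of_real x * \<phi> x)"] allI fourier_has_vderiv schwartz_cmult schwartz_times_x p)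
  show "\<exists>C. \<forall>x. \<bar>x\<bar> ^ j * norm (fourier \<phi> x) \<le> C"
    using p
  proof (induction j arbitrary: \<phi>)
    case 0
    then show ?case using norm_fourier_le[of \<phi>] by auto
  next
    case (Suc j)
    from Suc.IH[OF schwartz_vderiv[OF Suc.prems]] show ?case
      by (simp add: fourier_vderiv[OF Suc.prems] norm_mult mult_ac)
  qed
qed

lemma schwartz_ifourier: "\<phi> \<in> schwartz \<Longrightarrow> ifourier \<phi> \<in> schwartz"
proof -
  assume "\<phi> \<in> schwartz"
  from schwartz_cmult[OF schwartz_reflect[OF schwartz_fourier[OF this]], of "1 / (2 * pi)"] show ?thesis
    by (simp add: ifourier_def[abs_def])
qed

lemma ifourier_measurable [measurable]:
  assumes [measurable]: "\<phi> \<in> borel_measurable borel" shows "ifourier \<phi> \<in> borel_measurable borel"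
  unfolding ifourier_def[abs_def] by measurable

text \<open>
  Used with the Fourier kernel and with the Cauchy kernel on a line.
\<close>

lemma Fubini_bounded_kernel:
  fixes u v :: "real \<Rightarrow> complex" and k :: "real \<Rightarrow> real \<Rightarrow> complex"
  assumes k [measurable]: "case_prod k \<in> borel_measurable (borel \<Otimes>\<^sub>M borel)"
    and B: "\<And>x y. norm (k x y) \<le> B"
    and u: "integrable lborel u" and v: "integrable lborel v"
  shows "(\<integral>y. (\<integral>x. k x y * u x \<partial>lborel) * v y \<partial>lborel) = (\<integral>x. u x * (\<integral>y. k x y * v y \<partial>lborel) \<partial>lborel)"
proof -
  note [measurable] = borel_measurable_integrable[OF u] borel_measurable_integrable[OF v]
  have k1: "(\<lambda>y. k x y) \<in> borel_measurable borel" "(\<lambda>y. k y x) \<in> borel_measurable borel" for x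
    by measurable
  have ku: "integrable lborel (\<lambda>x. k x y * u x)" for y
    by (rule Bochner_Integration.integrable_bound[OF integrable_mult_right[OF integrable_norm[OF u], of B]])
      (auto simp: norm_mult intro!: AE_I2 order_trans[OF mult_right_mono[OF B]])
  have kv: "integrable lborel (\<lambda>y. k x y * v y)" for x
    by (rule Bochner_Integration.integrable_bound[OF integrable_mult_right[OF integrable_norm[OF v], of B]])
      (auto simp: norm_mult intro!: AE_I2 order_trans[OF mult_right_mono[OF B]])
  have "integrable (lborel \<Otimes>\<^sub>M lborel) (\<lambda>(x, y). k x y * u x * v y)"
  proof (rule lborel_pair.Fubini_integrable)
    have "integrable lborel (\<lambda>x. \<integral>y. norm (k x y * u x * v y) \<partial>lborel)"
    proof (rule Bochner_Integration.integrable_bound[OF integrable_mult_right[OF integrable_norm[OF u], of "B * (\<integral>y. norm (v y) \<partial>lborel)"]])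
      show "AE x in lborel. norm (\<integral>y. norm (k x y * u x * v y) \<partial>lborel) \<le> norm (B * (\<integral>y. norm (v y) \<partial>lborel) * norm (u x))"
      proof (intro AE_I2)
        fix x
        have "norm (\<integral>y. norm (k x y * u x * v y) \<partial>lborel) \<le> (\<integral>y. (B * norm (u x)) * norm (v y) \<partial>lborel)"
          using integrable_mult_left[OF kv[of x], of "u x"]
          by (intro Bochner_Integration.integral_norm_bound_integral integrable_norm integrable_mult_right v)
            (use mult_right_mono[OF B, of "norm (u x) * norm (v _)"] in \<open>auto simp: norm_mult mult_ac\<close>)
        then show "norm (\<integral>y. norm (k x y * u x * v y) \<partial>lborel) \<le> norm (B * (\<integral>y. norm (v y) \<partial>lborel) * norm (u x))"
          by (simp add: mult_ac)
      qed
    qed measurable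
    then show "integrable lborel (\<lambda>x. \<integral>y. norm (case (x, y) of (x, y) \<Rightarrow> k x y * u x * v y) \<partial>lborel)" by simp
    show "AE x in lborel. integrable lborel (\<lambda>y. case (x, y) of (x, y) \<Rightarrow> k x y * u x * v y)"
      using integrable_mult_left[OF kv] by (simp add: mult_ac)
  qed (simp add: k1)
  from lborel_pair.Fubini_integral[OF this] have "(\<integral>y. (\<integral>x. k x y * u x * v y \<partial>lborel) \<partial>lborel) = (\<integral>x. (\<integral>y. u x * (k x y * v y) \<partial>lborel) \<partial>lborel)"
    by (simp add: mult_ac)
  then show ?thesis by simp
qed

lemma fourier_swap:
  assumes "integrable lborel u" "integrable lborel v"
  shows "(\<integral>y. fourier u y * v y \<partial>lborel) = (\<integral>x. u x * fourier v x \<partial>lborel)"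
  using Fubini_bounded_kernel[of "\<lambda>x y. cis (- (y * x))" 1 u v] assms
  by (simp add: fourier_def mult.commute[of "_::real"])

text \<open>
  The Laplace transform of 1. It produces the Poisson kernel in the inversion formula and the Cauchy
  kernel in the cut-off to a half-line.
\<close>

lemma integral_exp_halfline:
  assumes "Re w > 0"
  shows "integrable lborel (\<lambda>x. indicator {0<..} x *\<^sub>R exp (- w * of_real x))"
    and "(\<integral>x. indicator {0<..} x *\<^sub>R exp (- w * of_real x) \<partial>lborel) = 1 / w"
proof -
  have e: "einterval 0 \<infinity> = {0<..}" by (auto simp: einterval_def zero_ereal_def)
  have m: "(\<lambda>x. exp (- w * of_real x)) \<in> borel_measurable borel"
    by (intro borel_measurable_continuous_onI continuous_intros)
  have i: "set_integrable lborel {0<..} (\<lambda>x. exp (- w * of_real x))"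
    unfolding set_integrable_def
    by (rule Bochner_Integration.integrable_bound[OF integrable_I0i_exp_mscale[OF assms, unfolded set_integrable_def]])
      (use m in \<open>auto simp: indicator_def mult_ac\<close>)
  then show "integrable lborel (\<lambda>x. indicator {0<..} x *\<^sub>R exp (- w * of_real x))"
    by (simp add: set_integrable_def)
  have w: "w \<noteq> 0" using assms by auto
  have "(LBINT x=0..\<infinity>. exp (- w * of_real x)) = 0 - (- 1 / w)"
  proof (rule interval_integral_FTC_integrable)
    fix x
    have "((\<lambda>z. - exp (- w * z) / w) has_field_derivative exp (- w * of_real x)) (at (of_real x))"
      using w by (auto intro!: derivative_eq_intros)
    from has_vector_derivative_real_field[OF this]
    show "((\<lambda>x. - exp (- w * of_real x) / w) has_vector_derivative exp (- w * of_real x)) (at x)" .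
    have "((\<lambda>x. - exp (- w * of_real x) / w) \<longlongrightarrow> - exp (- w * of_real 0) / w) (at_right (0::real))"
      using w by (intro tendsto_intros)
    then show "(((\<lambda>x. - exp (- w * of_real x) / w) \<circ> real_of_ereal) \<longlongrightarrow> - 1 / w) (at_right 0)"
      by (simp add: zero_ereal_def at_right_ereal filterlim_filtermap o_def)
    have "((\<lambda>x. exp (- Re w * x) / norm w) \<longlongrightarrow> 0) at_top"
      using assms w zero_less_norm_iff[of w] by real_asymp
    then have "((\<lambda>x. - exp (- w * of_real x) / w) \<longlongrightarrow> 0) at_top"
      by (rule Lim_null_comparison[rotated]) (auto simp: norm_divide)
    then show "(((\<lambda>x. - exp (- w * of_real x) / w) \<circ> real_of_ereal) \<longlongrightarrow> 0) (at_left \<infinity>)"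
      by (simp add: at_left_PInf filterlim_filtermap o_def)
  qed (use i in \<open>auto simp: e\<close>)
  then show "(\<integral>x. indicator {0<..} x *\<^sub>R exp (- w * of_real x) \<partial>lborel) = 1 / w"
    by (simp add: interval_lebesgue_integral_0_infty set_lebesgue_integral_def)
qed

text \<open>
  The Poisson kernel is the Fourier transform of \<open>exp (- e |x|)\<close>.
\<close>

lemma integral_exp_abs_cis:
  assumes "e > 0"
  shows "integrable lborel (\<lambda>x. of_real (exp (- e * \<bar>x\<bar>)) * cis (a * x))"
    and "(\<integral>x. of_real (exp (- e * \<bar>x\<bar>)) * cis (a * x) \<partial>lborel) = of_real (2 * e / (e\<^sup>2 + a\<^sup>2))"
proof -
  let ?f = "\<lambda>a x. indicator {0<..} x *\<^sub>R exp (- (of_real e - \<i> * of_real a) * of_real x)"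
  have i: "integrable lborel (?f a)" "integrable lborel (\<lambda>x. ?f (-a) (0 + (-1) * x))"
    using assms by (intro integral_exp_halfline(1) lborel_integrable_real_affine; simp)+
  have v: "(\<integral>x. ?f a x \<partial>lborel) = 1 / (of_real e - \<i> * of_real a)"
    "(\<integral>x. ?f (-a) (0 + (-1) * x) \<partial>lborel) = 1 / (of_real e + \<i> * of_real a)"
    using assms integral_exp_halfline(2)[of "of_real e - \<i> * of_real a"]
      integral_exp_halfline(2)[of "of_real e + \<i> * of_real a"]
      lborel_integral_real_affine[of "-1" "?f (-a)" 0]
    by simp_all
  have eq: "AE x in lborel. of_real (exp (- e * \<bar>x\<bar>)) * cis (a * x) = ?f a x + ?f (-a) (0 + (-1) * x)"
    using AE_lborel_singleton[of 0]
    by eventually_elim (auto simp: indicator_def cis_conv_exp exp_of_real[symmetric] exp_add[symmetric] algebra_simps)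
  have m: "(\<lambda>x. of_real (exp (- e * \<bar>x\<bar>)) * cis (a * x)) \<in> borel_measurable lborel" by measurable
  show "integrable lborel (\<lambda>x. of_real (exp (- e * \<bar>x\<bar>)) * cis (a * x))"
    by (rule integrable_cong_AE_imp[OF Bochner_Integration.integrable_add[OF i] m])
      (use eq in \<open>auto elim: eventually_mono\<close>)
  have "(\<integral>x. of_real (exp (- e * \<bar>x\<bar>)) * cis (a * x) \<partial>lborel) = (\<integral>x. ?f a x + ?f (-a) (0 + (-1) * x) \<partial>lborel)"
    by (rule integral_cong_AE[OF m _ eq]) (use i in measurable)
  also have "\<dots> = 1 / (of_real e - \<i> * of_real a) + 1 / (of_real e + \<i> * of_real a)"
    by (subst Bochner_Integration.integral_add[OF i]) (simp only: v)
  also have "\<dots> = of_real (2 * e / (e\<^sup>2 + a\<^sup>2))"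
  proof -
    have "of_real e - \<i> * of_real a \<noteq> 0" "of_real e + \<i> * of_real a \<noteq> 0"
      using assms by (auto simp: complex_eq_iff)
    moreover have "(of_real e - \<i> * of_real a) * (of_real e + \<i> * of_real a) = of_real (e\<^sup>2 + a\<^sup>2)"
      by (simp add: algebra_simps power2_eq_square)
    ultimately show ?thesis by (subst add_frac_eq) (simp_all add: mult.commute)
  qed
  finally show "(\<integral>x. of_real (exp (- e * \<bar>x\<bar>)) * cis (a * x) \<partial>lborel) = of_real (2 * e / (e\<^sup>2 + a\<^sup>2))" .
qed

lemma integral_reflect: "(\<integral>x. f (- x) \<partial>lborel) = (\<integral>x. f x \<partial>lborel)" for f :: "real \<Rightarrow> complex"
  using lborel_integral_real_affine[of "-1" f 0] by simp

lemma integrable_reflect: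
  "integrable lborel f \<Longrightarrow> integrable lborel (\<lambda>x. f (- x))" for f :: "real \<Rightarrow> complex"
  using lborel_integrable_real_affine[of f "-1" 0] by simp

lemma fourier_reflect: "fourier (\<lambda>x. \<phi> (- x)) \<tau> = fourier \<phi> (- \<tau>)"
  unfolding fourier_def using integral_reflect[of "\<lambda>x. cis (- (- \<tau> * x)) * \<phi> x"] by simp

lemma scaleR_times_of_real: "r *\<^sub>R (z * of_real s) = z * of_real (r * s)" for z :: complex
  by (simp add: scaleR_conv_of_real)

text \<open>
  With the convergence factor \<open>exp (- e |\<tau>|)\<close> in the inversion integral, the multiplication
  formula turns it into an average of \<open>\<phi>\<close> against the Poisson kernel of width \<open>e\<close>. Rescaling by \<open>e\<close> fixes the
  kernel, of total mass \<open>2 pi\<close>, and concentrates the argument of \<open>\<phi>\<close> at \<open>x\<close> as \<open>e\<close> tends to 0.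
\<close>

lemma fourier_inversion:
  assumes p: "\<phi> \<in> schwartz" shows "ifourier (fourier \<phi>) = \<phi>"
proof
  fix x
  \<comment> \<open>The widths of the Poisson kernels.\<close>
  define e where "e n = 1 / real (Suc n)" for n
  have e: "e n > 0" for n by (simp add: e_def)
  have e0: "e \<longlonglongrightarrow> 0" unfolding e_def[abs_def] by (rule LIMSEQ_inverse_real_of_nat[unfolded inverse_eq_divide])
  let ?v = "\<lambda>n \<tau>. of_real (exp (- e n * \<bar>\<tau>\<bar>)) * cis (x * \<tau>)"
  note pf = schwartz_fourier[OF p]
  note [measurable] = schwartz_measurable[OF p] schwartz_measurable[OF pf]
  obtain C where C: "C \<ge> 0" "\<And>x. norm (\<phi> x) \<le> C"
    using schwartz_boundE[OF p, of 0 thesis] by simp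
  have eq: "(\<integral>\<tau>. fourier \<phi> \<tau> * ?v n \<tau> \<partial>lborel) = (\<integral>t. \<phi> (x + e n * t) * of_real (2 * inverse (1 + t\<^sup>2)) \<partial>lborel)" for n
  proof -
    have "(\<integral>\<tau>. fourier \<phi> \<tau> * ?v n \<tau> \<partial>lborel) = (\<integral>y. \<phi> y * fourier (?v n) y \<partial>lborel)"
      by (rule fourier_swap[OF schwartz_integrable[OF p] integral_exp_abs_cis(1)[OF e]])
    also have "\<dots> = (\<integral>y. \<phi> y * of_real (2 * e n / ((e n)\<^sup>2 + (x - y)\<^sup>2)) \<partial>lborel)"
    proof (rule Bochner_Integration.integral_cong[OF refl])
      fix y
      have "fourier (?v n) y = (\<integral>\<tau>. of_real (exp (- e n * \<bar>\<tau>\<bar>)) * cis ((x - y) * \<tau>) \<partial>lborel)"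
        unfolding fourier_def
      proof (rule Bochner_Integration.integral_cong[OF refl])
        fix t
        have "cis (- (y * t)) * cis (x * t) = cis ((x - y) * t)" by (simp add: cis_mult left_diff_distrib)
        then show "cis (- (y * t)) * ?v n t = of_real (exp (- e n * \<bar>t\<bar>)) * cis ((x - y) * t)"
          by (metis mult.left_commute)
      qed
      also have "\<dots> = of_real (2 * e n / ((e n)\<^sup>2 + (x - y)\<^sup>2))" by (rule integral_exp_abs_cis(2)[OF e])
      finally show "\<phi> y * fourier (?v n) y = \<phi> y * of_real (2 * e n / ((e n)\<^sup>2 + (x - y)\<^sup>2))" by simp
    qed
    also have "\<dots> = \<bar>e n\<bar> *\<^sub>R (\<integral>t. \<phi> (x + e n * t) * of_real (2 * e n / ((e n)\<^sup>2 + (x - (x + e n * t))\<^sup>2)) \<partial>lborel)"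
      by (rule lborel_integral_real_affine) (use e[of n] in simp)
    also have "\<dots> = (\<integral>t. e n *\<^sub>R (\<phi> (x + e n * t) * of_real (2 * e n / ((e n)\<^sup>2 + (x - (x + e n * t))\<^sup>2))) \<partial>lborel)"
      using e[of n] by simp
    also have "\<dots> = (\<integral>t. \<phi> (x + e n * t) * of_real (2 * inverse (1 + t\<^sup>2)) \<partial>lborel)"
    proof (rule Bochner_Integration.integral_cong[OF refl])
      fix t
      have "e n * (2 * e n / ((e n)\<^sup>2 + (x - (x + e n * t))\<^sup>2)) = 2 * inverse (1 + t\<^sup>2)"
      proof -
        have "(e n)\<^sup>2 + (x - (x + e n * t))\<^sup>2 = (e n)\<^sup>2 * (1 + t\<^sup>2)" by (simp add: power2_eq_square algebra_simps)
        moreover have "1 + t\<^sup>2 \<noteq> 0" by (metis add_pos_nonneg less_numeral_extra(1) less_irrefl zero_le_power2)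
        ultimately show ?thesis using e[of n] by (simp add: power2_eq_square inverse_eq_divide)
      qed
      then have "e n *\<^sub>R (\<phi> (x + e n * t) * of_real (2 * e n / ((e n)\<^sup>2 + (x - (x + e n * t))\<^sup>2))) =
         \<phi> (x + e n * t) * of_real (2 * inverse (1 + t\<^sup>2))"
        using scaleR_times_of_real[of "e n" "\<phi> (x + e n * t)"] by (simp only:)
      then show "e n *\<^sub>R (\<phi> (x + e n * t) * of_real (2 * e n / ((e n)\<^sup>2 + (x - (x + e n * t))\<^sup>2))) =
         \<phi> (x + e n * t) * of_real (2 * inverse (1 + t\<^sup>2))" .
    qed
    finally show ?thesis .
  qed
  have "(\<lambda>n. \<integral>\<tau>. fourier \<phi> \<tau> * ?v n \<tau> \<partial>lborel) \<longlonglongrightarrow> (\<integral>\<tau>. fourier \<phi> \<tau> * cis (x * \<tau>) \<partial>lborel)"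
  proof (rule integral_dominated_convergence[where w = "\<lambda>\<tau>. norm (fourier \<phi> \<tau>)"])
    show "AE \<tau> in lborel. (\<lambda>n. fourier \<phi> \<tau> * ?v n \<tau>) \<longlonglongrightarrow> fourier \<phi> \<tau> * cis (x * \<tau>)"
    proof (rule AE_I2)
      fix \<tau>
      have "(\<lambda>n. fourier \<phi> \<tau> * ?v n \<tau>) \<longlonglongrightarrow> fourier \<phi> \<tau> * (of_real (exp (- 0 * \<bar>\<tau>\<bar>)) * cis (x * \<tau>))"
        by (intro tendsto_intros e0)
      then show "(\<lambda>n. fourier \<phi> \<tau> * ?v n \<tau>) \<longlonglongrightarrow> fourier \<phi> \<tau> * cis (x * \<tau>)" by simp
    qed
    show "AE \<tau> in lborel. norm (fourier \<phi> \<tau> * ?v n \<tau>) \<le> norm (fourier \<phi> \<tau>)" for n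
      using e[of n] by (intro AE_I2) (auto simp: norm_mult intro!: mult_left_le)
  qed (use schwartz_integrable[OF pf] in auto)
  moreover have "(\<lambda>n. \<integral>t. \<phi> (x + e n * t) * of_real (2 * inverse (1 + t\<^sup>2)) \<partial>lborel) \<longlonglongrightarrow> (\<integral>t. \<phi> x * of_real (2 * inverse (1 + t\<^sup>2)) \<partial>lborel)"
  proof (rule integral_dominated_convergence[where w = "\<lambda>t. (C * 2) * inverse (1 + t\<^sup>2)"])
    have c: "isCont \<phi> x" by (rule has_vector_derivative_continuous[OF schwartz_has_vderiv[OF p]])
    show "AE t in lborel. (\<lambda>n. \<phi> (x + e n * t) * of_real (2 * inverse (1 + t\<^sup>2))) \<longlonglongrightarrow> \<phi> x * of_real (2 * inverse (1 + t\<^sup>2))"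
    proof (rule AE_I2)
      fix t
      have "(\<lambda>n. x + e n * t) \<longlonglongrightarrow> x + 0 * t" by (intro tendsto_intros e0)
      then have "(\<lambda>n. \<phi> (x + e n * t)) \<longlonglongrightarrow> \<phi> x" using isCont_tendsto_compose[OF c] by simp
      then show "(\<lambda>n. \<phi> (x + e n * t) * of_real (2 * inverse (1 + t\<^sup>2))) \<longlonglongrightarrow> \<phi> x * of_real (2 * inverse (1 + t\<^sup>2))"
        by (intro tendsto_intros)
    qed
    show "AE t in lborel. norm (\<phi> (x + e n * t) * of_real (2 * inverse (1 + t\<^sup>2))) \<le> (C * 2) * inverse (1 + t\<^sup>2)" for n
    proof (rule AE_I2)
      fix t
      have "norm (\<phi> (x + e n * t)) * (2 * inverse (1 + t\<^sup>2)) \<le> C * (2 * inverse (1 + t\<^sup>2))"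
        by (intro mult_right_mono C) auto
      moreover have "norm (complex_of_real (2 * inverse (1 + t\<^sup>2))) = 2 * inverse (1 + t\<^sup>2)"
        unfolding norm_of_real by (simp add: abs_of_nonneg)
      ultimately show "norm (\<phi> (x + e n * t) * of_real (2 * inverse (1 + t\<^sup>2))) \<le> (C * 2) * inverse (1 + t\<^sup>2)"
        by (simp add: norm_mult)
    qed
    show "integrable lborel (\<lambda>t. (C * 2) * inverse (1 + t\<^sup>2))"
      by (intro integrable_mult_right integrable_inverse_1_plus_square)
  qed auto
  ultimately have "(\<integral>\<tau>. fourier \<phi> \<tau> * cis (x * \<tau>) \<partial>lborel) = (\<integral>t. \<phi> x * of_real (2 * inverse (1 + t\<^sup>2)) \<partial>lborel)"
    unfolding eq using LIMSEQ_unique by blast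
  also have "\<dots> = \<phi> x * of_real (2 * (\<integral>t. inverse (1 + t\<^sup>2) \<partial>lborel))"
    by (simp only: integral_mult_right_zero integral_complex_of_real)
  also have "\<dots> = \<phi> x * (2 * pi)" unfolding integral_inverse_1_plus_square by simp
  finally have "fourier (fourier \<phi>) (- x) = \<phi> x * (2 * pi)"
    by (simp add: fourier_def[of "fourier \<phi>"] mult.commute)
  then show "ifourier (fourier \<phi>) x = \<phi> x"
    by (simp add: ifourier_def)
qed

lemma fourier_ifourier:
  assumes p: "\<phi> \<in> schwartz" shows "fourier (ifourier \<phi>) = \<phi>"
proof
  fix x
  have "fourier (ifourier \<phi>) x = fourier (\<lambda>y. 1 / (2 * pi) * fourier \<phi> (- y)) x"
    by (simp add: ifourier_def[abs_def])
  also have "\<dots> = ifourier (fourier \<phi>) x"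
    unfolding fourier_cmult fourier_reflect[of "fourier \<phi>"] by (simp add: ifourier_def)
  finally show "fourier (ifourier \<phi>) x = \<phi> x" by (simp add: fourier_inversion[OF p])
qed

lemma ifourier_swap:
  assumes "integrable lborel u" "integrable lborel v"
  shows "(\<integral>y. ifourier u y * v y \<partial>lborel) = (\<integral>x. u x * ifourier v x \<partial>lborel)"
proof -
  have "(\<integral>y. ifourier u y * v y \<partial>lborel) = (\<integral>y. fourier u (- y) * v (- (- y)) \<partial>lborel) / (2 * pi)"
    by (simp add: ifourier_def)
  also have "(\<integral>y. fourier u (- y) * v (- (- y)) \<partial>lborel) = (\<integral>y. fourier u y * v (- y) \<partial>lborel)"
    by (rule integral_reflect)
  also have "\<dots> = (\<integral>x. u x * fourier (\<lambda>y. v (- y)) x \<partial>lborel)"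
    by (rule fourier_swap[OF assms(1) integrable_reflect[OF assms(2)]])
  also have "\<dots> / (2 * pi) = (\<integral>x. u x * ifourier v x \<partial>lborel)"
    by (simp add: ifourier_def fourier_reflect)
  finally show ?thesis .
qed

lemma norm_ifourier_le: "norm (ifourier u \<tau>) \<le> (\<integral>x. norm (u x) \<partial>lborel)"
proof -
  have "norm (ifourier u \<tau>) \<le> (\<integral>x. norm (u x) \<partial>lborel) / (2 * pi)"
    unfolding ifourier_def norm_divide using norm_fourier_le[of u "- \<tau>"] by (simp add: divide_right_mono)
  also have "\<dots> \<le> (\<integral>x. norm (u x) \<partial>lborel) / 1"
    using pi_ge_two by (intro divide_left_mono) auto
  finally show ?thesis by simp
qed

lemma ifourier_vderiv:
  assumes "u \<in> schwartz" shows "norm (ifourier (vderiv u) \<tau>) = \<bar>\<tau>\<bar> * norm (ifourier u \<tau>)"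
  by (simp add: ifourier_def fourier_vderiv[OF assms] norm_mult norm_divide)

text \<open>
  Only the \<open>L^1\<close> norms of \<open>u\<close> and of its derivative enter, and these stay bounded when \<open>u\<close> approaches a
  function with a jump.
\<close>

lemma ifourier_decay1:
  assumes "u \<in> schwartz"
  shows "(1 + \<bar>\<tau>\<bar>) * norm (ifourier u \<tau>) \<le> (\<integral>x. norm (u x) \<partial>lborel) + (\<integral>x. norm (vderiv u x) \<partial>lborel)"
  using norm_ifourier_le[of u \<tau>] norm_ifourier_le[of "vderiv u" \<tau>] unfolding ifourier_vderiv[OF assms]
  by (simp add: algebra_simps)

section \<open>Logistic functions\<close>

text \<open>
  A smooth step at \<open>a\<close> of steepness \<open>n\<close>. It solves \<open>L' = n L (1 - L)\<close>, so that all its derivatives are polynomials in \<open>L\<close>.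
\<close>

definition logistic :: "real \<Rightarrow> real \<Rightarrow> real \<Rightarrow> real" where
  "logistic n a x = 1 / (1 + exp (- n * (x - a)))"

lemma logistic_bounds: "0 < logistic n a x" "logistic n a x < 1"
  unfolding logistic_def by (auto simp: add_pos_pos)

lemma norm_logistic: "norm (complex_of_real (logistic n a x)) \<le> 1"
  using logistic_bounds[of n a x] by simp

lemma DERIV_logistic:
  "(logistic n a has_real_derivative n * (logistic n a x * (1 - logistic n a x))) (at x)"
proof -
  have p: "1 + exp (- n * (x - a)) > 0" by (simp add: add_pos_pos)
  have "(logistic n a has_real_derivative (n * exp (- n * (x - a))) / (1 + exp (- n * (x - a)))\<^sup>2) (at x)"
    unfolding logistic_def[abs_def] using p
    by (auto intro!: derivative_eq_intros simp: power2_eq_square field_simps)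
  also have "(n * exp (- n * (x - a))) / (1 + exp (- n * (x - a)))\<^sup>2 = n * (logistic n a x * (1 - logistic n a x))"
    unfolding logistic_def using p by (simp add: power2_eq_square divide_simps)
  finally show ?thesis .
qed

lemma continuous_logistic: "continuous_on A (logistic n a)"
  using DERIV_logistic DERIV_isCont continuous_at_imp_continuous_on by blast

lemma measurable_logistic [measurable]: "logistic n a \<in> borel_measurable borel"
  by (intro borel_measurable_continuous_onI continuous_logistic)

lemma logistic_tendsto_indicator:
  assumes "x \<noteq> a"
  shows "(\<lambda>n. logistic (real n) a x) \<longlonglongrightarrow> indicator {a<..} x"
proof (cases "x > a")
  case True
  then have "x - a > 0" by simp
  then have "((\<lambda>n. 1 / (1 + exp (- real n * (x - a)))) \<longlongrightarrow> 1) sequentially" by real_asymp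
  then show ?thesis using True by (simp add: logistic_def)
next
  case False
  then have "x - a < 0" using assms by simp
  then have "((\<lambda>n. 1 / (1 + exp (- real n * (x - a)))) \<longlongrightarrow> 0) sequentially" by real_asymp
  then show ?thesis using False by (simp add: logistic_def)
qed

text \<open>
  The functions generated from \<open>W\<close> by the step \<open>L\<close>. By the logistic equation this set is closed
  under differentiation as soon as the derivatives of \<open>W\<close> lie in it.
\<close>

inductive_set logistic_span :: "real \<Rightarrow> real \<Rightarrow> (real \<Rightarrow> complex) set \<Rightarrow> (real \<Rightarrow> complex) set"
  for n a W where
  base: "u \<in> W \<Longrightarrow> u \<in> logistic_span n a W"
| mult: "u \<in> logistic_span n a W \<Longrightarrow> (\<lambda>x. of_real (logistic n a x) * u x) \<in> logistic_span n a W"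
| add: "u \<in> logistic_span n a W \<Longrightarrow> v \<in> logistic_span n a W \<Longrightarrow> (\<lambda>x. u x + v x) \<in> logistic_span n a W"
| cmult: "u \<in> logistic_span n a W \<Longrightarrow> (\<lambda>x. c * u x) \<in> logistic_span n a W"

lemma logistic_span_subset_schwartz:
  assumes deriv: "\<And>w. w \<in> W \<Longrightarrow> \<exists>v\<in>logistic_span n a W. \<forall>x. (w has_vector_derivative v x) (at x)"
    and bdd: "\<And>w j. w \<in> W \<Longrightarrow> \<exists>C. \<forall>x. \<bar>x\<bar> ^ j * norm (w x) \<le> C"
    and u: "u \<in> logistic_span n a W"
  shows "u \<in> schwartz"
proof (rule schwartz_coinduct[OF u])
  fix u assume "u \<in> logistic_span n a W"
  then show "\<exists>v\<in>logistic_span n a W. \<forall>x. (u has_vector_derivative v x) (at x)"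
  proof induction
    case (base u)
    then show ?case by (rule deriv)
  next
    case (mult u)
    then obtain v where v: "v \<in> logistic_span n a W" "\<forall>x. (u has_vector_derivative v x) (at x)" by (elim bexE)
    let ?L = "\<lambda>x. complex_of_real (logistic n a x)"
    show ?case
    proof (intro bexI allI)
      fix x
      have "(?L has_vector_derivative of_real (n * (logistic n a x * (1 - logistic n a x)))) (at x)"
        by (rule has_vector_derivative_of_real[OF DERIV_logistic])
      from has_vector_derivative_mult[OF this v(2)[rule_format]]
      show "((\<lambda>x. ?L x * u x) has_vector_derivative
          (n * (?L x * u x) + - n * (?L x * (?L x * u x))) + ?L x * v x) (at x)"
        by (simp add: algebra_simps)
      show "(\<lambda>x. (n * (?L x * u x) + - n * (?L x * (?L x * u x))) + ?L x * v x) \<in> logistic_span n a W"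
        by (intro logistic_span.add logistic_span.cmult logistic_span.mult mult v)
    qed
  next
    case (add u v)
    from add.IH obtain u' v' where h: "u' \<in> logistic_span n a W" "\<forall>x. (u has_vector_derivative u' x) (at x)"
      "v' \<in> logistic_span n a W" "\<forall>x. (v has_vector_derivative v' x) (at x)" by (elim bexE)
    show ?case
      by (intro bexI[of _ "\<lambda>x. u' x + v' x"] allI has_vector_derivative_add h(2,4)[rule_format] logistic_span.add h)
  next
    case (cmult u c)
    then obtain v where v: "v \<in> logistic_span n a W" "\<forall>x. (u has_vector_derivative v x) (at x)" by (elim bexE)
    show ?case
      by (intro bexI[of _ "\<lambda>x. c * v x"] allI has_vector_derivative_mult_right v(2)[rule_format] logistic_span.cmult v)
  qed
next
  fix u j assume "u \<in> logistic_span n a W"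
  then show "\<exists>C. \<forall>x. \<bar>x\<bar> ^ j * norm (u x) \<le> C"
  proof induction
    case (base u)
    then show ?case by (rule bdd)
  next
    case (mult u)
    then obtain C where C: "\<forall>x. \<bar>x\<bar> ^ j * norm (u x) \<le> C" by (elim exE)
    have "\<bar>x\<bar> ^ j * norm (of_real (logistic n a x) * u x) \<le> C" for x
    proof -
      have "\<bar>x\<bar> ^ j * norm (of_real (logistic n a x) * u x) \<le> \<bar>x\<bar> ^ j * norm (u x)"
        using norm_logistic[of n a x] unfolding norm_mult
        by (intro mult_left_mono mult_left_le_one_le) auto
      then show ?thesis using C by (meson order_trans)
    qed
    then show ?case by blast
  next
    case (add u v)
    from add.IH obtain C C' where C: "\<forall>x. \<bar>x\<bar> ^ j * norm (u x) \<le> C" "\<forall>x. \<bar>x\<bar> ^ j * norm (v x) \<le> C'" by (elim exE)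
    have "\<bar>x\<bar> ^ j * norm (u x + v x) \<le> C + C'" for x
    proof -
      have "\<bar>x\<bar> ^ j * norm (u x + v x) \<le> \<bar>x\<bar> ^ j * (norm (u x) + norm (v x))"
        by (intro mult_left_mono norm_triangle_ineq) auto
      also have "\<dots> \<le> C + C'" unfolding distrib_left by (intro add_mono C[rule_format])
      finally show ?thesis .
    qed
    then show ?case by blast
  next
    case (cmult u c)
    then obtain C where C: "\<forall>x. \<bar>x\<bar> ^ j * norm (u x) \<le> C" by (elim exE)
    have "\<bar>x\<bar> ^ j * norm (c * u x) \<le> norm c * C" for x
      using mult_left_mono[OF C[rule_format, of x], of "norm c"] by (simp add: norm_mult mult_ac)
    then show ?case by blast
  qed
qed

lemma schwartz_logistic_mult:
  assumes "\<psi> \<in> schwartz" shows "(\<lambda>x. of_real (logistic n a x) * \<psi> x) \<in> schwartz"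
proof (rule logistic_span_subset_schwartz[where W = schwartz])
  show "(\<lambda>x. of_real (logistic n a x) * \<psi> x) \<in> logistic_span n a schwartz"
    by (intro logistic_span.mult logistic_span.base assms)
  show "\<exists>v\<in>logistic_span n a schwartz. \<forall>x. (w has_vector_derivative v x) (at x)" if "w \<in> schwartz" for w
    by (intro bexI[of _ "vderiv w"] allI schwartz_has_vderiv logistic_span.base schwartz_vderiv that)
qed (rule schwartz_bound)

text \<open>
  The derivative of the logistic function, a Schwartz function without zeros. Every measurable
  function is a multiple of it, so that indicators times \<open>bell\<close> can serve as the building blocks of
  integrable functions.
\<close>

definition bell :: "real \<Rightarrow> real" where
  "bell x = logistic 1 0 x * (1 - logistic 1 0 x)"

lemma bell_pos: "bell x > 0"
  unfolding bell_def using logistic_bounds[of 1 0 x] by simp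

lemma bell_le: "bell x \<le> exp (- \<bar>x\<bar>)"
proof -
  have p: "1 + exp (- x) > 0" by (simp add: add_pos_pos)
  have 1: "logistic 1 0 x \<le> exp x" "1 - logistic 1 0 x \<le> exp (- x)"
    unfolding logistic_def using p by (auto simp: field_simps exp_minus)
  show ?thesis
  proof (cases "x \<ge> 0")
    case True
    have "bell x \<le> 1 * exp (- x)" unfolding bell_def using 1 logistic_bounds[of 1 0 x]
      by (intro mult_mono) auto
    then show ?thesis using True by simp
  next
    case False
    have "bell x \<le> exp x * 1" unfolding bell_def using 1 logistic_bounds[of 1 0 x]
      by (intro mult_mono) auto
    then show ?thesis using False by simp
  qed
qed

lemma power_le_exp: "x \<ge> 0 \<Longrightarrow> x ^ j \<le> real j ^ j * exp x"
proof (cases "j = 0")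
  case False
  assume x: "x \<ge> 0"
  have "x / j \<le> exp (x / j)" using exp_ge_add_one_self[of "x / j"] by linarith
  then have "(x / j) ^ j \<le> exp (x / j) ^ j" using x by (intro power_mono) auto
  also have "\<dots> = exp x" using False by (simp flip: exp_of_nat_mult)
  finally show ?thesis using False by (simp add: power_divide field_simps)
qed simp

lemma schwartz_bell: "(\<lambda>x. of_real (bell x)) \<in> schwartz"
proof (rule logistic_span_subset_schwartz[where W = "{\<lambda>x. of_real (bell x)}" and n = 1 and a = 0])
  let ?b = "\<lambda>x. complex_of_real (bell x)"
  let ?W = "logistic_span 1 0 {?b}"
  show "?b \<in> ?W" by (intro logistic_span.base) simp
  show "\<exists>v\<in>?W. \<forall>x. (w has_vector_derivative v x) (at x)" if "w \<in> {?b}" for w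
  proof (intro bexI allI)
    fix x
    have "(bell has_real_derivative bell x + (- 2) * (logistic 1 0 x * bell x)) (at x)"
      unfolding bell_def[abs_def]
      by (rule derivative_eq_intros DERIV_logistic refl)+ (simp add: algebra_simps)
    from has_vector_derivative_of_real[OF this]
    show "(w has_vector_derivative ?b x + (- 2) * (of_real (logistic 1 0 x) * ?b x)) (at x)"
      using that by simp
    show "(\<lambda>x. ?b x + (- 2) * (of_real (logistic 1 0 x) * ?b x)) \<in> ?W"
      by (intro logistic_span.add logistic_span.cmult logistic_span.mult logistic_span.base) simp_all
  qed
  show "\<exists>C. \<forall>x. \<bar>x\<bar> ^ j * norm (w x) \<le> C" if "w \<in> {?b}" for w j
  proof (intro exI allI)
    fix x
    have "\<bar>x\<bar> ^ j * bell x \<le> (real j ^ j * exp \<bar>x\<bar>) * exp (- \<bar>x\<bar>)"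
      by (intro mult_mono power_le_exp bell_le) (auto simp: bell_pos less_imp_le)
    also have "\<dots> = real j ^ j" by (simp add: mult.assoc flip: exp_add)
    finally show "\<bar>x\<bar> ^ j * norm (w x) \<le> real j ^ j"
      using that bell_pos[of x] by simp
  qed
qed

lemma measurable_bell [measurable]: "bell \<in> borel_measurable borel"
  unfolding bell_def[abs_def] by measurable

section \<open>Uniqueness of the representing function\<close>

lemma borel_induct_greaterThan [consumes 1, case_names basic empty compl union]:
  assumes A: "A \<in> sets (borel :: real measure)"
    and basic: "\<And>a. P {a<..}" and empty: "P {}"
    and compl: "\<And>A. A \<in> sets borel \<Longrightarrow> P A \<Longrightarrow> P (- A)"
    and union: "\<And>A. disjoint_family A \<Longrightarrow> range A \<subseteq> sets borel \<Longrightarrow> (\<And>i. P (A i)) \<Longrightarrow> P (\<Union>i::nat. A i)"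
  shows "P A"
proof -
  have s: "sets (borel :: real measure) = sigma_sets UNIV (range greaterThan)"
    unfolding borel_Ioi by (rule sets_measure_of) simp
  have i: "Int_stable (range greaterThan :: real set set)"
    unfolding Int_stable_def
  proof (intro ballI)
    fix a b :: "real set" assume "a \<in> range greaterThan" "b \<in> range greaterThan"
    then obtain x y where "a = {x<..}" "b = {y<..}" by blast
    then have "a \<inter> b = {max x y<..}" by auto
    then show "a \<inter> b \<in> range greaterThan" by blast
  qed
  show ?thesis
  proof (rule sigma_sets_induct_disjoint[of "range greaterThan" UNIV A P])
    show "A \<in> sigma_sets UNIV (range greaterThan)" using A by (simp only: s)
    show "P B" if "B \<in> range greaterThan" for B using that basic by blast
    show "P (UNIV - B)" if "B \<in> sigma_sets UNIV (range greaterThan)" "P B" for B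
      using compl[of B] that by (simp add: s Compl_eq_Diff_UNIV)
    show "P (\<Union>i. B i)" if "disjoint_family B" "range B \<subseteq> sigma_sets UNIV (range greaterThan)" "\<And>i. P (B i)"
      for B :: "nat \<Rightarrow> real set" using union[of B] that by (simp add: s)
  qed (use i empty in auto)
qed

lemma AE_zero_of_set_integrals_real:
  fixes h :: "real \<Rightarrow> real"
  assumes h: "integrable lborel h"
    and z: "\<And>A. A \<in> sets borel \<Longrightarrow> (\<integral>x. indicator A x * h x \<partial>lborel) = 0"
  shows "AE x in lborel. h x = 0"
proof -
  note [measurable] = borel_measurable_integrable[OF h]
  have i: "integrable lborel (\<lambda>x. indicator A x * h x)" if "A \<in> sets borel" for A
    by (rule Bochner_Integration.integrable_bound[OF h]) (use that in \<open>auto simp: indicator_def\<close>)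
  have "AE x in lborel. indicator {x. h x > 0} x * h x = 0"
    by (subst integral_nonneg_eq_0_iff_AE[symmetric, OF i]) (use z[of "{x. h x > 0}"] in \<open>simp_all add: indicator_times_eq_if\<close>)
  moreover have "AE x in lborel. - (indicator {x. h x < 0} x * h x) = 0"
    by (subst integral_nonneg_eq_0_iff_AE[symmetric, OF integrable_minus[OF i]])
      (use z[of "{x. h x < 0}"] in \<open>simp_all add: indicator_times_eq_if\<close>)
  ultimately show ?thesis
    by eventually_elim (auto simp: indicator_def split: if_splits)
qed

lemma integrable_indicator_mult:
  fixes g :: "real \<Rightarrow> complex"
  assumes "integrable lborel g" "A \<in> sets borel"
  shows "integrable lborel (\<lambda>x. indicator A x * g x)"
  by (rule Bochner_Integration.integrable_bound[OF assms(1)])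
    (use assms borel_measurable_integrable[OF assms(1)] in \<open>auto simp: indicator_def\<close>)

text \<open>
  The half-lines form an intersection-stable generator of the Borel sets, so the integrals over
  them and over the whole line determine the integrals over all Borel sets.
\<close>

lemma AE_zero_of_halfline_integrals:
  fixes g :: "real \<Rightarrow> complex"
  assumes g: "integrable lborel g"
    and z: "\<And>a. (\<integral>x. indicator {a<..} x * g x \<partial>lborel) = 0"
    and z': "(\<integral>x. g x \<partial>lborel) = 0"
  shows "AE x in lborel. g x = 0"
proof -
  note [measurable] = borel_measurable_integrable[OF g]
  have *: "(\<integral>x. indicator A x * g x \<partial>lborel) = 0" if "A \<in> sets borel" for A
    using that
  proof (induction rule: borel_induct_greaterThan)
    case (compl A)
    have "(\<integral>x. indicator (- A) x * g x \<partial>lborel) = (\<integral>x. g x - indicator A x * g x \<partial>lborel)"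
      by (intro Bochner_Integration.integral_cong) (auto simp: indicator_def)
    then show ?case using compl g integrable_indicator_mult[OF g compl(1)] z' by simp
  next
    case (union A)
    then have [measurable]: "\<And>i. A i \<in> sets borel" by auto
    have "(\<lambda>n. \<integral>x. indicator (\<Union>i<n. A i) x * g x \<partial>lborel) \<longlonglongrightarrow> (\<integral>x. indicator (\<Union>i. A i) x * g x \<partial>lborel)"
    proof (rule integral_dominated_convergence[where w = "\<lambda>x. norm (g x)"])
      show "AE x in lborel. (\<lambda>n. indicator (\<Union>i<n. A i) x * g x) \<longlonglongrightarrow> indicator (\<Union>i. A i) x * g x"
        by (intro AE_I2 tendsto_intros LIMSEQ_indicator_UN)
    qed (auto simp: g indicator_def integrable_norm)
    moreover have "(\<integral>x. indicator (\<Union>i<n. A i) x * g x \<partial>lborel) = 0" for n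
    proof -
      have "indicator (\<Union>i<n. A i) x * g x = (\<Sum>i<n. indicator (A i) x * g x)" for x
      proof -
        have "indicator (\<Union>i<n. A i) x = (\<Sum>i<n. indicator (A i) x :: complex)"
          by (rule indicator_UN_disjoint) (use union(1) in \<open>auto simp: disjoint_family_on_def\<close>)
        then show ?thesis by (simp only: sum_distrib_right)
      qed
      then show ?thesis
        by (simp only: Bochner_Integration.integral_sum[OF integrable_indicator_mult[OF g \<open>A _ \<in> sets borel\<close>]] union(3) sum.neutral_const)
    qed
    ultimately show ?case by (simp add: LIMSEQ_const_iff)
  qed (auto simp: z)
  have i: "integrable lborel (\<lambda>x. Re (g x))" "integrable lborel (\<lambda>x. Im (g x))"
    using g by auto
  have "(\<integral>x. indicator A x * Re (g x) \<partial>lborel) = 0" "(\<integral>x. indicator A x * Im (g x) \<partial>lborel) = 0"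
    if A: "A \<in> sets borel" for A
  proof -
    have "(\<integral>x. indicator A x * Re (g x) \<partial>lborel) = (\<integral>x. Re (indicator A x * g x) \<partial>lborel)"
      "(\<integral>x. indicator A x * Im (g x) \<partial>lborel) = (\<integral>x. Im (indicator A x * g x) \<partial>lborel)"
      by (intro Bochner_Integration.integral_cong; simp add: indicator_def)+
    then show "(\<integral>x. indicator A x * Re (g x) \<partial>lborel) = 0" "(\<integral>x. indicator A x * Im (g x) \<partial>lborel) = 0"
      unfolding integral_Re[OF integrable_indicator_mult[OF g A]] integral_Im[OF integrable_indicator_mult[OF g A]] *[OF A]
      by simp_all
  qed
  then have "AE x in lborel. Re (g x) = 0" "AE x in lborel. Im (g x) = 0"
    using AE_zero_of_set_integrals_real[OF i(1)] AE_zero_of_set_integrals_real[OF i(2)] by auto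
  then show ?thesis by eventually_elim (simp add: complex_eq_iff)
qed

text \<open>
  Testing with \<open>bell\<close> times a logistic step, and letting the step become steep, gives the
  integrals of the integrable function \<open>g bell\<close> over half-lines.
\<close>

lemma AE_zero_of_schwartz_pairings:
  fixes g :: "real \<Rightarrow> complex"
  assumes [measurable]: "g \<in> borel_measurable borel"
    and i: "\<And>\<phi>. \<phi> \<in> schwartz \<Longrightarrow> integrable lborel (\<lambda>x. g x * \<phi> x)"
    and z: "\<And>\<phi>. \<phi> \<in> schwartz \<Longrightarrow> (\<integral>x. g x * \<phi> x \<partial>lborel) = 0"
  shows "AE x in lborel. g x = 0"
proof -
  let ?G = "\<lambda>x. g x * of_real (bell x)"
  note G = i[OF schwartz_bell]
  have "AE x in lborel. ?G x = 0"
  proof (rule AE_zero_of_halfline_integrals[OF G _ z[OF schwartz_bell]])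
    fix a
    have "(\<lambda>n. \<integral>x. g x * (of_real (logistic (real n) a x) * of_real (bell x)) \<partial>lborel) \<longlonglongrightarrow> (\<integral>x. indicator {a<..} x * ?G x \<partial>lborel)"
    proof (rule integral_dominated_convergence[where w = "\<lambda>x. norm (?G x)"])
      show "AE x in lborel. (\<lambda>n. g x * (of_real (logistic (real n) a x) * of_real (bell x))) \<longlonglongrightarrow> indicator {a<..} x * ?G x"
        using AE_lborel_singleton[of a]
      proof eventually_elim
        case (elim x)
        have "(\<lambda>n. g x * (of_real (logistic (real n) a x) * of_real (bell x))) \<longlonglongrightarrow> g x * (of_real (indicator {a<..} x) * of_real (bell x))"
          by (intro tendsto_intros logistic_tendsto_indicator elim)
        then show ?case by (cases "a < x") simp_all
      qed
      show "AE x in lborel. norm (g x * (of_real (logistic (real n) a x) * of_real (bell x))) \<le> norm (?G x)" for n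
        using norm_logistic by (intro AE_I2) (auto simp: norm_mult intro!: mult_left_mono mult_left_le_one_le)
    qed (use integrable_norm[OF G] in auto)
    then show "(\<integral>x. indicator {a<..} x * ?G x \<partial>lborel) = 0"
      using z[OF schwartz_logistic_mult[OF schwartz_bell]] by (simp add: LIMSEQ_const_iff)
  qed
  then show ?thesis by eventually_elim (use bell_pos in \<open>auto simp: less_le\<close>)
qed

section \<open>Weighted norms\<close>

lemma japanese_bracket_sqrt: "japanese_bracket t = sqrt (1 + t\<^sup>2)"
  by (simp add: japanese_bracket_def powr_half_sqrt)

lemma japanese_bracket_ge_1: "japanese_bracket t \<ge> 1"
  by (simp add: japanese_bracket_sqrt)

lemma measurable_japanese_bracket [measurable]: "japanese_bracket \<in> borel_measurable borel"
  unfolding japanese_bracket_sqrt[abs_def] by measurable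

lemma japanese_bracket_le: "japanese_bracket t \<le> 1 + \<bar>t\<bar>"
  unfolding japanese_bracket_sqrt by (intro real_le_lsqrt) (auto simp: power2_eq_square algebra_simps)

lemma le_japanese_bracket: "1 + \<bar>t\<bar> \<le> 2 * japanese_bracket t"
proof -
  have "\<bar>t\<bar> \<le> japanese_bracket t" unfolding japanese_bracket_sqrt by (intro real_le_rsqrt) simp
  then show ?thesis using japanese_bracket_ge_1[of t] by simp
qed

text \<open>
  The \<open>q\<close>-th power of the norm of the Fourier--Lebesgue space, in terms of the Fourier transform \<open>g\<close>. Since no root
  is taken, the triangle inequality holds up to the constant \<open>2 powr q\<close>, which is harmless for questions of boundedness and
  convergence; the value \<open>\<infinity>\<close> says that \<open>g\<close> does not belong to the space.
\<close>

definition wnorm :: "real \<Rightarrow> real \<Rightarrow> (real \<Rightarrow> complex) \<Rightarrow> ennreal" where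
  "wnorm b q g = (\<integral>\<^sup>+\<tau>. ennreal ((japanese_bracket \<tau> powr b * norm (g \<tau>)) powr q) \<partial>lborel)"

lemma powr_add_le:
  fixes x y q :: real
  assumes "x \<ge> 0" "y \<ge> 0" "q \<ge> 0"
  shows "(x + y) powr q \<le> 2 powr q * (x powr q + y powr q)"
proof -
  have "(x + y) powr q \<le> (2 * max x y) powr q" using assms by (intro powr_mono2) auto
  also have "\<dots> = 2 powr q * (max x y) powr q" using assms by (simp add: powr_mult)
  also have "\<dots> \<le> 2 powr q * (x powr q + y powr q)" by (auto simp: max_def)
  finally show ?thesis .
qed

lemma wnorm_mono:
  assumes "q \<ge> 0" "AE \<tau> in lborel. norm (f \<tau>) \<le> norm (g \<tau>)"
  shows "wnorm b q f \<le> wnorm b q g"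
  unfolding wnorm_def
  by (rule nn_integral_mono_AE, use assms(2) in eventually_elim)
    (intro ennreal_leI powr_mono2 mult_left_mono assms(1); simp)

lemma wnorm_cong:
  assumes "AE \<tau> in lborel. f \<tau> = g \<tau>" shows "wnorm b q f = wnorm b q g"
  unfolding wnorm_def by (rule nn_integral_cong_AE, use assms in eventually_elim) simp

lemma wnorm_add:
  assumes [measurable]: "f \<in> borel_measurable borel" "g \<in> borel_measurable borel" and "q \<ge> 0"
  shows "wnorm b q (\<lambda>\<tau>. f \<tau> + g \<tau>) \<le> ennreal (2 powr q) * (wnorm b q f + wnorm b q g)"
proof -
  have "wnorm b q (\<lambda>\<tau>. f \<tau> + g \<tau>) \<le> (\<integral>\<^sup>+\<tau>. ennreal (2 powr q) * (ennreal ((japanese_bracket \<tau> powr b * norm (f \<tau>)) powr q)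
      + ennreal ((japanese_bracket \<tau> powr b * norm (g \<tau>)) powr q)) \<partial>lborel)"
    unfolding wnorm_def
  proof (rule nn_integral_mono)
    fix \<tau>
    have "(japanese_bracket \<tau> powr b * norm (f \<tau> + g \<tau>)) powr q \<le> (japanese_bracket \<tau> powr b * norm (f \<tau>) + japanese_bracket \<tau> powr b * norm (g \<tau>)) powr q"
      using assms(3) by (intro powr_mono2) (auto simp: norm_triangle_ineq simp flip: distrib_left intro!: mult_left_mono)
    also have "\<dots> \<le> 2 powr q * ((japanese_bracket \<tau> powr b * norm (f \<tau>)) powr q + (japanese_bracket \<tau> powr b * norm (g \<tau>)) powr q)"
      using assms(3) by (intro powr_add_le) auto
    finally show "ennreal ((japanese_bracket \<tau> powr b * norm (f \<tau> + g \<tau>)) powr q) \<le> ennreal (2 powr q) * (ennreal ((japanese_bracket \<tau> powr b * norm (f \<tau>)) powr q)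
      + ennreal ((japanese_bracket \<tau> powr b * norm (g \<tau>)) powr q))"
      by (simp add: ennreal_leI flip: ennreal_plus ennreal_mult)
  qed
  also have "\<dots> = ennreal (2 powr q) * (wnorm b q f + wnorm b q g)"
    unfolding wnorm_def by (subst nn_integral_cmult) (auto simp: nn_integral_add)
  finally show ?thesis .
qed

lemma wnorm_minus_commute: "wnorm b q (\<lambda>\<tau>. f \<tau> - g \<tau>) = wnorm b q (\<lambda>\<tau>. g \<tau> - f \<tau>)"
  unfolding wnorm_def by (simp add: norm_minus_commute)

lemma wnorm_triangle:
  assumes [measurable]: "f \<in> borel_measurable borel" "g \<in> borel_measurable borel" "h \<in> borel_measurable borel" and "q \<ge> 0"
  shows "wnorm b q (\<lambda>\<tau>. f \<tau> - h \<tau>) \<le> ennreal (2 powr q) * (wnorm b q (\<lambda>\<tau>. f \<tau> - g \<tau>) + wnorm b q (\<lambda>\<tau>. g \<tau> - h \<tau>))"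
  using wnorm_add[of "\<lambda>\<tau>. f \<tau> - g \<tau>" "\<lambda>\<tau>. g \<tau> - h \<tau>" q b] assms(4) by simp

lemma wnorm_cmult:
  assumes [measurable]: "f \<in> borel_measurable borel" and "q \<ge> 0"
  shows "wnorm b q (\<lambda>\<tau>. c * f \<tau>) = ennreal (norm c powr q) * wnorm b q f"
  unfolding wnorm_def
  by (subst nn_integral_cmult[symmetric])
    (auto intro!: nn_integral_cong simp: norm_mult mult.left_commute powr_mult simp flip: ennreal_mult)

lemma wnorm_0_iff:
  assumes [measurable]: "f \<in> borel_measurable borel" and "q > 0"
  shows "wnorm b q f = 0 \<longleftrightarrow> (AE \<tau> in lborel. f \<tau> = 0)"
proof -
  have "japanese_bracket \<tau> \<noteq> 0" for \<tau> using japanese_bracket_ge_1[of \<tau>] by linarith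
  then show ?thesis unfolding wnorm_def using assms(2)
    by (subst nn_integral_0_iff_AE) (auto simp: ennreal_eq_0_iff powr_ge_zero intro!: AE_cong elim!: eventually_mono)
qed

lemma tendsto_powr_zero:
  fixes u :: "nat \<Rightarrow> real"
  assumes "u \<longlonglongrightarrow> 0" "q > 0" shows "(\<lambda>n. \<bar>u n\<bar> powr q) \<longlonglongrightarrow> 0"
proof -
  have "(\<lambda>n. \<bar>u n\<bar> powr q) \<longlonglongrightarrow> 0 powr q"
    using tendsto_rabs[OF assms(1)] assms(2) by (intro tendsto_powr') auto
  then show ?thesis by simp
qed

lemma wnorm_tendsto_0:
  assumes [measurable]: "\<And>n. f n \<in> borel_measurable borel" "w \<in> borel_measurable borel"
    and lim: "AE \<tau> in lborel. (\<lambda>n. f n \<tau>) \<longlonglongrightarrow> 0"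
    and dom: "\<And>n. AE \<tau> in lborel. norm (f n \<tau>) \<le> norm (w \<tau>)"
    and w: "wnorm b q w < \<infinity>" and q: "q > 0"
  shows "(\<lambda>n. wnorm b q (f n)) \<longlonglongrightarrow> 0"
proof -
  have "(\<lambda>n. wnorm b q (f n)) \<longlonglongrightarrow> (\<integral>\<^sup>+\<tau>. 0 \<partial>(lborel :: real measure))"
    unfolding wnorm_def
  proof (rule nn_integral_dominated_convergence[where u' = "\<lambda>_. 0" and w = "\<lambda>\<tau>. ennreal ((japanese_bracket \<tau> powr b * norm (w \<tau>)) powr q)"])
    show "AE \<tau> in lborel. ennreal ((japanese_bracket \<tau> powr b * norm (f n \<tau>)) powr q) \<le> ennreal ((japanese_bracket \<tau> powr b * norm (w \<tau>)) powr q)" for n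
      using dom[of n] by eventually_elim (intro ennreal_leI powr_mono2 mult_left_mono; use q in simp)
    show "AE \<tau> in lborel. (\<lambda>n. ennreal ((japanese_bracket \<tau> powr b * norm (f n \<tau>)) powr q)) \<longlonglongrightarrow> 0"
      using lim
    proof eventually_elim
      case (elim \<tau>)
      have "(\<lambda>n. japanese_bracket \<tau> powr b * norm (f n \<tau>)) \<longlonglongrightarrow> japanese_bracket \<tau> powr b * norm (0::complex)"
        by (intro tendsto_intros elim)
      from tendsto_powr_zero[OF this[simplified] q]
      have "(\<lambda>n. ennreal ((japanese_bracket \<tau> powr b * norm (f n \<tau>)) powr q)) \<longlonglongrightarrow> ennreal 0"
        by (intro tendsto_ennrealI) (simp add: abs_mult)
      then show ?case by simp
    qed
  qed (use w in \<open>auto simp: wnorm_def\<close>)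
  then show ?thesis by simp
qed

lemma nn_integral_tendsto_le:
  fixes u :: "nat \<Rightarrow> 'a \<Rightarrow> ennreal"
  assumes [measurable]: "\<And>n. u n \<in> borel_measurable M"
    and lim: "AE x in M. (\<lambda>n. u n x) \<longlonglongrightarrow> v x"
    and le: "\<And>n. (\<integral>\<^sup>+x. u n x \<partial>M) \<le> K n" and K: "K \<longlonglongrightarrow> L"
  shows "(\<integral>\<^sup>+x. v x \<partial>M) \<le> L"
proof -
  have "(\<integral>\<^sup>+x. v x \<partial>M) = (\<integral>\<^sup>+x. liminf (\<lambda>n. u n x) \<partial>M)"
    by (rule nn_integral_cong_AE, use lim in eventually_elim) (simp add: lim_imp_Liminf)
  also have "\<dots> \<le> liminf (\<lambda>n. \<integral>\<^sup>+x. u n x \<partial>M)" by (rule nn_integral_liminf) simp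
  also have "\<dots> \<le> liminf K" by (intro Liminf_mono always_eventually allI le)
  also have "\<dots> = L" using K by (simp add: lim_imp_Liminf)
  finally show ?thesis .
qed

text \<open>
  Fatou's lemma, in the form that transfers bounds to a pointwise limit.
\<close>

lemma wnorm_tendsto_le:
  assumes [measurable]: "\<And>n. f n \<in> borel_measurable borel"
    and lim: "AE \<tau> in lborel. (\<lambda>n. f n \<tau>) \<longlonglongrightarrow> g \<tau>"
    and le: "\<And>n. wnorm b q (f n) \<le> K n" and K: "K \<longlonglongrightarrow> L" and q: "q > 0"
  shows "wnorm b q g \<le> L"
  unfolding wnorm_def
proof (rule nn_integral_tendsto_le[OF _ _ le[unfolded wnorm_def] K])
  show "AE \<tau> in lborel. (\<lambda>n. ennreal ((japanese_bracket \<tau> powr b * norm (f n \<tau>)) powr q)) \<longlonglongrightarrow> ennreal ((japanese_bracket \<tau> powr b * norm (g \<tau>)) powr q)"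
    using lim
  proof eventually_elim
    case (elim \<tau>)
    show ?case by (intro tendsto_ennrealI tendsto_powr' tendsto_mult tendsto_const tendsto_norm elim) (use q in auto)
  qed
qed simp

section \<open>Density of Schwartz functions\<close>

lemma schwartz_power_weight:
  assumes "\<phi> \<in> schwartz" shows "(\<lambda>x. of_real ((1 + x\<^sup>2) ^ m) * \<phi> x) \<in> schwartz"
proof (induction m)
  case (Suc m)
  let ?u = "\<lambda>x. of_real ((1 + x\<^sup>2) ^ m) * \<phi> x"
  have "(\<lambda>x. ?u x + of_real x * (of_real x * ?u x)) \<in> schwartz"
    by (intro schwartz_add schwartz_times_x Suc)
  then show ?case by (simp add: algebra_simps power2_eq_square)
qed (use assms in simp)

lemma integrable_inverse_square_powr:
  assumes "q \<ge> 1" "C \<ge> 0" shows "(\<integral>\<^sup>+x. ennreal ((C * inverse (1 + x\<^sup>2)) powr q) \<partial>lborel) < \<infinity>"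
proof -
  have "(\<integral>\<^sup>+x. ennreal ((C * inverse (1 + x\<^sup>2)) powr q) \<partial>lborel) \<le> (\<integral>\<^sup>+x. ennreal (\<bar>C\<bar> powr q) * ennreal (inverse (1 + x\<^sup>2)) \<partial>lborel)"
  proof (rule nn_integral_mono)
    fix x :: real
    have i: "0 < inverse (1 + x\<^sup>2)" "inverse (1 + x\<^sup>2) \<le> 1" by (auto simp: add_pos_nonneg inverse_le_1_iff)
    have "(C * inverse (1 + x\<^sup>2)) powr q = (\<bar>C\<bar> * inverse (1 + x\<^sup>2)) powr q" using assms by simp
    also have "\<dots> = \<bar>C\<bar> powr q * inverse (1 + x\<^sup>2) powr q" using i by (simp add: powr_mult)
    also have "\<dots> \<le> \<bar>C\<bar> powr q * inverse (1 + x\<^sup>2) powr 1"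
      using i assms by (intro mult_left_mono powr_mono') auto
    also have "\<dots> = \<bar>C\<bar> powr q * inverse (1 + x\<^sup>2)" using i by simp
    finally show "ennreal ((C * inverse (1 + x\<^sup>2)) powr q) \<le> ennreal (\<bar>C\<bar> powr q) * ennreal (inverse (1 + x\<^sup>2))"
      by (simp add: ennreal_leI flip: ennreal_mult)
  qed
  also have "\<dots> = ennreal (\<bar>C\<bar> powr q) * (\<integral>\<^sup>+x. ennreal (inverse (1 + x\<^sup>2)) \<partial>lborel)" by (rule nn_integral_cmult) measurable
  also have "\<dots> < \<infinity>"
    using nn_integral_eq_integral[OF integrable_inverse_1_plus_square] by (simp add: ennreal_mult_less_top)
  finally show ?thesis .
qed

lemma wnorm_schwartz:
  assumes p: "\<phi> \<in> schwartz" and q: "q \<ge> 1" shows "wnorm b q \<phi> < \<infinity>"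
proof -
  obtain m :: nat where m: "\<bar>b\<bar> \<le> real m" using real_arch_simple by blast
  obtain C where C: "C \<ge> 0" "\<And>x. norm (of_real ((1 + x\<^sup>2) ^ m) * \<phi> x) \<le> C * inverse (1 + x\<^sup>2)"
    using schwartz_decay[OF schwartz_power_weight[OF p]] by blast
  have le: "japanese_bracket \<tau> powr b * norm (\<phi> \<tau>) \<le> C * inverse (1 + \<tau>\<^sup>2)" for \<tau>
  proof -
    have j: "japanese_bracket \<tau> \<ge> 1" by (rule japanese_bracket_ge_1)
    have "japanese_bracket \<tau> powr b \<le> japanese_bracket \<tau> powr real m" using j m by (intro powr_mono) auto
    also have "\<dots> = japanese_bracket \<tau> ^ m" using j by (simp add: powr_realpow)
    also have "\<dots> \<le> (japanese_bracket \<tau> ^ 2) ^ m" using j by (intro power_mono) (auto simp: power2_eq_square)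
    also have "japanese_bracket \<tau> ^ 2 = 1 + \<tau>\<^sup>2" by (simp add: japanese_bracket_sqrt add_nonneg_nonneg)
    finally have "japanese_bracket \<tau> powr b * norm (\<phi> \<tau>) \<le> (1 + \<tau>\<^sup>2) ^ m * norm (\<phi> \<tau>)" by (rule mult_right_mono) simp
    also have "\<dots> = norm (of_real ((1 + \<tau>\<^sup>2) ^ m) * \<phi> \<tau>)"
      unfolding norm_mult norm_of_real by (simp add: abs_of_nonneg)
    finally show ?thesis using C(2)[of \<tau>] by simp
  qed
  have "wnorm b q \<phi> \<le> (\<integral>\<^sup>+x. ennreal ((C * inverse (1 + x\<^sup>2)) powr q) \<partial>lborel)"
    unfolding wnorm_def using le q by (intro nn_integral_mono ennreal_leI powr_mono2) auto
  then show ?thesis using integrable_inverse_square_powr[OF q C(1)] by (rule le_less_trans)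
qed

definition approximable :: "real \<Rightarrow> real \<Rightarrow> (real \<Rightarrow> complex) \<Rightarrow> bool" where
  "approximable b q g \<longleftrightarrow> g \<in> borel_measurable borel \<and>
     (\<forall>d>0. \<exists>\<gamma>\<in>schwartz. wnorm b q (\<lambda>\<tau>. g \<tau> - \<gamma> \<tau>) < ennreal d)"

lemma approximable_schwartz: "\<phi> \<in> schwartz \<Longrightarrow> approximable b q \<phi>"
  unfolding approximable_def by (auto simp: schwartz_measurable wnorm_def intro!: bexI[of _ \<phi>])

text \<open>
  Together with the closure under linear combinations this makes the approximable functions a closed
  subspace.
\<close>

lemma approximable_limit:
  assumes [measurable]: "\<And>n. f n \<in> borel_measurable borel" "g \<in> borel_measurable borel" and q: "q > 0"
    and f: "\<And>n. approximable b q (f n)" and lim: "(\<lambda>n. wnorm b q (\<lambda>\<tau>. g \<tau> - f n \<tau>)) \<longlonglongrightarrow> 0"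
  shows "approximable b q g"
  unfolding approximable_def
proof (intro conjI allI impI)
  fix d :: real assume d: "d > 0"
  \<comment> \<open>Chosen so that 2^q (e + e) = d.\<close>
  define e where "e = d / (2 * 2 powr q)"
  have e: "e > 0" using d by (simp add: e_def)
  have "eventually (\<lambda>n. wnorm b q (\<lambda>\<tau>. g \<tau> - f n \<tau>) < ennreal e) sequentially"
    using order_tendstoD(2)[OF lim] e by simp
  then obtain n where n: "wnorm b q (\<lambda>\<tau>. g \<tau> - f n \<tau>) < ennreal e" by (auto dest: eventually_happens)
  obtain \<gamma> where g: "\<gamma> \<in> schwartz" "wnorm b q (\<lambda>\<tau>. f n \<tau> - \<gamma> \<tau>) < ennreal e"
    using f[of n] e unfolding approximable_def by blast
  have "wnorm b q (\<lambda>\<tau>. g \<tau> - \<gamma> \<tau>) \<le> ennreal (2 powr q) * (wnorm b q (\<lambda>\<tau>. g \<tau> - f n \<tau>) + wnorm b q (\<lambda>\<tau>. f n \<tau> - \<gamma> \<tau>))"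
    using q schwartz_measurable[OF g(1)] by (intro wnorm_triangle) auto
  also have "\<dots> < ennreal (2 powr q) * (ennreal e + ennreal e)"
    by (intro ennreal_mult_strict_left_mono add_strict_mono n g) auto
  also have "\<dots> = ennreal d"
    using e by (simp add: e_def flip: ennreal_plus ennreal_mult)
  finally show "\<exists>\<gamma>\<in>schwartz. wnorm b q (\<lambda>\<tau>. g \<tau> - \<gamma> \<tau>) < ennreal d" using g(1) by blast
qed simp

lemma approximable_add:
  assumes f: "approximable b q f" and g: "approximable b q g" and q: "q > 0"
  shows "approximable b q (\<lambda>\<tau>. f \<tau> + g \<tau>)"
  unfolding approximable_def
proof (intro conjI allI impI)
  note [measurable] = f[unfolded approximable_def, THEN conjunct1] g[unfolded approximable_def, THEN conjunct1]
  show "(\<lambda>\<tau>. f \<tau> + g \<tau>) \<in> borel_measurable borel" by measurable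
  fix d :: real assume d: "d > 0"
  define e where "e = d / (2 * 2 powr q)"
  have e: "e > 0" using d by (simp add: e_def)
  obtain \<gamma> where h: "\<gamma> \<in> schwartz" "wnorm b q (\<lambda>\<tau>. f \<tau> - \<gamma> \<tau>) < ennreal e"
    using f e unfolding approximable_def by blast
  obtain \<eta> where h': "\<eta> \<in> schwartz" "wnorm b q (\<lambda>\<tau>. g \<tau> - \<eta> \<tau>) < ennreal e"
    using g e unfolding approximable_def by blast
  have "wnorm b q (\<lambda>\<tau>. (f \<tau> + g \<tau>) - (\<gamma> \<tau> + \<eta> \<tau>)) = wnorm b q (\<lambda>\<tau>. (f \<tau> - \<gamma> \<tau>) + (g \<tau> - \<eta> \<tau>))"
    by (simp add: algebra_simps)
  also have "\<dots> \<le> ennreal (2 powr q) * (wnorm b q (\<lambda>\<tau>. f \<tau> - \<gamma> \<tau>) + wnorm b q (\<lambda>\<tau>. g \<tau> - \<eta> \<tau>))"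
    using q schwartz_measurable[OF h(1)] schwartz_measurable[OF h'(1)] by (intro wnorm_add) auto
  also have "\<dots> < ennreal (2 powr q) * (ennreal e + ennreal e)"
    by (intro ennreal_mult_strict_left_mono add_strict_mono h h') auto
  also have "\<dots> = ennreal d"
    using e by (simp add: e_def flip: ennreal_plus ennreal_mult)
  finally show "\<exists>\<gamma>\<in>schwartz. wnorm b q (\<lambda>\<tau>. f \<tau> + g \<tau> - \<gamma> \<tau>) < ennreal d"
    by (rule bexI[where x = "\<lambda>x. \<gamma> x + \<eta> x"]) (intro schwartz_add h h')
qed

lemma approximable_cmult:
  assumes f: "approximable b q f" and q: "q > 0"
  shows "approximable b q (\<lambda>\<tau>. c * f \<tau>)"
  unfolding approximable_def
proof (intro conjI allI impI)
  note [measurable] = f[unfolded approximable_def, THEN conjunct1]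
  show "(\<lambda>\<tau>. c * f \<tau>) \<in> borel_measurable borel" by measurable
  fix d :: real assume d: "d > 0"
  define e where "e = d / (norm c powr q + 1)"
  have e: "e > 0" using d by (simp add: e_def add_nonneg_pos)
  obtain \<gamma> where h: "\<gamma> \<in> schwartz" "wnorm b q (\<lambda>\<tau>. f \<tau> - \<gamma> \<tau>) < ennreal e"
    using f e unfolding approximable_def by blast
  note [measurable] = schwartz_measurable[OF h(1)]
  have "wnorm b q (\<lambda>\<tau>. c * f \<tau> - c * \<gamma> \<tau>) = ennreal (norm c powr q) * wnorm b q (\<lambda>\<tau>. f \<tau> - \<gamma> \<tau>)"
    using q by (subst wnorm_cmult[symmetric]) (auto simp: algebra_simps)
  also have "\<dots> \<le> ennreal (norm c powr q) * ennreal e" using h(2) by (intro mult_left_mono) auto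
  also have "\<dots> = ennreal (norm c powr q * e)" using e by (simp flip: ennreal_mult)
  also have "\<dots> < ennreal d"
  proof (rule ennreal_lessI[OF d])
    have "0 < norm c powr q + 1" by (simp add: add_nonneg_pos)
    moreover have "norm c powr q * d < (norm c powr q + 1) * d" using d by simp
    ultimately show "norm c powr q * e < d" unfolding e_def by (simp add: field_simps)
  qed
  finally show "\<exists>\<gamma>\<in>schwartz. wnorm b q (\<lambda>\<tau>. c * f \<tau> - \<gamma> \<tau>) < ennreal d"
    by (rule bexI[where x = "\<lambda>x. c * \<gamma> x"]) (intro schwartz_cmult h)
qed

lemma approximable_sum:
  assumes "finite A" "\<And>i. i \<in> A \<Longrightarrow> approximable b q (f i)" "q > 0"
  shows "approximable b q (\<lambda>\<tau>. \<Sum>i\<in>A. f i \<tau>)"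
  using assms(1,2)
proof (induction rule: finite_induct)
  case empty
  have "approximable b q (\<lambda>\<tau>. 0 * of_real (bell \<tau>))"
    by (intro approximable_schwartz schwartz_cmult schwartz_bell)
  then show ?case by simp
next
  case (insert x F)
  then show ?case using approximable_add[OF _ _ assms(3), of b "f x"] by simp
qed

text \<open>
  The sets with this property include the half-lines, by approximation with logistic steps, and are closed
  under complements and countable disjoint unions.
\<close>

lemma approximable_indicator:
  assumes A: "A \<in> sets borel" and q: "q \<ge> 1"
  shows "approximable b q (\<lambda>\<tau>. indicator A \<tau> * of_real (bell \<tau>))"
  using A
proof (induction rule: borel_induct_greaterThan)
  case (basic a)
  show ?case
  proof (rule approximable_limit)
    show "approximable b q (\<lambda>\<tau>. of_real (logistic (real n) a \<tau>) * of_real (bell \<tau>))" for n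
      by (intro approximable_schwartz schwartz_logistic_mult schwartz_bell)
    show "(\<lambda>n. wnorm b q (\<lambda>\<tau>. indicator {a<..} \<tau> * of_real (bell \<tau>) - of_real (logistic (real n) a \<tau>) * of_real (bell \<tau>))) \<longlonglongrightarrow> 0"
    proof (rule wnorm_tendsto_0[where w = "\<lambda>\<tau>. of_real (bell \<tau>)"])
      show "AE x in lborel. (\<lambda>n. indicator {a<..} x * of_real (bell x) - of_real (logistic (real n) a x) * complex_of_real (bell x)) \<longlonglongrightarrow> 0"
        using AE_lborel_singleton[of a]
      proof eventually_elim
        case (elim x)
        have "(\<lambda>n. of_real (indicator {a<..} x) * of_real (bell x) - of_real (logistic (real n) a x) * complex_of_real (bell x)) \<longlonglongrightarrow>
           of_real (indicator {a<..} x) * of_real (bell x) - of_real (indicator {a<..} x) * of_real (bell x)"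
          by (intro tendsto_intros logistic_tendsto_indicator elim)
        then show ?case by (cases "a < x") simp_all
      qed
      show "AE x in lborel. norm (indicator {a<..} x * of_real (bell x) - of_real (logistic (real n) a x) * complex_of_real (bell x)) \<le> norm (complex_of_real (bell x))" for n
      proof (rule AE_I2)
        fix x
        have "indicator {a<..} x * of_real (bell x) - of_real (logistic (real n) a x) * complex_of_real (bell x) = of_real ((indicator {a<..} x - logistic (real n) a x) * bell x)"
          by (cases "a < x") (simp_all add: algebra_simps)
        moreover have "\<bar>indicator {a<..} x - logistic (real n) a x\<bar> \<le> 1"
          using logistic_bounds[of "real n" a x] by (cases "a < x") auto
        ultimately show "norm (indicator {a<..} x * of_real (bell x) - of_real (logistic (real n) a x) * complex_of_real (bell x)) \<le> norm (complex_of_real (bell x))"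
          by (simp only: norm_of_real abs_mult) (intro mult_left_le_one_le; simp)
      qed
    qed (use q wnorm_schwartz[OF schwartz_bell q] in auto)
  qed (use q in auto)
next
  case empty
  then show ?case using approximable_sum[of "{}" b q] q by simp
next
  case (compl A)
  have eq: "(\<lambda>x. indicator (- A) x * of_real (bell x)) = (\<lambda>x. of_real (bell x) + (- 1) * (indicator A x * complex_of_real (bell x)))"
    by (auto simp: indicator_def)
  show ?case unfolding eq
    by (intro approximable_add approximable_cmult approximable_schwartz schwartz_bell compl) (use q in auto)
next
  case (union A)
  then have [measurable]: "\<And>i. A i \<in> sets borel" by auto
  have eq: "(\<lambda>x. indicator (\<Union>i<n. A i) x * complex_of_real (bell x)) = (\<lambda>x. \<Sum>i<n. indicator (A i) x * complex_of_real (bell x))" for n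
  proof
    fix x
    have "indicator (\<Union>i<n. A i) x = (\<Sum>i<n. indicator (A i) x :: complex)"
      by (rule indicator_UN_disjoint) (use union(1) in \<open>auto simp: disjoint_family_on_def\<close>)
    then show "indicator (\<Union>i<n. A i) x * complex_of_real (bell x) = (\<Sum>i<n. indicator (A i) x * complex_of_real (bell x))"
      by (simp only: sum_distrib_right)
  qed
  show ?case
  proof (rule approximable_limit)
    show "approximable b q (\<lambda>x. indicator (\<Union>i<n. A i) x * complex_of_real (bell x))" for n
      unfolding eq by (intro approximable_sum union) (use q in auto)
    show "(\<lambda>n. wnorm b q (\<lambda>x. indicator (\<Union>i. A i) x * of_real (bell x) - indicator (\<Union>i<n. A i) x * of_real (bell x))) \<longlonglongrightarrow> 0"
    proof (rule wnorm_tendsto_0[where w = "\<lambda>\<tau>. of_real (bell \<tau>)"])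
      show "AE x in lborel. (\<lambda>n. indicator (\<Union>i. A i) x * of_real (bell x) - indicator (\<Union>i<n. A i) x * complex_of_real (bell x)) \<longlonglongrightarrow> 0"
      proof (rule AE_I2)
        fix x
        have "(\<lambda>n. indicator (\<Union>i. A i) x * of_real (bell x) - indicator (\<Union>i<n. A i) x * complex_of_real (bell x)) \<longlonglongrightarrow>
          indicator (\<Union>i. A i) x * of_real (bell x) - indicator (\<Union>i. A i) x * complex_of_real (bell x)"
          by (intro tendsto_intros LIMSEQ_indicator_UN)
        then show "(\<lambda>n. indicator (\<Union>i. A i) x * of_real (bell x) - indicator (\<Union>i<n. A i) x * complex_of_real (bell x)) \<longlonglongrightarrow> 0" by simp
      qed
    qed (use q wnorm_schwartz[OF schwartz_bell q] in \<open>auto simp: indicator_def\<close>)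
  qed (use q in auto)
qed

text \<open>
  The quotient \<open>g / bell\<close> is a pointwise limit of simple functions dominated by \<open>2 |g / bell|\<close>; multiplied by \<open>bell\<close>
  they are combinations of indicators times \<open>bell\<close> and converge to \<open>g\<close> dominatedly.
\<close>

lemma schwartz_dense:
  assumes [measurable]: "g \<in> borel_measurable borel" and fin: "wnorm b q g < \<infinity>" and q: "q \<ge> 1"
  shows "approximable b q g"
proof -
  let ?G = "\<lambda>x. g x / of_real (bell x)"
  have "?G \<in> borel_measurable borel" by measurable
  from borel_measurable_implies_sequence_metric[OF this, of 0]
  obtain F where F: "\<And>i. simple_function borel (F i)" "\<And>x. (\<lambda>i. F i x) \<longlonglongrightarrow> ?G x"
    "\<And>i x. dist (F i x) 0 \<le> 2 * dist (?G x) 0" by auto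
  note [measurable] = borel_measurable_simple_function[OF F(1)]
  have b: "bell x > 0" "bell x \<noteq> 0" for x using bell_pos[of x] by auto
  show ?thesis
  proof (rule approximable_limit)
    show "approximable b q (\<lambda>x. F i x * of_real (bell x))" for i
    proof -
      have fin: "finite (range (F i))" using F(1)[of i] by (simp add: simple_function_def)
      have eq: "F i x * of_real (bell x) = (\<Sum>y\<in>range (F i). y * (indicator (F i -` {y}) x * of_real (bell x)))" for x
      proof -
        have "(\<Sum>y\<in>range (F i). y * (indicator (F i -` {y}) x * of_real (bell x))) = (\<Sum>y\<in>range (F i). if y = F i x then y * of_real (bell x) else 0)"
          by (intro sum.cong) (auto simp: indicator_def)
        then show ?thesis using fin by simp
      qed
      have "F i -` {y} \<in> sets borel" for y
        using measurable_sets[OF borel_measurable_simple_function[OF F(1)[of i]], of "{y}"] by simp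
      then show ?thesis unfolding eq
        by (intro approximable_sum approximable_cmult approximable_indicator fin) (use q in auto)
    qed
    show "(\<lambda>n. wnorm b q (\<lambda>x. g x - F n x * of_real (bell x))) \<longlonglongrightarrow> 0"
    proof (rule wnorm_tendsto_0[where w = "\<lambda>x. 3 * g x"])
      show "AE x in lborel. (\<lambda>n. g x - F n x * of_real (bell x)) \<longlonglongrightarrow> 0"
      proof (rule AE_I2)
        fix x
        have "(\<lambda>n. g x - F n x * of_real (bell x)) \<longlonglongrightarrow> g x - ?G x * of_real (bell x)" by (intro tendsto_intros F)
        then show "(\<lambda>n. g x - F n x * of_real (bell x)) \<longlonglongrightarrow> 0" using b[of x] by simp
      qed
      show "AE x in lborel. norm (g x - F n x * of_real (bell x)) \<le> norm (3 * g x)" for n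
      proof (rule AE_I2)
        fix x
        have "norm (F n x * of_real (bell x)) \<le> 2 * norm (g x)"
          using F(3)[of n x] b[of x] by (simp add: norm_mult norm_divide field_simps)
        then show "norm (g x - F n x * of_real (bell x)) \<le> norm (3 * g x)"
          using norm_triangle_ineq4[of "g x" "F n x * of_real (bell x)"] by (simp add: norm_mult)
      qed
      show "wnorm b q (\<lambda>x. 3 * g x) < \<infinity>"
        using fin q by (simp add: wnorm_cmult ennreal_mult_less_top)
    qed (use q in auto)
  qed (use q in auto)
qed

section \<open>Hoelder's inequality and Schur's test\<close>

text \<open>
  The norms of \<open>u\<close> and \<open>v\<close> enter through real upper bounds \<open>\<alpha>\<close> and \<open>\<beta>\<close>, so that
  fractional powers are taken of real numbers only. It is Young's inequality for \<open>u / \<alpha>\<close> and \<open>v / \<beta>\<close>, integrated.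
\<close>

lemma nn_Hoelder:
  fixes u v :: "'a \<Rightarrow> real"
  assumes pq: "p > 1" "q > 1" "1 / p + 1 / q = 1"
    and [measurable]: "u \<in> borel_measurable M" "v \<in> borel_measurable M"
    and nn: "\<And>x. u x \<ge> 0" "\<And>x. v x \<ge> 0" "\<alpha> \<ge> 0" "\<beta> \<ge> 0"
    and u: "(\<integral>\<^sup>+x. ennreal (u x powr p) \<partial>M) \<le> ennreal (\<alpha> powr p)"
    and v: "(\<integral>\<^sup>+x. ennreal (v x powr q) \<partial>M) \<le> ennreal (\<beta> powr q)"
  shows "(\<integral>\<^sup>+x. ennreal (u x * v x) \<partial>M) \<le> ennreal (\<alpha> * \<beta>)"
proof -
  consider "\<alpha> = 0" | "\<beta> = 0" | "\<alpha> > 0" "\<beta> > 0" using nn by fastforce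
  then show ?thesis
  proof cases
    case 1
    then have "(\<integral>\<^sup>+x. ennreal (u x powr p) \<partial>M) = 0" using u by simp
    then have "AE x in M. ennreal (u x powr p) = 0" by (subst (asm) nn_integral_0_iff_AE) auto
    then have "AE x in M. ennreal (u x * v x) = 0" by eventually_elim (auto simp: ennreal_eq_0_iff)
    then have "(\<integral>\<^sup>+x. ennreal (u x * v x) \<partial>M) = 0" by (subst nn_integral_0_iff_AE) auto
    then show ?thesis by simp
  next
    case 2
    then have "(\<integral>\<^sup>+x. ennreal (v x powr q) \<partial>M) = 0" using v by simp
    then have "AE x in M. ennreal (v x powr q) = 0" by (subst (asm) nn_integral_0_iff_AE) auto
    then have "AE x in M. ennreal (u x * v x) = 0" by eventually_elim (auto simp: ennreal_eq_0_iff)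
    then have "(\<integral>\<^sup>+x. ennreal (u x * v x) \<partial>M) = 0" by (subst nn_integral_0_iff_AE) auto
    then show ?thesis by simp
  next
    case 3
    \<comment> \<open>Young's inequality for u / \<alpha> and v / \<beta>, scaled back by \<alpha> \<beta>.\<close>
    define c where "c = \<alpha> * \<beta> / (p * \<alpha> powr p)"
    define d where "d = \<alpha> * \<beta> / (q * \<beta> powr q)"
    have cd: "c \<ge> 0" "d \<ge> 0" using 3 pq by (auto simp: c_def d_def)
    have "(\<integral>\<^sup>+x. ennreal (u x * v x) \<partial>M) \<le> (\<integral>\<^sup>+x. ennreal c * ennreal (u x powr p) + ennreal d * ennreal (v x powr q) \<partial>M)"
    proof (rule nn_integral_mono)
      fix x
      have "(u x / \<alpha>) * (v x / \<beta>) \<le> (u x / \<alpha>) powr p / p + (v x / \<beta>) powr q / q"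
        using 3 nn by (intro Youngs_inequality pq) auto
      then have "\<alpha> * \<beta> * ((u x / \<alpha>) * (v x / \<beta>)) \<le> \<alpha> * \<beta> * ((u x / \<alpha>) powr p / p + (v x / \<beta>) powr q / q)"
        using 3 by (intro mult_left_mono) auto
      also have "\<alpha> * \<beta> * ((u x / \<alpha>) * (v x / \<beta>)) = u x * v x" using 3 by simp
      also have "\<alpha> * \<beta> * ((u x / \<alpha>) powr p / p + (v x / \<beta>) powr q / q) = c * u x powr p + d * v x powr q"
        using 3 nn by (simp add: powr_divide c_def d_def algebra_simps)
      finally show "ennreal (u x * v x) \<le> ennreal c * ennreal (u x powr p) + ennreal d * ennreal (v x powr q)"
        using cd by (simp add: ennreal_leI flip: ennreal_plus ennreal_mult)
    qed
    also have "\<dots> = ennreal c * (\<integral>\<^sup>+x. ennreal (u x powr p) \<partial>M) + ennreal d * (\<integral>\<^sup>+x. ennreal (v x powr q) \<partial>M)"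
      by (simp add: nn_integral_add nn_integral_cmult)
    also have "\<dots> \<le> ennreal c * ennreal (\<alpha> powr p) + ennreal d * ennreal (\<beta> powr q)"
      by (intro add_mono mult_left_mono u v) auto
    also have "\<dots> = ennreal (c * \<alpha> powr p + d * \<beta> powr q)"
      using cd by (simp flip: ennreal_plus ennreal_mult)
    also have "c * \<alpha> powr p + d * \<beta> powr q = \<alpha> * \<beta> * (1 / p + 1 / q)"
      using 3 pq by (simp add: c_def d_def field_simps)
    finally show ?thesis by (simp add: pq)
  qed
qed

text \<open>
  Hoelder's inequality for the measure \<open>k(x,y) dy\<close>, applied to \<open>h\<close> and \<open>f / h\<close>, followed by Tonelli's theorem.
  The function \<open>E\<close> stands for anything dominated by the integral operator, so that signed kernels and
  points where the integral diverges are covered.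
\<close>

lemma Schur_test:
  fixes k :: "real \<Rightarrow> real \<Rightarrow> real" and h f E :: "real \<Rightarrow> real"
  assumes pq: "p > 1" "q > 1" "1 / p + 1 / q = 1"
    and k [measurable]: "case_prod k \<in> borel_measurable (borel \<Otimes>\<^sub>M borel)"
    and [measurable]: "h \<in> borel_measurable borel" "f \<in> borel_measurable borel"
    and nn: "\<And>x y. k x y \<ge> 0" "\<And>x. h x > 0" "\<And>x. f x \<ge> 0" "\<And>x. E x \<ge> 0" and AB: "A > 0" "B \<ge> 0"
    and A: "\<And>x. (\<integral>\<^sup>+y. ennreal (k x y * h y powr p) \<partial>lborel) \<le> ennreal (A * h x powr p)"
    and B: "\<And>y. (\<integral>\<^sup>+x. ennreal (k x y * h x powr q) \<partial>lborel) \<le> ennreal (B * h y powr q)"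
    and E: "\<And>x. ennreal (E x) \<le> (\<integral>\<^sup>+y. ennreal (k x y * f y) \<partial>lborel)"
  shows "(\<integral>\<^sup>+x. ennreal (E x powr q) \<partial>lborel) \<le> ennreal (A powr (q / p) * B) * (\<integral>\<^sup>+y. ennreal (f y powr q) \<partial>lborel)"
proof -
  define J where "J x = (\<integral>\<^sup>+y. ennreal (k x y * (f y / h y) powr q) \<partial>lborel)" for x
  have kx [measurable]: "(\<lambda>y. k x y) \<in> borel_measurable borel" "(\<lambda>y. k y x) \<in> borel_measurable borel" for x
    by measurable
  have hp: "h x powr r > 0" for x r using nn(2)[of x] by simp
  have le: "ennreal (E x powr q) \<le> ennreal (A powr (q / p)) * (ennreal (h x powr q) * J x)" for x
  proof (cases "J x = \<infinity>")
    case True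
    then show ?thesis using AB hp[of x q] by (simp add: ennreal_mult_top)
  next
    case False
    then obtain j where j: "j \<ge> 0" "J x = ennreal j" by (cases "J x") auto
    \<comment> \<open>The kernel is split as k^(1/p) k^(1/q) between the two factors.\<close>
    let ?u = "\<lambda>y. k x y powr (1 / p) * h y" and ?v = "\<lambda>y. k x y powr (1 / q) * (f y / h y)"
    have e1: "?u y powr p = k x y * h y powr p" for y
      using pq nn(1)[of x y] nn(2)[of y] by (simp add: powr_mult powr_powr)
    have e2: "?v y powr q = k x y * (f y / h y) powr q" for y
      using pq nn(1)[of x y] nn(2)[of y] nn(3)[of y] by (subst powr_mult) (auto simp: powr_powr less_imp_le)
    have e3: "?u y * ?v y = k x y * f y" for y
    proof -
      have "k x y powr (1 / p) * k x y powr (1 / q) = k x y"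
        using pq(3) nn(1)[of x y] by (simp flip: powr_add)
      then show ?thesis using nn(2)[of y] by (simp add: mult_ac) 
    qed
    have "(\<integral>\<^sup>+y. ennreal (?u y * ?v y) \<partial>lborel) \<le> ennreal ((A * h x powr p) powr (1 / p) * j powr (1 / q))"
    proof (rule nn_Hoelder[OF pq])
      show "(\<integral>\<^sup>+y. ennreal (?u y powr p) \<partial>lborel) \<le> ennreal (((A * h x powr p) powr (1 / p)) powr p)"
        unfolding e1 using A[of x] pq AB nn(2)[of x] by (simp add: powr_powr)
      show "(\<integral>\<^sup>+y. ennreal (?v y powr q) \<partial>lborel) \<le> ennreal ((j powr (1 / q)) powr q)"
        unfolding e2 using j pq by (simp add: J_def powr_powr)
    qed (use nn in \<open>auto simp: less_imp_le\<close>)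
    then have "ennreal (E x) \<le> ennreal ((A * h x powr p) powr (1 / p) * j powr (1 / q))"
      unfolding e3 using E[of x] by (rule order_trans[rotated])
    then have "E x \<le> (A * h x powr p) powr (1 / p) * j powr (1 / q)"
      by (subst (asm) ennreal_le_iff) auto
    then have "E x powr q \<le> ((A * h x powr p) powr (1 / p) * j powr (1 / q)) powr q"
      using nn pq by (intro powr_mono2) auto
    also have "\<dots> = A powr (q / p) * (h x powr q * j)"
      using j pq AB nn(2)[of x] by (simp add: powr_mult powr_powr)
    finally show ?thesis using j by (simp add: ennreal_leI flip: ennreal_mult)
  qed
  have mJ: "J \<in> borel_measurable borel" unfolding J_def[abs_def] by measurable
  have "(\<integral>\<^sup>+x. ennreal (E x powr q) \<partial>lborel) \<le> (\<integral>\<^sup>+x. ennreal (A powr (q / p)) * (ennreal (h x powr q) * J x) \<partial>lborel)"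
    by (intro nn_integral_mono le)
  also have "\<dots> = ennreal (A powr (q / p)) * (\<integral>\<^sup>+x. ennreal (h x powr q) * J x \<partial>lborel)"
    using mJ by (intro nn_integral_cmult) measurable
  also have "(\<integral>\<^sup>+x. ennreal (h x powr q) * J x \<partial>lborel) =
     (\<integral>\<^sup>+x. (\<integral>\<^sup>+y. ennreal ((f y / h y) powr q) * ennreal (k x y * h x powr q) \<partial>lborel) \<partial>lborel)"
    unfolding J_def
    by (subst nn_integral_cmult[symmetric]; (measurable | intro nn_integral_cong))
      (simp add: nn mult_ac flip: ennreal_mult)
  also have "\<dots> = (\<integral>\<^sup>+y. (\<integral>\<^sup>+x. ennreal ((f y / h y) powr q) * ennreal (k x y * h x powr q) \<partial>lborel) \<partial>lborel)"
    by (rule lborel_pair.Fubini'[symmetric]) measurable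
  also have "\<dots> = (\<integral>\<^sup>+y. ennreal ((f y / h y) powr q) * (\<integral>\<^sup>+x. ennreal (k x y * h x powr q) \<partial>lborel) \<partial>lborel)"
    by (intro nn_integral_cong nn_integral_cmult) measurable
  also have "\<dots> \<le> (\<integral>\<^sup>+y. ennreal ((f y / h y) powr q) * ennreal (B * h y powr q) \<partial>lborel)"
    by (intro nn_integral_mono mult_left_mono B) auto
  also have "\<dots> = (\<integral>\<^sup>+y. ennreal B * ennreal (f y powr q) \<partial>lborel)"
  proof (rule nn_integral_cong)
    fix y
    have "(f y / h y) powr q * (B * h y powr q) = B * f y powr q"
      using nn(2)[of y] nn(3)[of y] by (simp add: powr_divide)
    then show "ennreal ((f y / h y) powr q) * ennreal (B * h y powr q) = ennreal B * ennreal (f y powr q)"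
      using AB by (simp flip: ennreal_mult)
  qed
  also have "\<dots> = ennreal B * (\<integral>\<^sup>+y. ennreal (f y powr q) \<partial>lborel)" by (intro nn_integral_cmult) measurable
  finally show ?thesis using AB by (simp add: ennreal_mult mult.assoc mult_left_mono)
qed

section \<open>Integrals of the weight\<close>

lemma nn_integral_even_le:
  fixes f :: "real \<Rightarrow> real"
  assumes [measurable]: "f \<in> borel_measurable borel"
  shows "(\<integral>\<^sup>+x. ennreal (f \<bar>x\<bar>) \<partial>lborel) \<le> 2 * (\<integral>\<^sup>+x. ennreal (f x) * indicator {0..} x \<partial>lborel)"
proof -
  have "(\<integral>\<^sup>+x. ennreal (f \<bar>x\<bar>) \<partial>lborel) \<le> (\<integral>\<^sup>+x. ennreal (f x) * indicator {0..} x + ennreal (f (0 + (-1) * x)) * indicator {0..} (0 + (-1) * x) \<partial>lborel)"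
    by (intro nn_integral_mono) (auto simp: indicator_def abs_real_def)
  also have "\<dots> = (\<integral>\<^sup>+x. ennreal (f x) * indicator {0..} x \<partial>lborel) + (\<integral>\<^sup>+x. ennreal (f (0 + (-1) * x)) * indicator {0..} (0 + (-1) * x) \<partial>lborel)"
    by (intro nn_integral_add) measurable
  also have "(\<integral>\<^sup>+x. ennreal (f (0 + (-1) * x)) * indicator {0..} (0 + (-1) * x) \<partial>lborel) = (\<integral>\<^sup>+x. ennreal (f x) * indicator {0..} x \<partial>lborel)"
    using nn_integral_real_affine[of "\<lambda>x. ennreal (f x) * indicator {0..} x" "-1" 0] by simp
  finally show ?thesis by (simp add: mult_2)
qed

lemma DERIV_one_plus_powr:
  fixes x r :: real
  assumes "x \<ge> 0" shows "((\<lambda>x. (1 + x) powr r) has_real_derivative r * (1 + x) powr (r - 1)) (at x)"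
  using DERIV_fun_powr[of "\<lambda>x. 1 + x" 1 x r] assms by (auto intro!: derivative_eq_intros)

lemma nn_integral_weight_tail:
  fixes s t :: real assumes s: "s > 0" and t: "t \<ge> 0"
  shows "(\<integral>\<^sup>+x. ennreal ((1 + \<bar>x\<bar>) powr (- 1 - s) * indicator {t..} \<bar>x\<bar>) \<partial>lborel) \<le> ennreal (2 / s * (1 + t) powr (- s))"
proof -
  have "(\<integral>\<^sup>+x. ennreal ((1 + \<bar>x\<bar>) powr (- 1 - s) * indicator {t..} \<bar>x\<bar>) \<partial>lborel) \<le>
    2 * (\<integral>\<^sup>+x. ennreal ((1 + x) powr (- 1 - s) * indicator {t..} x) * indicator {0..} x \<partial>lborel)"
    using nn_integral_even_le[of "\<lambda>x. (1 + x) powr (- 1 - s) * indicator {t..} x"] by simp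
  also have "(\<integral>\<^sup>+x. ennreal ((1 + x) powr (- 1 - s) * indicator {t..} x) * indicator {0..} x \<partial>lborel)
    = (\<integral>\<^sup>+x. ennreal ((1 + x) powr (- 1 - s)) * indicator {t..} x \<partial>lborel)"
    using t by (intro nn_integral_cong) (auto simp: indicator_def)
  also have "\<dots> = ennreal (0 - (- ((1 + t) powr (- s)) / s))"
  proof (rule nn_integral_FTC_atLeast)
    fix x assume "t \<le> x"
    then show "((\<lambda>x. - ((1 + x) powr (- s)) / s) has_real_derivative (1 + x) powr (- 1 - s)) (at x)"
      using DERIV_cdivide[OF DERIV_minus[OF DERIV_one_plus_powr[of x "- s"]], of s] s t
      unfolding minus_diff_commute[of s 1] by simp
    show "0 \<le> (1 + x) powr (- 1 - s)" by simp
  next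
    have "((\<lambda>x::real. - ((1 + x) powr (- s)) / s) \<longlongrightarrow> - 0 / s) at_top"
      using s by (intro tendsto_intros tendsto_neg_powr filterlim_tendsto_add_at_top[OF tendsto_const] filterlim_ident) auto
    then show "((\<lambda>x::real. - ((1 + x) powr (- s)) / s) \<longlongrightarrow> 0) at_top" by simp
  qed measurable
  also have "2 * \<dots> = ennreal (2 / s * (1 + t) powr (- s))"
    using s by (simp add: ennreal_mult'[symmetric] flip: ennreal_numeral)
  finally show ?thesis .
qed

lemma nn_integral_weight_head:
  fixes r t :: real assumes r: "r < 1" and t: "t \<ge> 0"
  shows "(\<integral>\<^sup>+x. ennreal ((1 + \<bar>x\<bar>) powr (- r) * indicator {..t} \<bar>x\<bar>) \<partial>lborel) \<le> ennreal (2 / (1 - r) * (1 + t) powr (1 - r))"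
proof -
  have "(\<integral>\<^sup>+x. ennreal ((1 + \<bar>x\<bar>) powr (- r) * indicator {..t} \<bar>x\<bar>) \<partial>lborel) \<le>
    2 * (\<integral>\<^sup>+x. ennreal ((1 + x) powr (- r) * indicator {..t} x) * indicator {0..} x \<partial>lborel)"
    using nn_integral_even_le[of "\<lambda>x. (1 + x) powr (- r) * indicator {..t} x"] by simp
  also have "(\<integral>\<^sup>+x. ennreal ((1 + x) powr (- r) * indicator {..t} x) * indicator {0..} x \<partial>lborel)
    = (\<integral>\<^sup>+x. ennreal ((1 + x) powr (- r)) * indicator {0..t} x \<partial>lborel)"
    using t by (intro nn_integral_cong) (auto simp: indicator_def)
  also have "\<dots> = ennreal ((1 + t) powr (1 - r) / (1 - r) - (1 + 0) powr (1 - r) / (1 - r))"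
  proof (rule nn_integral_FTC_Icc)
    fix x assume "x \<in> {0..t}" then have x: "0 \<le> x" by simp
    from x show "((\<lambda>x. (1 + x) powr (1 - r) / (1 - r)) has_real_derivative (1 + x) powr (- r)) (at x)"
      using DERIV_cdivide[OF DERIV_one_plus_powr[of x "1 - r"], of "1 - r"] r by simp
    show "0 \<le> (1 + x) powr (- r)" by simp
  qed (use t in measurable)
  also have "\<dots> \<le> ennreal (1 / (1 - r) * (1 + t) powr (1 - r))" using r by (intro ennreal_leI) auto
  finally have "(\<integral>\<^sup>+x. ennreal ((1 + \<bar>x\<bar>) powr (- r) * indicator {..t} \<bar>x\<bar>) \<partial>lborel) \<le> 2 * ennreal (1 / (1 - r) * (1 + t) powr (1 - r))"
    by (simp add: mult_left_mono)
  also have "\<dots> = ennreal (2 / (1 - r) * (1 + t) powr (1 - r))"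
    using r by (simp add: ennreal_mult'[symmetric] flip: ennreal_numeral)
  finally show ?thesis .
qed

text \<open>
  The kernel of the commutator with a weight, integrated against a power: the part \<open>|x| \<le> |t|\<close> converges
  since \<open>r < 1\<close> and the part \<open>|x| > |t|\<close> since \<open>b < r\<close>, and both scale in the same way.
\<close>

lemma nn_integral_weight_max:
  fixes b r t :: real assumes r: "b < r" "r < 1"
  shows "(\<integral>\<^sup>+x. ennreal (max (1 + \<bar>t\<bar>) (1 + \<bar>x\<bar>) powr (b - 1) * (1 + \<bar>x\<bar>) powr (- r)) \<partial>lborel)
    \<le> ennreal ((2 / (1 - r) + 2 / (r - b)) * (1 + \<bar>t\<bar>) powr (b - r))"
proof -
  let ?m = "\<lambda>x::real. 1 + \<bar>x\<bar>"
  have "(\<integral>\<^sup>+x. ennreal (max (?m t) (?m x) powr (b - 1) * ?m x powr (- r)) \<partial>lborel) \<le>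
    (\<integral>\<^sup>+x. ennreal (?m t powr (b - 1)) * ennreal (?m x powr (- r) * indicator {..\<bar>t\<bar>} \<bar>x\<bar>) + ennreal (?m x powr (- 1 - (r - b)) * indicator {\<bar>t\<bar>..} \<bar>x\<bar>) \<partial>lborel)"
  proof (rule nn_integral_mono)
    fix x
    show "ennreal (max (?m t) (?m x) powr (b - 1) * ?m x powr (- r)) \<le>
      ennreal (?m t powr (b - 1)) * ennreal (?m x powr (- r) * indicator {..\<bar>t\<bar>} \<bar>x\<bar>) + ennreal (?m x powr (- 1 - (r - b)) * indicator {\<bar>t\<bar>..} \<bar>x\<bar>)"
    proof (cases "\<bar>x\<bar> \<le> \<bar>t\<bar>")
      case True
      then have "max (?m t) (?m x) = ?m t" by simp
      then show ?thesis using True by (simp add: ennreal_mult)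
    next
      case False
      then have "max (?m t) (?m x) = ?m x" by simp
      moreover have "?m x powr (b - 1) * ?m x powr (- r) = ?m x powr (- 1 - (r - b))"
        by (simp add: algebra_simps flip: powr_add)
      ultimately show ?thesis using False by simp
    qed
  qed
  also have "\<dots> = ennreal (?m t powr (b - 1)) * (\<integral>\<^sup>+x. ennreal (?m x powr (- r) * indicator {..\<bar>t\<bar>} \<bar>x\<bar>) \<partial>lborel) + (\<integral>\<^sup>+x. ennreal (?m x powr (- 1 - (r - b)) * indicator {\<bar>t\<bar>..} \<bar>x\<bar>) \<partial>lborel)"
    by (subst nn_integral_add) (auto simp: nn_integral_cmult)
  also have "\<dots> \<le> ennreal (?m t powr (b - 1)) * ennreal (2 / (1 - r) * ?m t powr (1 - r)) + ennreal (2 / (r - b) * ?m t powr (- (r - b)))"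
    using r by (intro add_mono mult_left_mono nn_integral_weight_head nn_integral_weight_tail) auto
  also have "\<dots> = ennreal (2 / (1 - r) * (?m t powr (b - 1) * ?m t powr (1 - r)) + 2 / (r - b) * ?m t powr (- (r - b)))"
    using r by (simp add: mult_ac flip: ennreal_plus ennreal_mult)
  also have "?m t powr (b - 1) * ?m t powr (1 - r) = ?m t powr (b - r)" by (simp flip: powr_add)
  finally show ?thesis by (simp add: algebra_simps)
qed

section \<open>The Cauchy transform in a half plane\<close>

text \<open>
  On the line \<open>Re w = e\<close> this is, up to the factor \<open>2 pi\<close>, the Fourier transform of \<open>exp (- e x)\<close> times the inverse transform
  of \<open>\<gamma>\<close> cut off to the positive half-line; as \<open>e\<close> tends to 0 it becomes a multiple of the Hilbert transform plus a multiple of the identity.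
\<close>

definition cauchy :: "(real \<Rightarrow> complex) \<Rightarrow> complex \<Rightarrow> complex" where
  "cauchy \<gamma> w = (\<integral>s. \<gamma> s / (w - \<i> * of_real s) \<partial>lborel)"

lemma half_plane_kernel:
  assumes "Re w > 0" shows "w - \<i> * of_real s \<noteq> 0" "Re w \<le> norm (w - \<i> * of_real s)"
proof -
  show "Re w \<le> norm (w - \<i> * of_real s)" using complex_Re_le_cmod[of "w - \<i> * of_real s"] by simp
  then show "w - \<i> * of_real s \<noteq> 0" using assms by auto
qed

lemma integrable_cauchy:
  assumes g: "integrable lborel \<gamma>" and w: "Re w > 0"
  shows "integrable lborel (\<lambda>s. \<gamma> s / (w - \<i> * of_real s))"
proof (rule Bochner_Integration.integrable_bound[OF integrable_mult_right[OF integrable_norm[OF g], of "1 / Re w"]])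
  note [measurable] = borel_measurable_integrable[OF g]
  show "(\<lambda>s. \<gamma> s / (w - \<i> * of_real s)) \<in> borel_measurable lborel" by measurable
  have "norm (\<gamma> s) / norm (w - \<i> * of_real s) \<le> norm (\<gamma> s) / Re w" for s
    using half_plane_kernel[OF w, of s] w by (intro divide_left_mono mult_pos_pos) auto
  then show "AE s in lborel. norm (\<gamma> s / (w - \<i> * of_real s)) \<le> norm (1 / Re w * norm (\<gamma> s))"
    using w by (simp add: norm_divide)
qed

lemma cauchy_le:
  assumes g: "integrable lborel \<gamma>" and w: "Re w > 0" and "d > 0"
    and d: "\<And>s. \<gamma> s \<noteq> 0 \<Longrightarrow> d \<le> norm (w - \<i> * of_real s)"
  shows "norm (cauchy \<gamma> w) \<le> (\<integral>s. norm (\<gamma> s) \<partial>lborel) / d"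
proof -
  have "norm (cauchy \<gamma> w) \<le> (\<integral>s. 1 / d * norm (\<gamma> s) \<partial>lborel)"
    unfolding cauchy_def
  proof (rule Bochner_Integration.integral_norm_bound_integral[OF integrable_cauchy[OF g w]])
    show "integrable lborel (\<lambda>s. 1 / d * norm (\<gamma> s))" using g by (intro integrable_mult_right integrable_norm)
    fix s
    show "norm (\<gamma> s / (w - \<i> * of_real s)) \<le> 1 / d * norm (\<gamma> s)"
    proof (cases "\<gamma> s = 0")
      case False
      then have "d \<le> norm (w - \<i> * of_real s)" by (rule d)
      with \<open>d > 0\<close> have "norm (\<gamma> s) / norm (w - \<i> * of_real s) \<le> norm (\<gamma> s) / d"
        by (intro divide_left_mono mult_pos_pos) auto
      then show ?thesis by (simp add: norm_divide)
    qed simp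
  qed
  then show ?thesis by simp
qed

text \<open>
  The remainder of the kernel \<open>1 / a\<close> at \<open>b\<close> is exactly \<open>(b - a)^2 / (a^2 b)\<close>, which is bounded by a multiple of
  \<open>|b - a|^2\<close> while \<open>b\<close> stays away from the imaginary axis.
\<close>

lemma cauchy_holomorphic:
  assumes g: "integrable lborel \<gamma>" shows "cauchy \<gamma> holomorphic_on {w. Re w > 0}"
proof (rule holomorphic_onI, rule field_differentiable_at_within)
  fix w assume "w \<in> {w. Re w > 0}"
  then have w: "Re w > 0" by simp
  define r where "r = Re w"
  have r: "r > 0" using w by (simp add: r_def)
  note [measurable] = borel_measurable_integrable[OF g]
  define D where "D = (\<integral>s. - (\<gamma> s / (w - \<i> * of_real s)\<^sup>2) \<partial>lborel)"
  have k: "r \<le> norm (w - \<i> * of_real s)" "w - \<i> * of_real s \<noteq> 0" for s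
    using half_plane_kernel[OF w, of s] by (auto simp: r_def)
  have iD: "integrable lborel (\<lambda>s. - (\<gamma> s / (w - \<i> * of_real s)\<^sup>2))"
  proof (rule Bochner_Integration.integrable_bound[OF integrable_mult_right[OF integrable_norm[OF g], of "1 / r\<^sup>2"]])
    have "norm (\<gamma> s) / norm (w - \<i> * of_real s) ^ 2 \<le> norm (\<gamma> s) / r\<^sup>2" for s
      using k[of s] r by (intro divide_left_mono power_mono mult_pos_pos) auto
    then show "AE s in lborel. norm (- (\<gamma> s / (w - \<i> * of_real s)\<^sup>2)) \<le> norm (1 / r\<^sup>2 * norm (\<gamma> s))"
      using r by (simp add: norm_divide norm_power)
  qed measurable
  have "(cauchy \<gamma> has_derivative (\<lambda>h. D * h)) (at w)"
  proof (rule has_derivative_quadratic[where e = "r / 2" and C = "(\<integral>s. norm (\<gamma> s) \<partial>lborel) * (2 / r ^ 3)"])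
    show "bounded_linear (\<lambda>h. D * h)" by (rule bounded_linear_mult_right)
    fix y assume y: "dist y w < r / 2"
    have "\<bar>Re (y - w)\<bar> < r / 2" using abs_Re_le_cmod[of "y - w"] y by (simp add: dist_norm)
    then have ry: "Re y > r / 2" unfolding r_def minus_complex.sel abs_less_iff by linarith
    then have y0: "Re y > 0" using r by simp
    have ky: "r / 2 \<le> norm (y - \<i> * of_real s)" "y - \<i> * of_real s \<noteq> 0" for s
      using half_plane_kernel[OF y0, of s] ry by auto
    have "cauchy \<gamma> y - cauchy \<gamma> w - D * (y - w) =
       (\<integral>s. \<gamma> s / (y - \<i> * of_real s) - \<gamma> s / (w - \<i> * of_real s) - (- (\<gamma> s / (w - \<i> * of_real s)\<^sup>2)) * (y - w) \<partial>lborel)"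
      unfolding cauchy_def D_def
      by (simp only: Bochner_Integration.integral_diff integrable_cauchy[OF g y0] integrable_cauchy[OF g w] iD
          integral_mult_left_zero Bochner_Integration.integrable_diff integrable_mult_left)
    also have "norm \<dots> \<le> (\<integral>s. (2 / r ^ 3 * norm (y - w) ^ 2) * norm (\<gamma> s) \<partial>lborel)"
    proof (rule Bochner_Integration.integral_norm_bound_integral)
      show "integrable lborel (\<lambda>s. \<gamma> s / (y - \<i> * of_real s) - \<gamma> s / (w - \<i> * of_real s) - (- (\<gamma> s / (w - \<i> * of_real s)\<^sup>2)) * (y - w))"
        by (intro Bochner_Integration.integrable_diff integrable_mult_left integrable_cauchy g y0 w iD)
      show "integrable lborel (\<lambda>s. (2 / r ^ 3 * norm (y - w) ^ 2) * norm (\<gamma> s))"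
        using g by (intro integrable_mult_right integrable_norm)
      fix s
      let ?a = "w - \<i> * of_real s" and ?b = "y - \<i> * of_real s"
      have "\<gamma> s / ?b - \<gamma> s / ?a - (- (\<gamma> s / ?a\<^sup>2)) * (y - w) = \<gamma> s * (?b - ?a)\<^sup>2 / (?a\<^sup>2 * ?b)"
      proof -
        have "y - w = ?b - ?a" by simp
        then show ?thesis using k(2)[of s] ky(2)[of s] 
          by (simp only: ) (simp add: divide_simps power2_eq_square, simp add: algebra_simps)
      qed
      then have "norm (\<gamma> s / ?b - \<gamma> s / ?a - (- (\<gamma> s / ?a\<^sup>2)) * (y - w)) = norm (\<gamma> s) * norm (y - w) ^ 2 / (norm ?a ^ 2 * norm ?b)"
        by (simp add: norm_mult norm_divide norm_power)
      also have "\<dots> \<le> norm (\<gamma> s) * norm (y - w) ^ 2 / (r ^ 2 * (r / 2))"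
        using k(1)[of s] ky(1)[of s] r by (intro divide_left_mono mult_mono power_mono mult_pos_pos) auto
      also have "\<dots> = (2 / r ^ 3 * norm (y - w) ^ 2) * norm (\<gamma> s)"
        using r by (simp add: field_simps power2_eq_square power3_eq_cube)
      finally show "norm (\<gamma> s / ?b - \<gamma> s / ?a - (- (\<gamma> s / ?a\<^sup>2)) * (y - w)) \<le> (2 / r ^ 3 * norm (y - w) ^ 2) * norm (\<gamma> s)" .
    qed
    finally show "norm (cauchy \<gamma> y - cauchy \<gamma> w - D * (y - w)) \<le> (\<integral>s. norm (\<gamma> s) \<partial>lborel) * (2 / r ^ 3) * norm (y - w) ^ 2"
      by (simp add: mult_ac)
  qed (use r in simp)
  then show "cauchy \<gamma> field_differentiable (at w)"
    by (auto simp: field_differentiable_def has_field_derivative_def)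
qed

section \<open>A power inequality in the right half plane\<close>

text \<open>
  Near \<open>|\<theta>| = pi/2\<close> the angle \<open>p |\<theta>|\<close> lies beyond \<open>pi/2\<close>, so \<open>cos (p \<theta>)\<close> is negative there and \<open>B\<close> can be chosen to
  make the second term at least 1; away from \<open>pi/2\<close> the first term wins for large \<open>A\<close>.
\<close>

lemma cos_powr_inequality:
  fixes p :: real assumes p: "1 < p" "p \<le> 2"
  obtains A B where "A \<ge> 0" "B \<ge> 0" "\<And>\<theta>. \<bar>\<theta>\<bar> < pi / 2 \<Longrightarrow> 1 \<le> A * cos \<theta> powr p - B * cos (p * \<theta>)"
proof -
  \<comment> \<open>The midpoint between pi/2 and p pi/2, where the cosine is negative.\<close>
  define a where "a = (p + 1) * pi / 4"
  have a: "pi / 2 < a" "a < p * (pi / 2)" "a < pi"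
  proof -
    have "2 * pi < (p + 1) * pi" using p by (intro mult_strict_right_mono) auto
    then show "pi / 2 < a" unfolding a_def by simp
    have "(p + 1) * pi < (2 * p) * pi" using p by (intro mult_strict_right_mono) auto
    then show "a < p * (pi / 2)" unfolding a_def by simp
    have "(p + 1) * pi < 4 * pi" using p by (intro mult_strict_right_mono) auto
    then show "a < pi" unfolding a_def by simp
  qed
  have ca: "cos a < 0" using cos_monotone_0_pi[of "pi / 2" a] a by simp
  have b: "0 < a / p" "a / p < pi / 2" using a p pi_gt_zero by (auto simp: field_simps) 
  have cb: "cos (a / p) > 0" using b by (intro cos_gt_zero_pi) auto
  define B where "B = 1 / (- cos a)"
  define A where "A = (1 + B) / cos (a / p) powr p"
  have AB: "A \<ge> 0" "B \<ge> 0" using ca cb by (auto simp: A_def B_def)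
  show thesis
  proof (rule that[OF AB])
    fix \<theta> :: real assume t: "\<bar>\<theta>\<bar> < pi / 2"
    have ce: "cos (p * \<theta>) = cos (p * \<bar>\<theta>\<bar>)" "cos \<theta> = cos \<bar>\<theta>\<bar>" by (auto simp: abs_real_def)
    show "1 \<le> A * cos \<theta> powr p - B * cos (p * \<theta>)"
    proof (cases "\<bar>\<theta>\<bar> \<le> a / p")
      case True
      have "cos (a / p) \<le> cos \<bar>\<theta>\<bar>" using True b t pi_gt_zero by (intro cos_monotone_0_pi_le) linarith+
      then have "cos (a / p) powr p \<le> cos \<theta> powr p" unfolding ce using cb p by (intro powr_mono2) auto
      then have "A * cos (a / p) powr p \<le> A * cos \<theta> powr p" using AB by (intro mult_left_mono) auto
      moreover have "A * cos (a / p) powr p = 1 + B" using cb by (simp add: A_def)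
      moreover have "B * cos (p * \<theta>) \<le> B * 1" using AB by (intro mult_left_mono) auto
      ultimately show ?thesis by simp
    next
      case False
      then have "a \<le> p * \<bar>\<theta>\<bar>" using p by (simp add: field_simps)
      moreover have "p * \<bar>\<theta>\<bar> \<le> 2 * (pi / 2)" using t p by (intro mult_mono) auto
      ultimately have "cos (p * \<theta>) \<le> cos a" unfolding ce using a pi_gt_zero by (intro cos_monotone_0_pi_le) auto
      then have "B * cos (p * \<theta>) \<le> B * cos a" using AB by (intro mult_left_mono) auto
      also have "B * cos a = - 1" using ca by (simp add: B_def field_simps)
      finally have "1 \<le> - (B * cos (p * \<theta>))" by simp
      also have "\<dots> \<le> A * cos \<theta> powr p - B * cos (p * \<theta>)" using AB by simp
      finally show ?thesis .
    qed
  qed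
qed

text \<open>
  The preceding inequality for \<open>\<theta> = arg z\<close>, multiplied by \<open>|z|^p\<close>.
\<close>

lemma half_plane_powr_inequality:
  fixes p :: real assumes p: "1 < p" "p \<le> 2"
  obtains A B where "A \<ge> 0" "B \<ge> 0"
    "\<And>z. Re z > 0 \<Longrightarrow> norm z powr p \<le> A * Re z powr p - B * Re (z powr of_real p)"
proof -
  obtain A B where AB: "A \<ge> 0" "B \<ge> 0" "\<And>\<theta>. \<bar>\<theta>\<bar> < pi / 2 \<Longrightarrow> 1 \<le> A * cos \<theta> powr p - B * cos (p * \<theta>)"
    by (rule cos_powr_inequality[OF p]) blast
  show thesis
  proof (rule that[OF AB(1,2)])
    fix z :: complex assume z: "Re z > 0"
    then have z0: "z \<noteq> 0" by auto
    define \<theta> where "\<theta> = Im (Ln z)"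
    have t: "\<bar>\<theta>\<bar> < pi / 2" unfolding \<theta>_def using Re_Ln_pos_lt[OF z0] z by simp
    have n: "exp (Re (Ln z)) = norm z" using z0 by simp
    have "Re z = Re (exp (Ln z))" using z0 by simp
    also have "\<dots> = norm z * cos \<theta>" unfolding Re_exp n \<theta>_def ..
    finally have re: "Re z = norm z * cos \<theta>" .
    have c: "cos \<theta> > 0" using t by (intro cos_gt_zero_pi) auto
    have "Re (z powr of_real p) = exp (p * Re (Ln z)) * cos (p * \<theta>)"
      using z0 by (simp add: powr_def Re_exp \<theta>_def)
    also have "exp (p * Re (Ln z)) = norm z powr p"
      using z0 by (simp add: powr_def)
    finally have rp: "Re (z powr of_real p) = norm z powr p * cos (p * \<theta>)" .
    have "norm z powr p * 1 \<le> norm z powr p * (A * cos \<theta> powr p - B * cos (p * \<theta>))"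
      by (intro mult_left_mono AB t) auto
    also have "\<dots> = A * Re z powr p - B * Re (z powr of_real p)"
      unfolding re rp using c by (simp add: powr_mult algebra_simps)
    finally show "norm z powr p \<le> A * Re z powr p - B * Re (z powr of_real p)" by simp
  qed
qed

section \<open>The real part of the Cauchy transform\<close>

lemma nn_integral_Poisson:
  assumes e: "e > 0"
  shows "(\<integral>\<^sup>+s. ennreal (e / (e\<^sup>2 + (t - s)\<^sup>2)) \<partial>lborel) = ennreal pi"
proof -
  have "(\<integral>\<^sup>+s. ennreal (e / (e\<^sup>2 + (t - s)\<^sup>2)) \<partial>lborel) = ennreal \<bar>e\<bar> * (\<integral>\<^sup>+s. ennreal (e / (e\<^sup>2 + (t - (t + e * s))\<^sup>2)) \<partial>lborel)"
    using e by (intro nn_integral_real_affine) auto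
  also have "\<dots> = (\<integral>\<^sup>+s. ennreal \<bar>e\<bar> * ennreal (e / (e\<^sup>2 + (t - (t + e * s))\<^sup>2)) \<partial>lborel)"
    by (rule nn_integral_cmult[symmetric]) measurable
  also have "\<dots> = (\<integral>\<^sup>+s. ennreal (inverse (1 + s\<^sup>2)) \<partial>lborel)"
  proof (rule nn_integral_cong)
    fix s :: real
    have "e\<^sup>2 + (t - (t + e * s))\<^sup>2 = e\<^sup>2 * (1 + s\<^sup>2)" by (simp add: power2_eq_square algebra_simps)
    moreover have "1 + s\<^sup>2 \<noteq> 0" by (metis add_pos_nonneg less_numeral_extra(1) less_irrefl zero_le_power2)
    ultimately have "\<bar>e\<bar> * (e / (e\<^sup>2 + (t - (t + e * s))\<^sup>2)) = inverse (1 + s\<^sup>2)"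
      using e by (simp add: power2_eq_square inverse_eq_divide)
    moreover have "ennreal \<bar>e\<bar> * ennreal (e / (e\<^sup>2 + (t - (t + e * s))\<^sup>2)) = ennreal (\<bar>e\<bar> * (e / (e\<^sup>2 + (t - (t + e * s))\<^sup>2)))"
      using e by (intro ennreal_mult[symmetric]) auto
    ultimately show "ennreal \<bar>e\<bar> * ennreal (e / (e\<^sup>2 + (t - (t + e * s))\<^sup>2)) = ennreal (inverse (1 + s\<^sup>2))" by simp
  qed
  also have "\<dots> = ennreal pi"
    using nn_integral_eq_integral[OF integrable_inverse_1_plus_square] integral_inverse_1_plus_square by simp
  finally show ?thesis .
qed

lemma Re_cauchy:
  fixes \<gamma> :: "real \<Rightarrow> real"
  assumes g: "integrable lborel \<gamma>" and w: "Re w > 0"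
  shows "integrable lborel (\<lambda>s. \<gamma> s * (Re w / ((Re w)\<^sup>2 + (Im w - s)\<^sup>2)))"
    and "Re (cauchy (\<lambda>s. of_real (\<gamma> s)) w) = (\<integral>s. \<gamma> s * (Re w / ((Re w)\<^sup>2 + (Im w - s)\<^sup>2)) \<partial>lborel)"
proof -
  have g': "integrable lborel (\<lambda>s. complex_of_real (\<gamma> s))" using g by (rule integrable_of_real)
  have eq: "Re (of_real (\<gamma> s) / (w - \<i> * of_real s)) = \<gamma> s * (Re w / ((Re w)\<^sup>2 + (Im w - s)\<^sup>2))" for s
    by (simp add: Re_divide)
  show "integrable lborel (\<lambda>s. \<gamma> s * (Re w / ((Re w)\<^sup>2 + (Im w - s)\<^sup>2)))"
    using integrable_Re[OF integrable_cauchy[OF g' w]] unfolding eq .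
  show "Re (cauchy (\<lambda>s. of_real (\<gamma> s)) w) = (\<integral>s. \<gamma> s * (Re w / ((Re w)\<^sup>2 + (Im w - s)\<^sup>2)) \<partial>lborel)"
    unfolding cauchy_def integral_Re[OF integrable_cauchy[OF g' w], symmetric] eq ..
qed

text \<open>
  The real part of the Cauchy kernel is the Poisson kernel, which is positive and has mass \<open>pi\<close> in either variable.
\<close>

lemma Poisson_Lp:
  fixes \<gamma> :: "real \<Rightarrow> real"
  assumes p: "1 < p" and e: "e > 0" and g: "integrable lborel \<gamma>" and nn: "\<And>s. \<gamma> s \<ge> 0"
  shows "(\<integral>\<^sup>+t. ennreal (Re (cauchy (\<lambda>s. of_real (\<gamma> s)) (of_real e + \<i> * of_real t)) powr p) \<partial>lborel)
    \<le> ennreal (pi powr (p - 1) * pi) * (\<integral>\<^sup>+s. ennreal (\<gamma> s powr p) \<partial>lborel)"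
proof -
  note [measurable] = borel_measurable_integrable[OF g]
  let ?p' = "p / (p - 1)"
  have pp: "?p' > 1" "1 / ?p' + 1 / p = 1" "p / ?p' = p - 1" using p by (simp_all add: diff_divide_distrib)
  have "(\<integral>\<^sup>+t. ennreal (Re (cauchy (\<lambda>s. of_real (\<gamma> s)) (of_real e + \<i> * of_real t)) powr p) \<partial>lborel)
    \<le> ennreal (pi powr (p / ?p') * pi) * (\<integral>\<^sup>+s. ennreal (\<gamma> s powr p) \<partial>lborel)"
  proof (rule Schur_test[where h = "\<lambda>_. 1" and k = "\<lambda>t s. e / (e\<^sup>2 + (t - s)\<^sup>2)"])
    show "(\<integral>\<^sup>+y. ennreal (e / (e\<^sup>2 + (x - y)\<^sup>2) * 1 powr ?p') \<partial>lborel) \<le> ennreal (pi * 1 powr ?p')" for x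
      using nn_integral_Poisson[OF e, of x] by simp
    show "(\<integral>\<^sup>+x. ennreal (e / (e\<^sup>2 + (x - y)\<^sup>2) * 1 powr p) \<partial>lborel) \<le> ennreal (pi * 1 powr p)" for y
      using nn_integral_Poisson[OF e, of y] by (simp add: power2_commute[of _ y])
    fix t
    have w: "Re (of_real e + \<i> * of_real t) > 0" using e by simp
    have re: "Re (of_real e + \<i> * of_real t) = e" "Im (of_real e + \<i> * of_real t) = t" by simp_all
    note r = Re_cauchy[OF g w, unfolded re]
    show "Re (cauchy (\<lambda>s. of_real (\<gamma> s)) (of_real e + \<i> * of_real t)) \<ge> 0"
      unfolding r(2) using nn e by (intro Bochner_Integration.integral_nonneg mult_nonneg_nonneg divide_nonneg_nonneg add_nonneg_nonneg) auto
    show "ennreal (Re (cauchy (\<lambda>s. of_real (\<gamma> s)) (of_real e + \<i> * of_real t))) \<le> (\<integral>\<^sup>+s. ennreal (e / (e\<^sup>2 + (t - s)\<^sup>2) * \<gamma> s) \<partial>lborel)"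
      unfolding r(2) using e by (subst nn_integral_eq_integral[OF r(1), symmetric])
        (auto intro!: AE_I2 mult_nonneg_nonneg nn simp: mult.commute simp del: times_divide_eq_right)
  next
    show "(\<lambda>(t, s). e / (e\<^sup>2 + (t - s)\<^sup>2)) \<in> borel_measurable (borel \<Otimes>\<^sub>M borel)" by measurable
  qed (use pp(1,2) p e nn in \<open>simp_all\<close>)
  then show ?thesis by (simp only: pp(3))
qed

section \<open>Boundedness of the Cauchy transform\<close>

text \<open>
  The power has a primitive in the half plane, so its integral over a segment of the line equals
  that over the half circle of radius \<open>R\<close> to the right of it, where the transform of a density supported in \<open>[-N,N]\<close> is
  \<open>O(1/R)\<close>. For \<open>p > 1\<close> the bound tends to 0 as \<open>R\<close> grows.
\<close>

lemma cauchy_powr_integral_le: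
  fixes \<gamma> :: "real \<Rightarrow> real" and p :: real
  assumes p: "p > 0" and e: "e > 0" and g: "integrable lborel \<gamma>"
    and supp: "\<And>s. \<gamma> s \<noteq> 0 \<Longrightarrow> \<bar>s\<bar> \<le> N" and N: "N \<ge> 0" and R: "R > e + N"
    and pos: "\<And>w. Re w > 0 \<Longrightarrow> Re (cauchy (\<lambda>s. of_real (\<gamma> s)) w) > 0"
  defines "G \<equiv> \<lambda>w. cauchy (\<lambda>s. of_real (\<gamma> s)) w powr of_real p"
  shows "continuous_on UNIV (\<lambda>t. G (of_real e + \<i> * of_real t))"
    and "norm (\<integral>t. indicator {-R..R} t *\<^sub>R G (of_real e + \<i> * of_real t) \<partial>lborel)
     \<le> ((\<integral>s. \<bar>\<gamma> s\<bar> \<partial>lborel) / (R - e - N)) powr p * R * pi"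
proof -
  let ?F = "cauchy (\<lambda>s. of_real (\<gamma> s))"
  let ?S = "{w. Re w > 0}"
  have g': "integrable lborel (\<lambda>s. complex_of_real (\<gamma> s))" using g by (rule integrable_of_real)
  have S: "open ?S" "convex ?S"
    by (auto simp: open_halfspace_Re_gt convex_halfspace_Re_gt)
  have hG: "G holomorphic_on ?S"
    unfolding G_def
    by (intro holomorphic_on_powr cauchy_holomorphic[OF g'] holomorphic_on_const)
      (use pos in \<open>auto simp: complex_nonpos_Reals_iff dest: less_imp_le less_le_not_le[THEN iffD1]\<close>)
  obtain P where P: "\<And>w. w \<in> ?S \<Longrightarrow> (P has_field_derivative G w) (at w within ?S)"
    by (rule holomorphic_convex_primitive'[OF S(2,1) hG]) (rule that)
  have P': "(P has_field_derivative G w) (at w)" if "Re w > 0" for w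
  proof -
    have w: "w \<in> ?S" using that by simp
    show ?thesis using P[OF w] unfolding at_within_open[OF w S(1)] .
  qed
  let ?l = "\<lambda>t::real. of_real e + \<i> * of_real t"
  have l: "Re (?l t) > 0" for t using e by simp
  have cl: "continuous_on UNIV ?l" by (intro continuous_intros)
  show cG: "continuous_on UNIV (\<lambda>t. G (?l t))"
    by (rule continuous_on_compose2[OF holomorphic_on_imp_continuous_on[OF hG] cl]) (use l in auto)
  have R0: "R > 0" using R e N by simp
  have "(\<integral>t. indicator {-R..R} t *\<^sub>R G (?l t) \<partial>lborel) = - \<i> * P (?l R) - - \<i> * P (?l (-R))"
  proof (rule integral_FTC_atLeastAtMost)
    show "continuous_on {-R..R} (\<lambda>t. G (?l t))" using cG by (rule continuous_on_subset) simp
    fix t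
    have "(?l has_vector_derivative (0 + \<i> * 1)) (at t within {-R..R})"
      by (intro has_vector_derivative_add has_vector_derivative_const has_vector_derivative_mult_right
          has_vector_derivative_of_real[OF DERIV_ident, simplified])
    then have "((P \<circ> ?l) has_vector_derivative \<i> * G (?l t)) (at t within {-R..R})"
      using field_vector_diff_chain_within[of ?l \<i> t "{-R..R}" P "G (?l t)"] P'[OF l[of t]]
      by (simp add: has_field_derivative_at_within)
    from has_vector_derivative_mult_right[OF this, of "- \<i>"]
    show "((\<lambda>t. - \<i> * P (?l t)) has_vector_derivative G (?l t)) (at t within {-R..R})"
      by (simp add: o_def flip: mult.assoc)
  qed (use R0 in simp)
  then have n1: "norm (\<integral>t. indicator {-R..R} t *\<^sub>R G (?l t) \<partial>lborel) = norm (P (?l R) - P (?l (-R)))"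
    by (simp only: right_diff_distrib[symmetric] norm_mult norm_minus_cancel norm_ii mult_1)
  let ?c = "part_circlepath (of_real e) R (-(pi/2)) (pi/2)"
  have re: "Re w > 0 \<and> norm (w - of_real e) = R" if "w \<in> path_image ?c" for w
  proof -
    have "- (pi / 2) \<le> pi / 2" using pi_gt_zero by simp
    then have "\<exists>x. w = of_real e + of_real R * exp (\<i> * of_real x) \<and> - (pi / 2) \<le> x \<and> x \<le> pi / 2"
      using that by (simp add: path_image_part_circlepath)
    then obtain x where x: "w = of_real e + of_real R * exp (\<i> * of_real x)" "- (pi / 2) \<le> x" "x \<le> pi / 2"
      by blast
    have "cos x \<ge> 0" by (intro cos_ge_zero x)
    then have "Re w > 0" using x R0 e by (auto simp: Re_exp intro!: add_pos_nonneg)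
    then show ?thesis using x R0 by (simp add: norm_mult)
  qed
  have ci0: "(G has_contour_integral (P (pathfinish ?c) - P (pathstart ?c))) ?c"
    by (rule contour_integral_primitive[where S = ?S]) (use P re in auto)
  have "exp (\<i> * of_real (pi / 2)) = \<i>" "exp (\<i> * of_real (- (pi / 2))) = - \<i>"
    by (simp_all only: cis_conv_exp[symmetric] cis_pi_half cis_minus_pi_half)
  then have ends: "pathfinish ?c = ?l R" "pathstart ?c = ?l (-R)"
    unfolding pathstart_part_circlepath pathfinish_part_circlepath by simp_all
  have ci: "(G has_contour_integral (P (?l R) - P (?l (-R)))) ?c" using ci0 by (simp only: ends)
  have "norm (P (?l R) - P (?l (-R))) \<le> ((\<integral>s. \<bar>\<gamma> s\<bar> \<partial>lborel) / (R - e - N)) powr p * R * (pi / 2 - -(pi/2))"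
  proof (rule has_contour_integral_bound_part_circlepath[OF ci])
    fix w assume w: "w \<in> path_image ?c"
    have d: "R - e - N \<le> norm (w - \<i> * of_real s)" if "complex_of_real (\<gamma> s) \<noteq> 0" for s
    proof -
      have "norm (w - of_real e) \<le> norm (w - \<i> * of_real s) + norm (\<i> * of_real s - of_real e)"
        using norm_triangle_ineq[of "w - \<i> * of_real s" "\<i> * of_real s - of_real e"] by simp
      also have "norm (\<i> * of_real s - of_real e) \<le> norm (\<i> * of_real s) + norm (complex_of_real e)"
        by (rule norm_triangle_ineq4)
      also have "\<dots> = \<bar>s\<bar> + e" using e by (simp add: norm_mult)
      finally show ?thesis using re[OF w] supp[of s] that by simp
    qed
    have "norm (?F w) \<le> (\<integral>s. norm (complex_of_real (\<gamma> s)) \<partial>lborel) / (R - e - N)"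
      using re[OF w] R by (intro cauchy_le[OF g'] d) auto
    then have "norm (?F w) powr p \<le> ((\<integral>s. \<bar>\<gamma> s\<bar> \<partial>lborel) / (R - e - N)) powr p"
      using p by (intro powr_mono2) auto
    then show "norm (G w) \<le> ((\<integral>s. \<bar>\<gamma> s\<bar> \<partial>lborel) / (R - e - N)) powr p"
      by (simp add: G_def norm_powr_real_powr')
  qed (use R0 pi_gt_zero in auto)
  then show "norm (\<integral>t. indicator {-R..R} t *\<^sub>R G (?l t) \<partial>lborel) \<le> ((\<integral>s. \<bar>\<gamma> s\<bar> \<partial>lborel) / (R - e - N)) powr p * R * pi"
    unfolding n1 by simp
qed

lemma continuous_on_cauchy_line:
  assumes g: "integrable lborel \<gamma>" and e: "e > 0"
  shows "continuous_on A (\<lambda>t. cauchy \<gamma> (of_real e + \<i> * of_real t))"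
proof -
  have "continuous_on A (\<lambda>t::real. of_real e + \<i> * of_real t)" by (intro continuous_intros)
  then show ?thesis
    by (rule continuous_on_compose2[OF holomorphic_on_imp_continuous_on[OF cauchy_holomorphic[OF g]]]) (use e in auto)
qed

lemma measurable_cauchy_line [measurable (raw)]:
  "integrable lborel \<gamma> \<Longrightarrow> e > 0 \<Longrightarrow> (\<lambda>t. cauchy \<gamma> (of_real e + \<i> * of_real t)) \<in> borel_measurable borel"
  by (intro borel_measurable_continuous_onI continuous_on_cauchy_line)

lemma indicator_Icc_tendsto: "(\<lambda>n. indicator {- real n..real n} x :: real) \<longlonglongrightarrow> 1"
proof (rule tendsto_eventually)
  obtain m :: nat where m: "\<bar>x\<bar> \<le> real m" using real_arch_simple by blast
  show "\<forall>\<^sub>F n in sequentially. indicator {- real n..real n} x = (1::real)"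
    using eventually_ge_at_top[of m] by eventually_elim (use m in \<open>auto simp: indicator_def\<close>)
qed

lemma contour_bound_tendsto_0:
  fixes p c I :: real assumes p: "p > 1" and c: "c \<ge> 0" and I: "I \<ge> 0"
  shows "(\<lambda>n. (I / (real n - c)) powr p * real n * pi) \<longlonglongrightarrow> 0"
proof (rule tendsto_sandwich[of "\<lambda>_. 0" _ _ "\<lambda>n. ((2 * I) powr p * pi) * (real n powr (1 - p))"])
  show "\<forall>\<^sub>F n in sequentially. (I / (real n - c)) powr p * real n * pi \<le> ((2 * I) powr p * pi) * (real n powr (1 - p))"
    using eventually_ge_at_top[of "nat \<lceil>2 * c\<rceil> + 1"]
  proof eventually_elim
    case (elim n)
    then have n: "real n \<ge> 2 * c" "real n > 0" by linarith+
    have "I / (real n - c) \<le> I / (real n / 2)" using n c I by (intro divide_left_mono mult_pos_pos) auto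
    then have "(I / (real n - c)) powr p \<le> (2 * I / real n) powr p" using n I c p by (intro powr_mono2) (auto simp: mult.commute)
    also have "\<dots> = (2 * I) powr p / real n powr p" using n I by (simp add: powr_divide)
    finally have "(I / (real n - c)) powr p * (real n * pi) \<le> (2 * I) powr p / real n powr p * (real n * pi)"
      by (intro mult_right_mono) auto
    also have "\<dots> = ((2 * I) powr p * pi) * (real n powr (1 - p))" using n by (simp add: powr_diff)
    finally show ?case by simp
  qed
  have "(\<lambda>n. real n powr (1 - p)) \<longlonglongrightarrow> 0"
    using p by (intro tendsto_neg_powr filterlim_real_sequentially) auto
  from tendsto_mult_left[OF this, of "(2 * I) powr p * pi"]
  show "(\<lambda>n. ((2 * I) powr p * pi) * (real n powr (1 - p))) \<longlonglongrightarrow> 0" by simp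
qed (auto intro!: always_eventually)

text \<open>
  Integrating the power inequality over \<open>[-R,R]\<close> along the line leaves the Poisson integral and
  the integral of \<open>F^p\<close>, and the latter disappears as \<open>R\<close> grows. The positivity of the real part, which makes \<open>F^p\<close> holomorphic, uses that the density is nonnegative and
  not almost everywhere 0.
\<close>

lemma cauchy_Lp_supported:
  fixes \<gamma> :: "real \<Rightarrow> real" and p :: real
  assumes p: "1 < p" and AB: "A \<ge> 0" "B \<ge> 0"
    "\<And>z. Re z > 0 \<Longrightarrow> norm z powr p \<le> A * Re z powr p - B * Re (z powr of_real p)"
    and e: "e > 0" and g: "integrable lborel \<gamma>" and nn: "\<And>s. \<gamma> s \<ge> 0"
    and supp: "\<And>s. \<gamma> s \<noteq> 0 \<Longrightarrow> \<bar>s\<bar> \<le> N" and N: "N \<ge> 0"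
  shows "(\<integral>\<^sup>+t. ennreal (norm (cauchy (\<lambda>s. of_real (\<gamma> s)) (of_real e + \<i> * of_real t)) powr p) \<partial>lborel)
    \<le> ennreal (A * (pi powr (p - 1) * pi)) * (\<integral>\<^sup>+s. ennreal (\<gamma> s powr p) \<partial>lborel)"
proof (cases "AE s in lborel. \<gamma> s = 0")
  case True
  have [measurable]: "\<gamma> \<in> borel_measurable borel" using g by auto
  have "cauchy (\<lambda>s. of_real (\<gamma> s)) w = 0" for w
    unfolding cauchy_def by (rule integral_eq_zero_AE, use True in eventually_elim) simp
  then show ?thesis by simp
next
  case False
  have g': "integrable lborel (\<lambda>s. complex_of_real (\<gamma> s))" using g by (rule integrable_of_real)
  let ?l = "\<lambda>t::real. of_real e + \<i> * of_real t"
  let ?F = "\<lambda>t. cauchy (\<lambda>s. of_real (\<gamma> s)) (?l t)"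
  have pos: "Re (cauchy (\<lambda>s. of_real (\<gamma> s)) w) > 0" if w: "Re w > 0" for w
  proof -
    have k: "Re w / ((Re w)\<^sup>2 + (Im w - s)\<^sup>2) > 0" for s using w by (auto intro!: divide_pos_pos add_pos_nonneg)
    have ge: "Re (cauchy (\<lambda>s. of_real (\<gamma> s)) w) \<ge> 0"
      unfolding Re_cauchy(2)[OF g w] by (intro Bochner_Integration.integral_nonneg mult_nonneg_nonneg nn less_imp_le[OF k])
    moreover have "Re (cauchy (\<lambda>s. of_real (\<gamma> s)) w) \<noteq> 0"
    proof
      assume "Re (cauchy (\<lambda>s. of_real (\<gamma> s)) w) = 0"
      then have "AE s in lborel. \<gamma> s * (Re w / ((Re w)\<^sup>2 + (Im w - s)\<^sup>2)) = 0"
        unfolding Re_cauchy(2)[OF g w]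
        by (subst (asm) integral_nonneg_eq_0_iff_AE[OF Re_cauchy(1)[OF g w]])
          (auto intro!: AE_I2 mult_nonneg_nonneg[OF nn less_imp_le[OF k]] simp del: times_divide_eq_right)
      then have "AE s in lborel. \<gamma> s = 0"
        by eventually_elim (metis k less_irrefl mult_eq_0_iff)
      then show False using False by simp
    qed
    ultimately show ?thesis by simp
  qed
  have l: "Re (?l t) > 0" for t using e by simp
  define I where "I = (\<integral>s. \<bar>\<gamma> s\<bar> \<partial>lborel)"
  define K where "K = ennreal (pi powr (p - 1) * pi) * (\<integral>\<^sup>+s. ennreal (\<gamma> s powr p) \<partial>lborel)"
  have [measurable]: "?F \<in> borel_measurable borel" by (rule measurable_cauchy_line[OF g' e])
  \<comment> \<open>The contour bound applies to radii beyond e + N only, so the exhaustion of the line starts at m.\<close>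
  obtain m :: nat where m: "e + N < real m" using reals_Archimedean2 by blast
  define \<delta> where "\<delta> n = (I / (real (n + m) - (e + N))) powr p * real (n + m) * pi" for n
  have cont: "continuous_on A ?F" for A by (rule continuous_on_cauchy_line[OF g' e])
  have bound: "(\<integral>\<^sup>+t. ennreal (indicator {- real (n + m)..real (n + m)} t * norm (?F t) powr p) \<partial>lborel) \<le> ennreal A * K + ennreal (B * \<delta> n)" for n
  proof -
    let ?R = "real (n + m)"
    have R: "?R > e + N" using m by simp
    let ?G = "\<lambda>t. ?F t powr of_real p"
    note C = cauchy_powr_integral_le[OF _ e g supp N R pos, of p, folded I_def]
    have i1: "integrable lborel (\<lambda>t. indicator {-?R..?R} t * norm (?F t) powr p)"
      and i2: "integrable lborel (\<lambda>t. indicator {-?R..?R} t * Re (?F t) powr p)"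
      and i3: "integrable lborel (\<lambda>t. indicator {-?R..?R} t *\<^sub>R ?G t)"
    proof -
      have "continuous_on {-?R..?R} (\<lambda>t. norm (?F t) powr p)"
        by (intro continuous_intros continuous_on_powr' cont) (use p in auto)
      from borel_integrable_compact[OF compact_Icc this] show "integrable lborel (\<lambda>t. indicator {-?R..?R} t * norm (?F t) powr p)"
        unfolding real_scaleR_def .
      have "continuous_on {-?R..?R} (\<lambda>t. Re (?F t) powr p)"
        by (intro continuous_intros continuous_on_powr' cont) (use p pos[OF l] in \<open>auto simp: less_imp_le\<close>)
      from borel_integrable_compact[OF compact_Icc this] show "integrable lborel (\<lambda>t. indicator {-?R..?R} t * Re (?F t) powr p)"
        unfolding real_scaleR_def .
      have "continuous_on {-?R..?R} ?G"
        using continuous_on_subset[OF C(1)] p by auto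
      then show "integrable lborel (\<lambda>t. indicator {-?R..?R} t *\<^sub>R ?G t)"
        by (rule borel_integrable_compact[OF compact_Icc])
    qed
    have "(\<integral>t. indicator {-?R..?R} t * norm (?F t) powr p \<partial>lborel) \<le>
      (\<integral>t. A * (indicator {-?R..?R} t * Re (?F t) powr p) - B * Re (indicator {-?R..?R} t *\<^sub>R ?G t) \<partial>lborel)"
    proof (rule integral_mono[OF i1])
      show "integrable lborel (\<lambda>t. A * (indicator {-?R..?R} t * Re (?F t) powr p) - B * Re (indicator {-?R..?R} t *\<^sub>R ?G t))"
        by (intro Bochner_Integration.integrable_diff integrable_mult_right i2 integrable_Re i3)
      show "indicator {-?R..?R} t * norm (?F t) powr p \<le> A * (indicator {-?R..?R} t * Re (?F t) powr p) - B * Re (indicator {-?R..?R} t *\<^sub>R ?G t)" for t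
        using AB(3)[OF pos[OF l[of t]]] by (cases "t \<in> {-?R..?R}") auto
    qed
    also have "\<dots> = A * (\<integral>t. indicator {-?R..?R} t * Re (?F t) powr p \<partial>lborel) - B * Re (\<integral>t. indicator {-?R..?R} t *\<^sub>R ?G t \<partial>lborel)"
      by (simp only: Bochner_Integration.integral_diff integrable_mult_right i2 integrable_Re i3 integral_mult_right_zero integral_Re)
    also have "\<dots> \<le> A * (\<integral>t. indicator {-?R..?R} t * Re (?F t) powr p \<partial>lborel) + B * \<delta> n"
    proof -
      have "- Re (\<integral>t. indicator {-?R..?R} t *\<^sub>R ?G t \<partial>lborel) \<le> norm (\<integral>t. indicator {-?R..?R} t *\<^sub>R ?G t \<partial>lborel)"
        using abs_Re_le_cmod abs_ge_minus_self order_trans by blast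
      also have "\<dots> \<le> \<delta> n" using C(2) p unfolding \<delta>_def by (simp add: diff_diff_eq)
      finally have "B * - Re (\<integral>t. indicator {-?R..?R} t *\<^sub>R ?G t \<partial>lborel) \<le> B * \<delta> n" by (rule mult_left_mono) (rule AB)
      then show ?thesis by simp
    qed
    finally have le: "(\<integral>t. indicator {-?R..?R} t * norm (?F t) powr p \<partial>lborel) \<le>
       A * (\<integral>t. indicator {-?R..?R} t * Re (?F t) powr p \<partial>lborel) + B * \<delta> n" .
    have d0: "B * \<delta> n \<ge> 0" using AB by (simp add: \<delta>_def)
    have y0: "(\<integral>t. indicator {-?R..?R} t * Re (?F t) powr p \<partial>lborel) \<ge> 0" by (intro Bochner_Integration.integral_nonneg) auto
    have "(\<integral>\<^sup>+t. ennreal (indicator {-?R..?R} t * norm (?F t) powr p) \<partial>lborel) = ennreal (\<integral>t. indicator {-?R..?R} t * norm (?F t) powr p \<partial>lborel)"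
      by (intro nn_integral_eq_integral i1) auto
    also have "\<dots> \<le> ennreal A * ennreal (\<integral>t. indicator {-?R..?R} t * Re (?F t) powr p \<partial>lborel) + ennreal (B * \<delta> n)"
      using le AB(1) d0 y0 by (simp add: ennreal_leI flip: ennreal_mult ennreal_plus)
    also have "ennreal (\<integral>t. indicator {-?R..?R} t * Re (?F t) powr p \<partial>lborel) = (\<integral>\<^sup>+t. ennreal (indicator {-?R..?R} t * Re (?F t) powr p) \<partial>lborel)"
      by (intro nn_integral_eq_integral[symmetric] i2) auto
    also have "\<dots> \<le> (\<integral>\<^sup>+t. ennreal (Re (?F t) powr p) \<partial>lborel)"
      by (intro nn_integral_mono ennreal_leI) (auto simp: indicator_def)
    also have "\<dots> \<le> K" unfolding K_def by (rule Poisson_Lp[OF p e g nn])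
    finally show ?thesis by (simp add: add_right_mono mult_left_mono)
  qed
  have "(\<integral>\<^sup>+t. ennreal (norm (?F t) powr p) \<partial>lborel) \<le> ennreal A * K + ennreal (B * 0)"
  proof (rule nn_integral_tendsto_le[OF _ _ bound])
    show "AE t in lborel. (\<lambda>n. ennreal (indicator {- real (n + m)..real (n + m)} t * norm (?F t) powr p)) \<longlonglongrightarrow> ennreal (norm (?F t) powr p)"
    proof (rule AE_I2)
      fix t
      have "(\<lambda>n. indicator {- real (n + m)..real (n + m)} t * norm (?F t) powr p) \<longlonglongrightarrow> 1 * norm (?F t) powr p"
        using LIMSEQ_ignore_initial_segment[OF indicator_Icc_tendsto[of t], of m] by (intro tendsto_intros) simp
      then show "(\<lambda>n. ennreal (indicator {- real (n + m)..real (n + m)} t * norm (?F t) powr p)) \<longlonglongrightarrow> ennreal (norm (?F t) powr p)"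
        by (intro tendsto_ennrealI) simp
    qed
    have "\<delta> \<longlonglongrightarrow> 0"
      using LIMSEQ_ignore_initial_segment[OF contour_bound_tendsto_0[OF p, of "e + N" I], of m] e N
      by (simp add: \<delta>_def[abs_def] I_def)
    then show "(\<lambda>n. ennreal A * K + ennreal (B * \<delta> n)) \<longlonglongrightarrow> ennreal A * K + ennreal (B * 0)"
      by (intro tendsto_add tendsto_const tendsto_ennrealI tendsto_mult)
  qed measurable
  then show ?thesis using AB(1) by (simp add: K_def ennreal_mult mult.assoc)
qed

lemma cauchy_tendsto:
  assumes g: "integrable lborel \<gamma>" and w: "Re w > 0"
  shows "(\<lambda>n. cauchy (\<lambda>s. indicator {- real n..real n} s *\<^sub>R \<gamma> s) w) \<longlonglongrightarrow> cauchy \<gamma> w"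
  unfolding cauchy_def
proof (rule integral_dominated_convergence[where w = "\<lambda>s. norm (\<gamma> s / (w - \<i> * of_real s))"])
  note [measurable] = borel_measurable_integrable[OF g]
  show "AE s in lborel. (\<lambda>n. (indicator {- real n..real n} s *\<^sub>R \<gamma> s) / (w - \<i> * of_real s)) \<longlonglongrightarrow> \<gamma> s / (w - \<i> * of_real s)"
  proof (rule AE_I2)
    fix s
    have "(\<lambda>n. (indicator {- real n..real n} s *\<^sub>R \<gamma> s) / (w - \<i> * of_real s)) \<longlonglongrightarrow> (1 *\<^sub>R \<gamma> s) / (w - \<i> * of_real s)"
      using half_plane_kernel[OF w, of s] by (intro tendsto_intros indicator_Icc_tendsto) auto
    then show "(\<lambda>n. (indicator {- real n..real n} s *\<^sub>R \<gamma> s) / (w - \<i> * of_real s)) \<longlonglongrightarrow> \<gamma> s / (w - \<i> * of_real s)" by simp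
  qed
  show "AE s in lborel. norm ((indicator {- real n..real n} s *\<^sub>R \<gamma> s) / (w - \<i> * of_real s)) \<le> norm (\<gamma> s / (w - \<i> * of_real s))" for n
    by (intro AE_I2) (auto simp: indicator_def)
  show "(\<lambda>s. \<gamma> s / (w - \<i> * of_real s)) \<in> borel_measurable lborel"
    "\<And>n. (\<lambda>s. (indicator {- real n..real n} s *\<^sub>R \<gamma> s) / (w - \<i> * of_real s)) \<in> borel_measurable lborel"
    by measurable
qed (use integrable_norm[OF integrable_cauchy[OF g w]] in simp)

text \<open>
  Truncating the density to \<open>[-n,n]\<close> and Fatou's lemma remove the condition on the support.
\<close>

lemma cauchy_Lp_nonneg:
  fixes \<gamma> :: "real \<Rightarrow> real" and p :: real
  assumes p: "1 < p" and AB: "A \<ge> 0" "B \<ge> 0"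
    "\<And>z. Re z > 0 \<Longrightarrow> norm z powr p \<le> A * Re z powr p - B * Re (z powr of_real p)"
    and e: "e > 0" and g: "integrable lborel \<gamma>" and nn: "\<And>s. \<gamma> s \<ge> 0"
  shows "(\<integral>\<^sup>+t. ennreal (norm (cauchy (\<lambda>s. of_real (\<gamma> s)) (of_real e + \<i> * of_real t)) powr p) \<partial>lborel)
    \<le> ennreal (A * (pi powr (p - 1) * pi)) * (\<integral>\<^sup>+s. ennreal (\<gamma> s powr p) \<partial>lborel)"
proof (rule nn_integral_tendsto_le)
  let ?g = "\<lambda>n s. indicator {- real n..real n} s * \<gamma> s"
  have g': "integrable lborel (\<lambda>s. complex_of_real (\<gamma> s))" using g by (rule integrable_of_real)
  have gn: "integrable lborel (?g n)" for n
    by (rule Bochner_Integration.integrable_bound[OF g]) (use g in \<open>auto simp: indicator_def\<close>)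
  have eq: "(\<lambda>s. complex_of_real (?g n s)) = (\<lambda>s. indicator {- real n..real n} s *\<^sub>R complex_of_real (\<gamma> s))" for n
    by (auto simp: indicator_def)
  show "AE t in lborel. (\<lambda>n. ennreal (norm (cauchy (\<lambda>s. of_real (?g n s)) (of_real e + \<i> * of_real t)) powr p))
      \<longlonglongrightarrow> ennreal (norm (cauchy (\<lambda>s. of_real (\<gamma> s)) (of_real e + \<i> * of_real t)) powr p)"
    unfolding eq using e p
    by (intro AE_I2 tendsto_ennrealI tendsto_powr' tendsto_norm cauchy_tendsto[OF g'] tendsto_const) auto
  show "(\<integral>\<^sup>+t. ennreal (norm (cauchy (\<lambda>s. of_real (?g n s)) (of_real e + \<i> * of_real t)) powr p) \<partial>lborel)
      \<le> ennreal (A * (pi powr (p - 1) * pi)) * (\<integral>\<^sup>+s. ennreal (\<gamma> s powr p) \<partial>lborel)" for n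
  proof -
    have "(\<integral>\<^sup>+t. ennreal (norm (cauchy (\<lambda>s. of_real (?g n s)) (of_real e + \<i> * of_real t)) powr p) \<partial>lborel)
      \<le> ennreal (A * (pi powr (p - 1) * pi)) * (\<integral>\<^sup>+s. ennreal (?g n s powr p) \<partial>lborel)"
      by (rule cauchy_Lp_supported[OF p AB e gn, where N = "real n"])
        (auto simp: indicator_def nn split: if_splits)
    also have "(\<integral>\<^sup>+s. ennreal (?g n s powr p) \<partial>lborel) \<le> (\<integral>\<^sup>+s. ennreal (\<gamma> s powr p) \<partial>lborel)"
      using nn by (intro nn_integral_mono ennreal_leI) (auto simp: indicator_def)
    finally show ?thesis by (simp add: mult_left_mono)
  qed
  show "(\<lambda>t. ennreal (norm (cauchy (\<lambda>s. of_real (?g n s)) (of_real e + \<i> * of_real t)) powr p)) \<in> borel_measurable lborel" for n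
    using measurable_cauchy_line[OF integrable_of_real[OF gn[of n]] e] by measurable
qed (rule tendsto_const)

lemma cauchy_add:
  assumes "integrable lborel f" "integrable lborel g" "Re w > 0"
  shows "cauchy (\<lambda>s. f s + g s) w = cauchy f w + cauchy g w"
  unfolding cauchy_def add_divide_distrib
  by (intro Bochner_Integration.integral_add integrable_cauchy assms)

lemma cauchy_cmult: "cauchy (\<lambda>s. c * f s) w = c * cauchy f w"
  unfolding cauchy_def by (simp only: times_divide_eq_right[symmetric] integral_mult_right_zero)

text \<open>
  A complex density is a combination of four nonnegative ones.
\<close>

lemma cauchy_Lp_le2:
  fixes p :: real assumes p: "1 < p" "p \<le> 2"
  obtains C where "C \<ge> 0" "\<And>e \<gamma>. e > 0 \<Longrightarrow> integrable lborel \<gamma> \<Longrightarrow>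
    (\<integral>\<^sup>+t. ennreal (norm (cauchy \<gamma> (of_real e + \<i> * of_real t)) powr p) \<partial>lborel) \<le> ennreal C * (\<integral>\<^sup>+s. ennreal (norm (\<gamma> s) powr p) \<partial>lborel)"
proof -
  obtain A B where AB: "A \<ge> 0" "B \<ge> 0"
    "\<And>z. Re z > 0 \<Longrightarrow> norm z powr p \<le> A * Re z powr p - B * Re (z powr of_real p)"
    by (rule half_plane_powr_inequality[OF p]) blast
  define K where "K = A * (pi powr (p - 1) * pi)"
  have K: "K \<ge> 0" using AB by (simp add: K_def)
  show thesis
  proof (rule that[of "2 powr p * (2 powr p * (4 * K))"])
    show "2 powr p * (2 powr p * (4 * K)) \<ge> 0" using K by simp
    fix e :: real and \<gamma> :: "real \<Rightarrow> complex" assume e: "e > 0" and g: "integrable lborel \<gamma>"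
    note [measurable] = borel_measurable_integrable[OF g]
    let ?l = "\<lambda>t::real. of_real e + \<i> * of_real t"
    let ?J = "\<integral>\<^sup>+s. ennreal (norm (\<gamma> s) powr p) \<partial>lborel"
    have part: "(\<integral>\<^sup>+t. ennreal (norm (cauchy (\<lambda>s. of_real (r s)) (?l t)) powr p) \<partial>lborel) \<le> ennreal K * ?J"
      if r: "integrable lborel r" "\<And>s. 0 \<le> r s" "\<And>s. r s \<le> norm (\<gamma> s)" for r
    proof -
      have "(\<integral>\<^sup>+t. ennreal (norm (cauchy (\<lambda>s. of_real (r s)) (?l t)) powr p) \<partial>lborel) \<le> ennreal K * (\<integral>\<^sup>+s. ennreal (r s powr p) \<partial>lborel)"
        unfolding K_def by (rule cauchy_Lp_nonneg[OF p(1) AB e r(1,2)])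
      also have "(\<integral>\<^sup>+s. ennreal (r s powr p) \<partial>lborel) \<le> ?J"
        using p r by (intro nn_integral_mono ennreal_leI powr_mono2) auto
      finally show ?thesis by (simp add: mult_left_mono)
    qed
    define r1 where "r1 s = max 0 (Re (\<gamma> s))" for s
    define r2 where "r2 s = max 0 (- Re (\<gamma> s))" for s
    define r3 where "r3 s = max 0 (Im (\<gamma> s))" for s
    define r4 where "r4 s = max 0 (- Im (\<gamma> s))" for s
    have i: "integrable lborel r1" "integrable lborel r2" "integrable lborel r3" "integrable lborel r4"
      unfolding r1_def[abs_def] r2_def[abs_def] r3_def[abs_def] r4_def[abs_def]
      by (intro integrable_max integrable_zero integrable_minus integrable_Re integrable_Im g)+
    note i' = i[THEN integrable_of_real[where 'a = complex]]
    have b: "0 \<le> r1 s" "r1 s \<le> norm (\<gamma> s)" "0 \<le> r2 s" "r2 s \<le> norm (\<gamma> s)"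
      "0 \<le> r3 s" "r3 s \<le> norm (\<gamma> s)" "0 \<le> r4 s" "r4 s \<le> norm (\<gamma> s)" for s
      using abs_Re_le_cmod[of "\<gamma> s"] abs_Im_le_cmod[of "\<gamma> s"] by (auto simp: r1_def r2_def r3_def r4_def)
    let ?c = "\<lambda>r t. cauchy (\<lambda>s. of_real (r s)) (?l t)"
    have split: "\<gamma> = (\<lambda>s. (of_real (r1 s) + (-1) * of_real (r2 s)) + (\<i> * of_real (r3 s) + (- \<i>) * of_real (r4 s)))"
      by (rule ext) (simp add: complex_eq_iff r1_def r2_def r3_def r4_def max_def)
    have c: "cauchy \<gamma> (?l t) = (?c r1 t + (-1) * ?c r2 t) + (\<i> * ?c r3 t + (- \<i>) * ?c r4 t)" for t
    proof -
      have w: "Re (?l t) > 0" using e by simp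
      show ?thesis
        by (subst split) (simp only: cauchy_add[OF _ _ w] cauchy_cmult i' Bochner_Integration.integrable_add integrable_mult_right)
    qed
    have le: "ennreal (norm (cauchy \<gamma> (?l t)) powr p) \<le> ennreal (2 powr p * 2 powr p) *
       ((ennreal (norm (?c r1 t) powr p) + ennreal (norm (?c r2 t) powr p)) + (ennreal (norm (?c r3 t) powr p) + ennreal (norm (?c r4 t) powr p)))" for t
    proof -
      have "norm (cauchy \<gamma> (?l t)) \<le> (norm (?c r1 t) + norm (?c r2 t)) + (norm (?c r3 t) + norm (?c r4 t))"
        unfolding c by (intro order_trans[OF norm_triangle_ineq] add_mono) (simp_all add: norm_mult)
      then have "norm (cauchy \<gamma> (?l t)) powr p \<le> ((norm (?c r1 t) + norm (?c r2 t)) + (norm (?c r3 t) + norm (?c r4 t))) powr p"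
        using p by (intro powr_mono2) auto
      also have "\<dots> \<le> 2 powr p * ((norm (?c r1 t) + norm (?c r2 t)) powr p + (norm (?c r3 t) + norm (?c r4 t)) powr p)"
        using p by (intro powr_add_le) auto
      also have "\<dots> \<le> 2 powr p * (2 powr p * (norm (?c r1 t) powr p + norm (?c r2 t) powr p) + 2 powr p * (norm (?c r3 t) powr p + norm (?c r4 t) powr p))"
        using p by (intro mult_left_mono add_mono powr_add_le) auto
      also have "\<dots> = 2 powr p * 2 powr p * ((norm (?c r1 t) powr p + norm (?c r2 t) powr p) + (norm (?c r3 t) powr p + norm (?c r4 t) powr p))"
        by (simp add: algebra_simps)
      finally show ?thesis by (simp add: ennreal_leI flip: ennreal_plus ennreal_mult)
    qed
    have m: "(\<lambda>t. ennreal (norm (?c r t) powr p)) \<in> borel_measurable lborel" if "integrable lborel r" for r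
      using measurable_cauchy_line[OF integrable_of_real[OF that] e] by measurable
    note m4 = m[OF i(1)] m[OF i(2)] m[OF i(3)] m[OF i(4)]
    have "(\<integral>\<^sup>+t. ennreal (norm (cauchy \<gamma> (?l t)) powr p) \<partial>lborel) \<le> (\<integral>\<^sup>+t. ennreal (2 powr p * 2 powr p) *
       ((ennreal (norm (?c r1 t) powr p) + ennreal (norm (?c r2 t) powr p)) + (ennreal (norm (?c r3 t) powr p) + ennreal (norm (?c r4 t) powr p))) \<partial>lborel)"
      by (intro nn_integral_mono le)
    also have "\<dots> = ennreal (2 powr p * 2 powr p) *
      (((\<integral>\<^sup>+t. ennreal (norm (?c r1 t) powr p) \<partial>lborel) + (\<integral>\<^sup>+t. ennreal (norm (?c r2 t) powr p) \<partial>lborel))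
      + ((\<integral>\<^sup>+t. ennreal (norm (?c r3 t) powr p) \<partial>lborel) + (\<integral>\<^sup>+t. ennreal (norm (?c r4 t) powr p) \<partial>lborel)))"
      by (simp only: nn_integral_cmult nn_integral_add m4 borel_measurable_add)
    also have "\<dots> \<le> ennreal (2 powr p * 2 powr p) * ((ennreal K * ?J + ennreal K * ?J) + (ennreal K * ?J + ennreal K * ?J))"
      by (intro mult_left_mono add_mono part i b) auto
    also have "\<dots> = ennreal (2 powr p * (2 powr p * (4 * K))) * ?J"
    proof -
      have "(ennreal K * ?J + ennreal K * ?J) + (ennreal K * ?J + ennreal K * ?J) = ennreal (4 * K) * ?J"
        using K by (simp add: ennreal_mult distrib_right[symmetric] flip: ennreal_plus) 
      then show ?thesis using K by (simp add: ennreal_mult mult.assoc)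
    qed
    finally show "(\<integral>\<^sup>+t. ennreal (norm (cauchy \<gamma> (?l t)) powr p) \<partial>lborel) \<le> ennreal (2 powr p * (2 powr p * (4 * K))) * ?J" .
  qed
qed

text \<open>
  Pairing the transform with \<open>\<eta> = |F|^(p-2) F\<close> on \<open>[-n,n]\<close> gives the integral \<open>X\<close> of \<open>|F|^p\<close> over this
  interval. The kernel is conjugated when its arguments are exchanged, so the transform can be moved to \<open>\<eta>\<close>, and
  Hoelder's inequality yields \<open>X \<le> (C X)^(1/p') ||\<gamma>||_p\<close>. Since \<open>X\<close> is finite, it can be divided out.
\<close>

lemma cauchy_Lp_dual:
  fixes p p' C :: real
  assumes p: "p > 1" "p' > 1" "1 / p' + 1 / p = 1" and C: "C \<ge> 0"
    and dual: "\<And>e \<gamma>. e > 0 \<Longrightarrow> integrable lborel \<gamma> \<Longrightarrow>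
    (\<integral>\<^sup>+t. ennreal (norm (cauchy \<gamma> (of_real e + \<i> * of_real t)) powr p') \<partial>lborel) \<le> ennreal C * (\<integral>\<^sup>+s. ennreal (norm (\<gamma> s) powr p') \<partial>lborel)"
    and e: "e > 0" and g: "integrable lborel \<gamma>"
  shows "(\<integral>\<^sup>+t. ennreal (norm (cauchy \<gamma> (of_real e + \<i> * of_real t)) powr p) \<partial>lborel) \<le> ennreal (C powr (p / p')) * (\<integral>\<^sup>+s. ennreal (norm (\<gamma> s) powr p) \<partial>lborel)"
proof (cases "(\<integral>\<^sup>+s. ennreal (norm (\<gamma> s) powr p) \<partial>lborel) = \<infinity> \<and> C \<noteq> 0")
  case True
  then show ?thesis using C by (simp add: ennreal_mult_top)
next
  case False
  note [measurable] = borel_measurable_integrable[OF g]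
  let ?l = "\<lambda>t::real. of_real e + \<i> * of_real t"
  let ?F = "\<lambda>t. cauchy \<gamma> (?l t)"
  have mF [measurable]: "?F \<in> borel_measurable borel" by (rule measurable_cauchy_line[OF g e])
  \<comment> \<open>Hence |\<eta>|^p' = |F|^p on [-n,n] for the function \<eta> below.\<close>
  have p1: "(p - 1) * p' = p" using p by (simp add: field_simps)
  have le: "(\<integral>\<^sup>+t. ennreal (indicator {- real n..real n} t * norm (?F t) powr p) \<partial>lborel) \<le> ennreal (C powr (p / p')) * (\<integral>\<^sup>+s. ennreal (norm (\<gamma> s) powr p) \<partial>lborel)" for n
  proof -
    let ?I = "\<lambda>t. indicator {- real n..real n} t :: real"
    define \<eta> where "\<eta> t = of_real (?I t * norm (?F t) powr (p - 2)) * ?F t" for t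
    have m [measurable]: "\<eta> \<in> borel_measurable borel" unfolding \<eta>_def[abs_def] by measurable
    have n\<eta>: "norm (\<eta> t) = ?I t * norm (?F t) powr (p - 1)" for t
    proof (cases "?F t = 0")
      case False
      then have "norm (?F t) powr (p - 2) * norm (?F t) = norm (?F t) powr (p - 2) * norm (?F t) powr 1" by simp
      also have "\<dots> = norm (?F t) powr (p - 1)" unfolding powr_add[symmetric] by simp
      finally show ?thesis by (simp add: \<eta>_def norm_mult abs_mult mult.assoc)
    qed (simp add: \<eta>_def)
    have bc: "integrable lborel (\<lambda>t. ?I t * norm (?F t) powr r)" if "r > 0" for r
    proof -
      have "continuous_on {- real n..real n} (\<lambda>t. norm (?F t) powr r)"
        by (intro continuous_intros continuous_on_powr' continuous_on_cauchy_line[OF g e]) (use that in auto)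
      from borel_integrable_compact[OF compact_Icc this] show ?thesis unfolding real_scaleR_def .
    qed
    have i\<eta>: "integrable lborel \<eta>"
      by (rule Bochner_Integration.integrable_bound[OF bc[of "p - 1"]]) (use p n\<eta> in auto)
    define X where "X = (\<integral>t. ?I t * norm (?F t) powr p \<partial>lborel)"
    have X0: "X \<ge> 0" unfolding X_def by (intro Bochner_Integration.integral_nonneg) auto
    have XN: "(\<integral>\<^sup>+t. ennreal (?I t * norm (?F t) powr p) \<partial>lborel) = ennreal X"
      unfolding X_def using p by (intro nn_integral_eq_integral bc) auto
    have N\<eta>: "(\<integral>\<^sup>+t. ennreal (norm (\<eta> t) powr p') \<partial>lborel) = ennreal X"
      unfolding n\<eta> XN[symmetric] using p by (intro nn_integral_cong) (auto simp: indicator_def powr_powr p1)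
    have "complex_of_real X = (\<integral>t. of_real (?I t * norm (?F t) powr p) \<partial>lborel)"
      unfolding X_def by (rule integral_complex_of_real[symmetric])
    also have "\<dots> = (\<integral>t. ?F t * cnj (\<eta> t) \<partial>lborel)"
    proof (rule Bochner_Integration.integral_cong[OF refl])
      fix t
      show "of_real (?I t * norm (?F t) powr p) = ?F t * cnj (\<eta> t)"
      proof (cases "?F t = 0")
        case False
        then have "norm (?F t) powr (p - 2) * (norm (?F t))\<^sup>2 = norm (?F t) powr (p - 2) * norm (?F t) powr 2" by simp
        also have "\<dots> = norm (?F t) powr p" unfolding powr_add[symmetric] by simp
        finally have "of_real (?I t * norm (?F t) powr p) = of_real (?I t * norm (?F t) powr (p - 2)) * of_real ((norm (?F t))\<^sup>2)"
          unfolding of_real_mult[symmetric] mult.assoc by simp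
        also have "\<dots> = of_real (?I t * norm (?F t) powr (p - 2)) * (?F t * cnj (?F t))"
          unfolding complex_norm_square ..
        finally show ?thesis by (simp add: \<eta>_def mult_ac)
      qed (use p in \<open>simp add: \<eta>_def\<close>)
    qed
    also have "\<dots> = (\<integral>t. (\<integral>s. 1 / (?l t - \<i> * of_real s) * \<gamma> s \<partial>lborel) * cnj (\<eta> t) \<partial>lborel)"
      unfolding cauchy_def by simp
    also have "\<dots> = (\<integral>s. \<gamma> s * (\<integral>t. 1 / (?l t - \<i> * of_real s) * cnj (\<eta> t) \<partial>lborel) \<partial>lborel)"
    proof (rule Fubini_bounded_kernel[where B = "1 / e"])
      show "norm (1 / (?l y - \<i> * of_real x)) \<le> 1 / e" for x y
      proof -
        have "Re (?l y) > 0" using e by simp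
        from half_plane_kernel[OF this, of x] e have "e \<le> norm (?l y - \<i> * of_real x)" by simp
        then show ?thesis using e by (simp add: norm_divide frac_le)
      qed
      show "integrable lborel (\<lambda>t. cnj (\<eta> t))" using i\<eta> by (rule integrable_cnj)
      show "(\<lambda>(x, y). 1 / (?l y - \<i> * of_real x)) \<in> borel_measurable (borel \<Otimes>\<^sub>M borel)" by measurable
    qed (rule g)
    also have "\<dots> = (\<integral>s. \<gamma> s * cnj (cauchy \<eta> (?l s)) \<partial>lborel)"
    proof (rule Bochner_Integration.integral_cong[OF refl])
      fix s
      have "(\<integral>t. 1 / (?l t - \<i> * of_real s) * cnj (\<eta> t) \<partial>lborel) = (\<integral>t. cnj (\<eta> t / (?l s - \<i> * of_real t)) \<partial>lborel)"
        by (intro Bochner_Integration.integral_cong[OF refl]) (simp add: algebra_simps)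
      also have "\<dots> = cnj (cauchy \<eta> (?l s))" unfolding cauchy_def by (rule integral_bounded_linear'[OF bounded_linear_cnj bounded_linear_cnj]) simp
      finally show "\<gamma> s * (\<integral>t. 1 / (?l t - \<i> * of_real s) * cnj (\<eta> t) \<partial>lborel) = \<gamma> s * cnj (cauchy \<eta> (?l s))" by simp
    qed
    finally have X1: "complex_of_real X = (\<integral>s. \<gamma> s * cnj (cauchy \<eta> (?l s)) \<partial>lborel)" .
    have "ennreal X = ennreal (norm (complex_of_real X))" using X0 by simp
    also have "\<dots> \<le> (\<integral>\<^sup>+s. ennreal (norm (cauchy \<eta> (?l s)) * norm (\<gamma> s)) \<partial>lborel)"
      unfolding X1 using integral_norm_bound_ennreal
      by (cases "integrable lborel (\<lambda>s. \<gamma> s * cnj (cauchy \<eta> (?l s)))")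
        (auto simp: norm_mult mult.commute not_integrable_integral_eq dest!: integral_norm_bound_ennreal)
    finally have XH: "ennreal X \<le> (\<integral>\<^sup>+s. ennreal (norm (cauchy \<eta> (?l s)) * norm (\<gamma> s)) \<partial>lborel)" .
    have \<eta>C: "(\<integral>\<^sup>+s. ennreal (norm (cauchy \<eta> (?l s)) powr p') \<partial>lborel) \<le> ennreal (C * X)"
      using dual[OF e i\<eta>] unfolding N\<eta> using C X0 by (simp add: ennreal_mult)
    have m\<eta>: "(\<lambda>s. norm (cauchy \<eta> (?l s))) \<in> borel_measurable lborel"
      using measurable_cauchy_line[OF i\<eta> e] by measurable
    show ?thesis
    proof (cases "C = 0")
      case True
      then have "(\<integral>\<^sup>+s. ennreal (norm (cauchy \<eta> (?l s)) powr p') \<partial>lborel) = 0" using \<eta>C by simp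
      then have "AE s in lborel. ennreal (norm (cauchy \<eta> (?l s)) powr p') = 0"
        using m\<eta> by (subst (asm) nn_integral_0_iff_AE) auto
      then have "AE s in lborel. ennreal (norm (cauchy \<eta> (?l s)) * norm (\<gamma> s)) = 0"
        by eventually_elim (auto simp: ennreal_eq_0_iff)
      then have "(\<integral>\<^sup>+s. ennreal (norm (cauchy \<eta> (?l s)) * norm (\<gamma> s)) \<partial>lborel) = 0"
        using m\<eta> by (subst nn_integral_0_iff_AE) auto
      then show ?thesis using XH XN by simp
    next
      case C0: False
      then obtain j where j: "j \<ge> 0" "(\<integral>\<^sup>+s. ennreal (norm (\<gamma> s) powr p) \<partial>lborel) = ennreal j"
        using False by (cases "\<integral>\<^sup>+s. ennreal (norm (\<gamma> s) powr p) \<partial>lborel") auto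
      have "(\<integral>\<^sup>+s. ennreal (norm (cauchy \<eta> (?l s)) * norm (\<gamma> s)) \<partial>lborel) \<le> ennreal ((C * X) powr (1 / p') * j powr (1 / p))"
        by (rule nn_Hoelder[OF p(2,1,3)]) (use p C X0 \<eta>C j m\<eta> in \<open>auto simp: powr_powr\<close>)
      then have "X \<le> (C * X) powr (1 / p') * j powr (1 / p)"
        using XH order_trans by (subst ennreal_le_iff[symmetric]) fastforce+
      also have "(C * X) powr (1 / p') = C powr (1 / p') * X powr (1 / p')" using C X0 by (simp add: powr_mult)
      finally have X2: "X \<le> C powr (1 / p') * X powr (1 / p') * j powr (1 / p)" .
      have "X \<le> C powr (p / p') * j"
      proof (cases "X = 0")
        case False
        then have X: "X > 0" using X0 by simp
        have "X powr (1 / p') * X powr (1 / p) = X" using X p(3) by (simp flip: powr_add)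
        with X2 have "X powr (1 / p') * X powr (1 / p) \<le> X powr (1 / p') * (C powr (1 / p') * j powr (1 / p))"
          by (simp add: mult_ac)
        then have "X powr (1 / p) \<le> C powr (1 / p') * j powr (1 / p)" using X by simp
        then have "(X powr (1 / p)) powr p \<le> (C powr (1 / p') * j powr (1 / p)) powr p"
          using p by (intro powr_mono2) auto
        then show ?thesis using X j p C by (simp add: powr_mult powr_powr)
      qed (use j in simp)
      then show ?thesis unfolding XN j(2) using j by (simp add: ennreal_leI flip: ennreal_mult)
    qed
  qed
  show ?thesis
  proof (rule nn_integral_tendsto_le[OF _ _ le tendsto_const])
    show "AE t in lborel. (\<lambda>n. ennreal (indicator {- real n..real n} t * norm (?F t) powr p)) \<longlonglongrightarrow> ennreal (norm (?F t) powr p)"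
    proof (rule AE_I2)
      fix t
      have "(\<lambda>n. indicator {- real n..real n} t * norm (?F t) powr p) \<longlonglongrightarrow> 1 * norm (?F t) powr p"
        by (intro tendsto_intros indicator_Icc_tendsto)
      then show "(\<lambda>n. ennreal (indicator {- real n..real n} t * norm (?F t) powr p)) \<longlonglongrightarrow> ennreal (norm (?F t) powr p)"
        by (intro tendsto_ennrealI) simp
    qed
  qed measurable
qed

lemma cauchy_Lp:
  fixes p :: real assumes p: "1 < p"
  obtains C where "C \<ge> 0" "\<And>e \<gamma>. e > 0 \<Longrightarrow> integrable lborel \<gamma> \<Longrightarrow>
    (\<integral>\<^sup>+t. ennreal (norm (cauchy \<gamma> (of_real e + \<i> * of_real t)) powr p) \<partial>lborel) \<le> ennreal C * (\<integral>\<^sup>+s. ennreal (norm (\<gamma> s) powr p) \<partial>lborel)"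
proof (cases "p \<le> 2")
  case True
  show ?thesis by (rule cauchy_Lp_le2[OF p True]) (rule that)
next
  case False
  define p' where "p' = p / (p - 1)"
  have p': "p' > 1" "p' \<le> 2" "1 / p' + 1 / p = 1"
    using False by (simp_all add: p'_def divide_le_eq diff_divide_distrib)
  obtain C where C: "C \<ge> 0" "\<And>e \<gamma>. e > 0 \<Longrightarrow> integrable lborel \<gamma> \<Longrightarrow>
    (\<integral>\<^sup>+t. ennreal (norm (cauchy \<gamma> (of_real e + \<i> * of_real t)) powr p') \<partial>lborel) \<le> ennreal C * (\<integral>\<^sup>+s. ennreal (norm (\<gamma> s) powr p') \<partial>lborel)"
    by (rule cauchy_Lp_le2[OF p'(1,2)]) blast
  show ?thesis
    by (rule that[of "C powr (p / p')"]) (auto intro!: cauchy_Lp_dual[OF p p'(1,3) C])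
qed

section \<open>The weighted estimate\<close>

text \<open>
  For \<open>y \<le> x\<close> this is \<open>1 - (y/x)^b \<le> 1 - y/x\<close>, multiplied by \<open>x^b\<close>.
\<close>

lemma powr_diff_le:
  fixes x y b :: real
  assumes "x > 0" "y > 0" "0 \<le> b" "b \<le> 1"
  shows "\<bar>x powr b - y powr b\<bar> \<le> \<bar>x - y\<bar> * max x y powr (b - 1)"
proof -
  have *: "\<bar>u powr b - v powr b\<bar> \<le> \<bar>u - v\<bar> * u powr (b - 1)" if "0 < v" "v \<le> u" for u v :: real
  proof -
    have u: "u > 0" using that by simp
    have "v / u = (v / u) powr 1" using that u by simp
    also have "\<dots> \<le> (v / u) powr b" using that u assms by (intro powr_mono') auto
    also have "\<dots> = v powr b / u powr b" using that u by (simp add: powr_divide)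
    finally have "u powr b * (v / u) \<le> u powr b * (v powr b / u powr b)" by (intro mult_left_mono) auto
    then have "u powr b * (v / u) \<le> v powr b" using u by simp
    moreover have "u powr (b - 1) * (u - v) = u powr b - u powr b * (v / u)"
      using u by (simp add: powr_diff field_simps)
    moreover have "v powr b \<le> u powr b" using that assms by (intro powr_mono2) auto
    ultimately show ?thesis using that by (simp add: mult.commute)
  qed
  show ?thesis
  proof (cases "y \<le> x")
    case True then show ?thesis using *[of y x] assms by (simp add: max_def)
  next
    case False then show ?thesis using *[of x y] assms by (simp add: max_def abs_minus_commute)
  qed
qed

text \<open>
  The difference of the weights vanishes on the diagonal and cancels the singularity of the Cauchy kernel.
\<close>

lemma commutator_kernel_le:
  fixes b e t s :: real
  assumes b: "0 \<le> b" "b \<le> 1" and e: "e > 0"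
  shows "norm (of_real ((1 + \<bar>t\<bar>) powr b - (1 + \<bar>s\<bar>) powr b) / (of_real e + \<i> * of_real t - \<i> * of_real s))
    \<le> max (1 + \<bar>t\<bar>) (1 + \<bar>s\<bar>) powr (b - 1)"
proof (cases "t = s")
  case False
  let ?w = "of_real e + \<i> * of_real t - \<i> * of_real s"
  have "\<bar>t - s\<bar> \<le> norm ?w" using abs_Im_le_cmod[of ?w] by simp
  then have w: "\<bar>t - s\<bar> / norm ?w \<le> 1" using False by (simp add: divide_le_eq_1)
  have "\<bar>(1 + \<bar>t\<bar>) powr b - (1 + \<bar>s\<bar>) powr b\<bar> \<le> \<bar>(1 + \<bar>t\<bar>) - (1 + \<bar>s\<bar>)\<bar> * max (1 + \<bar>t\<bar>) (1 + \<bar>s\<bar>) powr (b - 1)"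
    using b by (intro powr_diff_le) auto
  also have "\<dots> \<le> \<bar>t - s\<bar> * max (1 + \<bar>t\<bar>) (1 + \<bar>s\<bar>) powr (b - 1)"
    by (intro mult_right_mono) auto
  finally have "norm (of_real ((1 + \<bar>t\<bar>) powr b - (1 + \<bar>s\<bar>) powr b) / ?w) \<le> \<bar>t - s\<bar> * max (1 + \<bar>t\<bar>) (1 + \<bar>s\<bar>) powr (b - 1) / norm ?w"
    unfolding norm_divide norm_of_real by (rule divide_right_mono) simp
  also have "\<dots> = (\<bar>t - s\<bar> / norm ?w) * max (1 + \<bar>t\<bar>) (1 + \<bar>s\<bar>) powr (b - 1)" by simp
  also have "\<dots> \<le> 1 * max (1 + \<bar>t\<bar>) (1 + \<bar>s\<bar>) powr (b - 1)" by (intro mult_right_mono w) simp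
  finally show ?thesis by simp
qed simp

text \<open>
  Schur's test with the function \<open>(1 + |\<tau>|)^(-\<theta>)\<close>. The two conditions are
  \<open>0 < \<theta> p < 1 - b\<close> and \<open>b < \<theta> q < 1\<close>; they are compatible if and only if \<open>b < 1 - 1/q\<close>.
\<close>

lemma commutator_Lp:
  fixes b q :: real
  assumes q: "1 < q" and b: "0 \<le> b" "b < 1 - 1 / q"
  obtains C where "C \<ge> 0" "\<And>E f. f \<in> borel_measurable borel \<Longrightarrow> (\<And>s. f s \<ge> 0) \<Longrightarrow> (\<And>t. E t \<ge> 0) \<Longrightarrow>
     (\<And>t. ennreal (E t) \<le> (\<integral>\<^sup>+s. ennreal ((1 + \<bar>s\<bar>) powr (- b) * max (1 + \<bar>t\<bar>) (1 + \<bar>s\<bar>) powr (b - 1) * f s) \<partial>lborel)) \<Longrightarrow>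
     (\<integral>\<^sup>+t. ennreal (E t powr q) \<partial>lborel) \<le> ennreal C * (\<integral>\<^sup>+s. ennreal (f s powr q) \<partial>lborel)"
proof -
  define p where "p = q / (q - 1)"
  have pq: "p > 1" "1 / p + 1 / q = 1" "1 / p = 1 - 1 / q"
    using q by (simp_all add: p_def diff_divide_distrib)
  let ?m = "\<lambda>x::real. 1 + \<bar>x\<bar>"
  have b1: "b < 1" using b q by (simp add: less_le_trans[of b "1 - 1 / q" 1])
  have "b / q < 1 / q" using b1 q by (simp add: divide_strict_right_mono)
  moreover have "b / q < (1 - b) / p"
  proof -
    have "(1 - b) / p = (1 - 1 / q) - b + b / q"
      using pq(3) by (metis (no_types, opaque_lifting) add_diff_eq diff_add_eq divide_inverse inverse_eq_divide left_diff_distrib mult.commute mult_1 right_diff_distrib diff_diff_eq2 mult_1_right)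
    then show ?thesis using b by simp
  qed
  ultimately have mid: "b / q < min (1 / q) ((1 - b) / p)" by simp
  \<comment> \<open>Any exponent strictly between the two bounds will do.\<close>
  obtain \<theta> where "b / q < \<theta>" "\<theta> < min (1 / q) ((1 - b) / p)" using dense[OF mid] by blast
  moreover have "0 \<le> b / q" using b q by simp
  ultimately have \<theta>: "b / q < \<theta>" "\<theta> < 1 / q" "\<theta> < (1 - b) / p" "\<theta> > 0" by simp_all
  have r: "b < \<theta> * q" "\<theta> * q < 1" "\<theta> * p < 1 - b" "\<theta> * p > 0"
    using \<theta> q pq(1) by (auto simp: field_simps)
  define A where "A = 2 / (1 - (b + \<theta> * p)) + 2 / (b + \<theta> * p - b)"
  define B where "B = 2 / (1 - \<theta> * q) + 2 / (\<theta> * q - b)"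
  have AB: "A > 0" "B > 0" using r by (auto simp: A_def B_def intro!: add_pos_pos)
  let ?k = "\<lambda>t s. ?m s powr (- b) * max (?m t) (?m s) powr (b - 1)"
  have hA: "(\<integral>\<^sup>+y. ennreal (?k x y * (?m y powr (- \<theta>)) powr p) \<partial>lborel) \<le> ennreal (A * (?m x powr (- \<theta>)) powr p)" for x
  proof -
    have "?m y powr (- b) * ?m y powr (- (\<theta> * p)) = ?m y powr (- (b + \<theta> * p))" for y :: real
      unfolding powr_add[symmetric] by simp
    then have "?k x y * (?m y powr (- \<theta>)) powr p = max (?m x) (?m y) powr (b - 1) * ?m y powr (- (b + \<theta> * p))" for y
      by (simp add: powr_powr mult_ac)
    moreover have "(?m x powr (- \<theta>)) powr p = ?m x powr (b - (b + \<theta> * p))" by (simp add: powr_powr)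
    ultimately show ?thesis
      using nn_integral_weight_max[of b "b + \<theta> * p" x] r by (simp only: A_def) 
  qed
  have hB: "(\<integral>\<^sup>+x. ennreal (?k x y * (?m x powr (- \<theta>)) powr q) \<partial>lborel) \<le> ennreal (B * (?m y powr (- \<theta>)) powr q)" for y
  proof -
    have "(\<integral>\<^sup>+x. ennreal (?k x y * (?m x powr (- \<theta>)) powr q) \<partial>lborel) = (\<integral>\<^sup>+x. ennreal (?m y powr (- b)) * ennreal (max (?m y) (?m x) powr (b - 1) * ?m x powr (- (\<theta> * q))) \<partial>lborel)"
      by (intro nn_integral_cong) (simp add: powr_powr max.commute mult_ac flip: ennreal_mult)
    also have "\<dots> = ennreal (?m y powr (- b)) * (\<integral>\<^sup>+x. ennreal (max (?m y) (?m x) powr (b - 1) * ?m x powr (- (\<theta> * q))) \<partial>lborel)"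
      by (intro nn_integral_cmult) measurable
    also have "\<dots> \<le> ennreal (?m y powr (- b)) * ennreal (B * ?m y powr (b - \<theta> * q))"
      using nn_integral_weight_max[OF r(1,2), of y] by (intro mult_left_mono) (simp_all add: B_def)
    also have "\<dots> = ennreal (B * (?m y powr (- b) * ?m y powr (b - \<theta> * q)))"
      using AB by (simp add: mult_ac flip: ennreal_mult)
    also have "?m y powr (- b) * ?m y powr (b - \<theta> * q) = (?m y powr (- \<theta>)) powr q"
      unfolding powr_add[symmetric] by (simp add: powr_powr)
    finally show ?thesis .
  qed
  show thesis
  proof (rule that)
    show "A powr (q / p) * B \<ge> 0" using AB by simp
    fix E f :: "real \<Rightarrow> real"
    assume f: "f \<in> borel_measurable borel" "\<And>s. f s \<ge> 0" and E: "\<And>t. E t \<ge> 0"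
      "\<And>t. ennreal (E t) \<le> (\<integral>\<^sup>+s. ennreal (?k t s * f s) \<partial>lborel)"
    show "(\<integral>\<^sup>+t. ennreal (E t powr q) \<partial>lborel) \<le> ennreal (A powr (q / p) * B) * (\<integral>\<^sup>+s. ennreal (f s powr q) \<partial>lborel)"
    proof (rule Schur_test[OF pq(1) q pq(2) _ _ f(1) _ _ f(2) E(1) AB(1) less_imp_le[OF AB(2)] hA hB E(2)])
      show "(\<lambda>(t, s). ?k t s) \<in> borel_measurable (borel \<Otimes>\<^sub>M borel)" by measurable
      show "(\<lambda>x. ?m x powr (- \<theta>)) \<in> borel_measurable borel" by measurable
    qed auto
  qed
qed

text \<open>
  The weight times the transform of \<open>\<gamma>\<close> is the transform of the weight times \<open>\<gamma>\<close> plus the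
  commutator term \<open>Err\<close>.
\<close>

lemma cauchy_weighted_Lp:
  fixes b q :: real
  assumes q: "1 < q" and b: "0 \<le> b" "b < 1 - 1 / q"
  obtains C where "C \<ge> 0" "\<And>e \<gamma>. e > 0 \<Longrightarrow> integrable lborel \<gamma> \<Longrightarrow> integrable lborel (\<lambda>s. of_real ((1 + \<bar>s\<bar>) powr b) * \<gamma> s) \<Longrightarrow>
    (\<integral>\<^sup>+t. ennreal (((1 + \<bar>t\<bar>) powr b * norm (cauchy \<gamma> (of_real e + \<i> * of_real t))) powr q) \<partial>lborel)
      \<le> ennreal C * (\<integral>\<^sup>+s. ennreal (((1 + \<bar>s\<bar>) powr b * norm (\<gamma> s)) powr q) \<partial>lborel)"
proof -
  obtain C1 where C1: "C1 \<ge> 0" "\<And>e \<gamma>. e > 0 \<Longrightarrow> integrable lborel \<gamma> \<Longrightarrow>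
    (\<integral>\<^sup>+t. ennreal (norm (cauchy \<gamma> (of_real e + \<i> * of_real t)) powr q) \<partial>lborel) \<le> ennreal C1 * (\<integral>\<^sup>+s. ennreal (norm (\<gamma> s) powr q) \<partial>lborel)"
    by (rule cauchy_Lp[OF q]) blast
  obtain C2 where C2: "C2 \<ge> 0" "\<And>E f. f \<in> borel_measurable borel \<Longrightarrow> (\<And>s. f s \<ge> 0) \<Longrightarrow> (\<And>t. E t \<ge> 0) \<Longrightarrow>
     (\<And>t. ennreal (E t) \<le> (\<integral>\<^sup>+s. ennreal ((1 + \<bar>s\<bar>) powr (- b) * max (1 + \<bar>t\<bar>) (1 + \<bar>s\<bar>) powr (b - 1) * f s) \<partial>lborel)) \<Longrightarrow>
     (\<integral>\<^sup>+t. ennreal (E t powr q) \<partial>lborel) \<le> ennreal C2 * (\<integral>\<^sup>+s. ennreal (f s powr q) \<partial>lborel)"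
    by (rule commutator_Lp[OF q b]) blast
  let ?m = "\<lambda>x::real. 1 + \<bar>x\<bar>"
  have b1: "b \<le> 1" using b q by (simp add: order_trans[OF less_imp_le[OF b(2)]])
  show thesis
  proof (rule that)
    show "2 powr q * (C1 + C2) \<ge> 0" using C1 C2 by simp
    fix e :: real and \<gamma> :: "real \<Rightarrow> complex"
    assume e: "e > 0" and g: "integrable lborel \<gamma>" and G: "integrable lborel (\<lambda>s. of_real (?m s powr b) * \<gamma> s)"
    let ?G = "\<lambda>s. of_real (?m s powr b) * \<gamma> s"
    let ?l = "\<lambda>t::real. of_real e + \<i> * of_real t"
    note [measurable] = borel_measurable_integrable[OF g]
    have w: "Re (?l t) > 0" for t using e by simp
    define Err where "Err t = of_real (?m t powr b) * cauchy \<gamma> (?l t) - cauchy ?G (?l t)" for t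
    have Err: "Err t = (\<integral>s. of_real (?m t powr b - ?m s powr b) / (?l t - \<i> * of_real s) * \<gamma> s \<partial>lborel)" for t
    proof -
      have "Err t = (\<integral>s. of_real (?m t powr b) * (\<gamma> s / (?l t - \<i> * of_real s)) - ?G s / (?l t - \<i> * of_real s) \<partial>lborel)"
        unfolding Err_def cauchy_def
        by (simp only: Bochner_Integration.integral_diff integrable_mult_right integrable_cauchy[OF g w] integrable_cauchy[OF G w] integral_mult_right_zero)
      also have "\<dots> = (\<integral>s. of_real (?m t powr b - ?m s powr b) / (?l t - \<i> * of_real s) * \<gamma> s \<partial>lborel)"
        by (intro Bochner_Integration.integral_cong[OF refl]) (simp add: left_diff_distrib diff_divide_distrib)
      finally show ?thesis .
    qed
    have Errk: "ennreal (norm (Err t)) \<le> (\<integral>\<^sup>+s. ennreal (?m s powr (- b) * max (?m t) (?m s) powr (b - 1) * norm (?G s)) \<partial>lborel)" for t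
    proof -
      let ?h = "\<lambda>s. of_real (?m t powr b - ?m s powr b) / (?l t - \<i> * of_real s) * \<gamma> s"
      have "ennreal (norm (Err t)) \<le> (\<integral>\<^sup>+s. ennreal (norm (?h s)) \<partial>lborel)"
        unfolding Err by (cases "integrable lborel ?h") (auto simp: not_integrable_integral_eq intro: integral_norm_bound_ennreal)
      also have "\<dots> \<le> (\<integral>\<^sup>+s. ennreal (?m s powr (- b) * max (?m t) (?m s) powr (b - 1) * norm (?G s)) \<partial>lborel)"
      proof (intro nn_integral_mono ennreal_leI)
        fix s
        have "norm (?h s) \<le> max (?m t) (?m s) powr (b - 1) * norm (\<gamma> s)"
          unfolding norm_mult[of _ "\<gamma> s"] by (intro mult_right_mono commutator_kernel_le b b1 e) simp
        also have "norm (\<gamma> s) = ?m s powr (- b) * norm (?G s)"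
          unfolding norm_mult norm_of_real by (simp add: powr_minus)
        finally show "norm (?h s) \<le> ?m s powr (- b) * max (?m t) (?m s) powr (b - 1) * norm (?G s)"
          by (simp only: mult_ac)
      qed
      finally show ?thesis .
    qed
    have nG: "norm (?G s) = ?m s powr b * norm (\<gamma> s)" for s by (simp add: norm_mult)
    let ?J = "\<integral>\<^sup>+s. ennreal ((?m s powr b * norm (\<gamma> s)) powr q) \<partial>lborel"
    have e1: "(\<integral>\<^sup>+t. ennreal (norm (cauchy ?G (?l t)) powr q) \<partial>lborel) \<le> ennreal C1 * ?J"
      using C1(2)[OF e G] unfolding nG .
    have e2: "(\<integral>\<^sup>+t. ennreal (norm (Err t) powr q) \<partial>lborel) \<le> ennreal C2 * ?J"
      using C2(2)[of "\<lambda>s. norm (?G s)" "\<lambda>t. norm (Err t)"] Errk unfolding nG by simp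
    have [measurable]: "(\<lambda>t. cauchy \<gamma> (?l t)) \<in> borel_measurable borel" "(\<lambda>t. cauchy ?G (?l t)) \<in> borel_measurable borel"
      by (intro measurable_cauchy_line g G e)+
    have [measurable]: "Err \<in> borel_measurable borel" unfolding Err_def[abs_def] by measurable
    have "(\<integral>\<^sup>+t. ennreal ((?m t powr b * norm (cauchy \<gamma> (?l t))) powr q) \<partial>lborel)
      \<le> (\<integral>\<^sup>+t. ennreal (2 powr q) * (ennreal (norm (cauchy ?G (?l t)) powr q) + ennreal (norm (Err t) powr q)) \<partial>lborel)"
    proof (rule nn_integral_mono)
      fix t
      have "?m t powr b * norm (cauchy \<gamma> (?l t)) = norm (of_real (?m t powr b) * cauchy \<gamma> (?l t))"
        unfolding norm_mult norm_of_real by simp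
      also have "of_real (?m t powr b) * cauchy \<gamma> (?l t) = cauchy ?G (?l t) + Err t" by (simp add: Err_def)
      finally have "?m t powr b * norm (cauchy \<gamma> (?l t)) \<le> norm (cauchy ?G (?l t)) + norm (Err t)"
        by (simp only: norm_triangle_ineq)
      then have "(?m t powr b * norm (cauchy \<gamma> (?l t))) powr q \<le> (norm (cauchy ?G (?l t)) + norm (Err t)) powr q"
        using q by (intro powr_mono2) auto
      also have "\<dots> \<le> 2 powr q * (norm (cauchy ?G (?l t)) powr q + norm (Err t) powr q)"
        using q by (intro powr_add_le) auto
      finally show "ennreal ((?m t powr b * norm (cauchy \<gamma> (?l t))) powr q) \<le> ennreal (2 powr q) * (ennreal (norm (cauchy ?G (?l t)) powr q) + ennreal (norm (Err t) powr q))"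
        by (simp add: ennreal_leI flip: ennreal_plus ennreal_mult)
    qed
    also have "\<dots> = ennreal (2 powr q) * ((\<integral>\<^sup>+t. ennreal (norm (cauchy ?G (?l t)) powr q) \<partial>lborel) + (\<integral>\<^sup>+t. ennreal (norm (Err t) powr q) \<partial>lborel))"
      by (subst nn_integral_cmult, measurable) (subst nn_integral_add, auto)
    also have "\<dots> \<le> ennreal (2 powr q) * (ennreal C1 * ?J + ennreal C2 * ?J)"
      by (intro mult_left_mono add_mono e1 e2) auto
    also have "\<dots> = ennreal (2 powr q * (C1 + C2)) * ?J"
      using C1(1) C2(1) by (simp add: ennreal_mult ennreal_plus distrib_right mult.assoc)
    finally show "(\<integral>\<^sup>+t. ennreal ((?m t powr b * norm (cauchy \<gamma> (?l t))) powr q) \<partial>lborel) \<le> ennreal (2 powr q * (C1 + C2)) * ?J" .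
  qed
qed

section \<open>Cutting off Schwartz functions\<close>

text \<open>
  The multiplication formula moves the inverse transform from \<open>\<gamma>\<close> to a truncated exponential, whose
  transform is the Cauchy kernel.
\<close>

lemma fourier_indicator_exp_ifourier:
  assumes g: "\<gamma> \<in> schwartz" and e: "e > 0"
  shows "fourier (\<lambda>x. indicator {0<..} x * (of_real (exp (- e * x)) * ifourier \<gamma> x)) \<tau>
    = cauchy \<gamma> (of_real e + \<i> * of_real \<tau>) / (2 * pi)"
proof -
  let ?v = "\<lambda>x. indicator {0<..} x *\<^sub>R exp (- (of_real e + \<i> * of_real \<tau>) * of_real x)"
  have v: "integrable lborel ?v" by (rule integral_exp_halfline(1)) (use e in simp)
  have "fourier (\<lambda>x. indicator {0<..} x * (of_real (exp (- e * x)) * ifourier \<gamma> x)) \<tau> = (\<integral>x. ifourier \<gamma> x * ?v x \<partial>lborel)"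
    unfolding fourier_def
  proof (rule Bochner_Integration.integral_cong[OF refl])
    fix x
    have "exp (- (of_real e + \<i> * of_real \<tau>) * of_real x) = of_real (exp (- e * x)) * cis (- (\<tau> * x))"
      by (simp add: cis_conv_exp exp_of_real[symmetric] exp_add[symmetric] algebra_simps)
    then show "cis (- (\<tau> * x)) * (indicator {0<..} x * (of_real (exp (- e * x)) * ifourier \<gamma> x)) = ifourier \<gamma> x * ?v x"
      by (simp add: indicator_def mult_ac)
  qed
  also have "\<dots> = (\<integral>s. \<gamma> s * ifourier ?v s \<partial>lborel)" by (rule ifourier_swap[OF schwartz_integrable[OF g] v])
  also have "\<dots> = (\<integral>s. \<gamma> s / (of_real e + \<i> * of_real \<tau> - \<i> * of_real s) / (2 * pi) \<partial>lborel)"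
  proof (rule Bochner_Integration.integral_cong[OF refl])
    fix s
    let ?w = "of_real e + \<i> * of_real \<tau> - \<i> * of_real s"
    have "fourier ?v (- s) = (\<integral>x. indicator {0<..} x *\<^sub>R exp (- ?w * of_real x) \<partial>lborel)"
      unfolding fourier_def
      by (intro Bochner_Integration.integral_cong[OF refl])
        (simp add: indicator_def cis_conv_exp exp_add[symmetric] algebra_simps)
    also have "\<dots> = 1 / ?w" by (rule integral_exp_halfline(2)) (use e in simp)
    finally show "\<gamma> s * ifourier ?v s = \<gamma> s / ?w / (2 * pi)" by (simp add: ifourier_def)
  qed
  also have "\<dots> = cauchy \<gamma> (of_real e + \<i> * of_real \<tau>) / (2 * pi)"
    unfolding cauchy_def by (rule integral_divide_zero)
  finally show ?thesis .
qed

lemma fourier_cut_tendsto: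
  assumes g: "\<gamma> \<in> schwartz"
  shows "(\<lambda>n. cauchy \<gamma> (of_real (1 / real (Suc n)) + \<i> * of_real \<tau>) / (2 * pi)) \<longlonglongrightarrow> fourier (cut {0<..} (ifourier \<gamma>)) \<tau>"
proof -
  let ?e = "\<lambda>n. 1 / real (Suc n)"
  let ?f = "ifourier \<gamma>"
  note f = schwartz_ifourier[OF g]
  note [measurable] = schwartz_measurable[OF f]
  have "(\<lambda>n. fourier (\<lambda>x. indicator {0<..} x * (of_real (exp (- ?e n * x)) * ?f x)) \<tau>) \<longlonglongrightarrow> fourier (cut {0<..} ?f) \<tau>"
    unfolding fourier_def cut_def
  proof (rule integral_dominated_convergence[where w = "\<lambda>x. norm (?f x)"])
    show "AE x in lborel. (\<lambda>n. cis (- (\<tau> * x)) * (indicator {0<..} x * (of_real (exp (- ?e n * x)) * ?f x))) \<longlonglongrightarrow> cis (- (\<tau> * x)) * (indicator {0<..} x * ?f x)"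
    proof (rule AE_I2)
      fix x :: real
      have e0: "?e \<longlonglongrightarrow> 0" by (rule LIMSEQ_inverse_real_of_nat[unfolded inverse_eq_divide])
      have "(\<lambda>n. cis (- (\<tau> * x)) * (indicator {0<..} x * (of_real (exp (- ?e n * x)) * ?f x))) \<longlonglongrightarrow> cis (- (\<tau> * x)) * (indicator {0<..} x * (of_real (exp (- 0 * x)) * ?f x))"
        by (intro tendsto_intros e0)
      then show "(\<lambda>n. cis (- (\<tau> * x)) * (indicator {0<..} x * (of_real (exp (- ?e n * x)) * ?f x))) \<longlonglongrightarrow> cis (- (\<tau> * x)) * (indicator {0<..} x * ?f x)" by simp
    qed
    show "AE x in lborel. norm (cis (- (\<tau> * x)) * (indicator {0<..} x * (of_real (exp (- ?e n * x)) * ?f x))) \<le> norm (?f x)" for n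
      by (intro AE_I2) (auto simp: norm_mult indicator_def intro!: mult_left_le_one_le)
  qed (use schwartz_integrable[OF f] in auto)
  moreover have pos: "0 < ?e n" for n by simp
  ultimately show ?thesis unfolding fourier_indicator_exp_ifourier[OF g pos] by -
qed

lemma integrable_cut:
  assumes "integrable lborel f" "I \<in> sets borel" shows "integrable lborel (cut I f)"
  unfolding cut_def using integrable_indicator_mult[OF assms] .

text \<open>
  Translation by \<open>a\<close> reduces the half-line \<open>(a,\<infinity>)\<close> to \<open>(0,\<infinity>)\<close> at the price of phases.
\<close>

lemma fourier_cut_shift:
  assumes g: "\<gamma> \<in> schwartz"
  shows "fourier (cut {a<..} (ifourier \<gamma>)) \<tau> = cis (- (\<tau> * a)) * fourier (cut {0<..} (ifourier (\<lambda>s. cis (a * s) * \<gamma> s))) \<tau>"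
proof -
  have shift: "ifourier (\<lambda>s. cis (a * s) * \<gamma> s) y = ifourier \<gamma> (a + 1 * y)" for y
  proof -
    have "fourier (\<lambda>s. cis (a * s) * \<gamma> s) (- y) = fourier \<gamma> (- (a + 1 * y))"
      unfolding fourier_def
    proof (rule Bochner_Integration.integral_cong[OF refl])
      fix s
      have "cis (- (- y * s)) * cis (a * s) = cis (- (- (a + 1 * y) * s))"
        unfolding cis_mult by (rule arg_cong[where f = cis]) (simp add: algebra_simps)
      then show "cis (- (- y * s)) * (cis (a * s) * \<gamma> s) = cis (- (- (a + 1 * y) * s)) * \<gamma> s"
        by (simp only: mult.assoc[symmetric])
    qed
    then show ?thesis by (simp only: ifourier_def)
  qed
  have "fourier (cut {a<..} (ifourier \<gamma>)) \<tau> = \<bar>1\<bar> *\<^sub>R (\<integral>y. cis (- (\<tau> * (a + 1 * y))) * (indicator {a<..} (a + 1 * y) * ifourier \<gamma> (a + 1 * y)) \<partial>lborel)"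
    unfolding fourier_def cut_def by (rule lborel_integral_real_affine) simp
  also have "\<dots> = (\<integral>y. cis (- (\<tau> * a)) * (cis (- (\<tau> * y)) * (indicator {0<..} y * ifourier (\<lambda>s. cis (a * s) * \<gamma> s) y)) \<partial>lborel)"
    unfolding shift abs_one scaleR_one
  proof (rule Bochner_Integration.integral_cong[OF refl])
    fix y
    have "cis (- (\<tau> * (a + 1 * y))) = cis (- (\<tau> * a)) * cis (- (\<tau> * y))"
      by (simp add: cis_mult distrib_left)
    moreover have "indicator {a<..} (a + 1 * y) = (indicator {0<..} y :: complex)" by (simp add: indicator_def)
    ultimately show "cis (- (\<tau> * (a + 1 * y))) * (indicator {a<..} (a + 1 * y) * ifourier \<gamma> (a + 1 * y))
      = cis (- (\<tau> * a)) * (cis (- (\<tau> * y)) * (indicator {0<..} y * ifourier \<gamma> (a + 1 * y)))"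
      by (simp only: mult.assoc)
  qed
  finally show ?thesis by (simp add: fourier_def cut_def)
qed

text \<open>
  The weight \<open>1 + |s|\<close> is comparable with the Japanese bracket and easier to integrate.
\<close>

lemma weight_comparison:
  assumes "q \<ge> 0" "b \<ge> 0"
  shows "wnorm b q g \<le> (\<integral>\<^sup>+s. ennreal (((1 + \<bar>s\<bar>) powr b * norm (g s)) powr q) \<partial>lborel)"
    and "(\<integral>\<^sup>+s. ennreal (((1 + \<bar>s\<bar>) powr b * norm (g s)) powr q) \<partial>lborel) \<le> wnorm b q (\<lambda>s. of_real (2 powr b) * g s)"
proof -
  show "wnorm b q g \<le> (\<integral>\<^sup>+s. ennreal (((1 + \<bar>s\<bar>) powr b * norm (g s)) powr q) \<partial>lborel)"
    unfolding wnorm_def using assms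
    by (intro nn_integral_mono ennreal_leI powr_mono2 mult_right_mono japanese_bracket_le)
      (auto intro: order_trans[OF zero_le_one japanese_bracket_ge_1])
  have "(1 + \<bar>s\<bar>) powr b * norm (g s) \<le> japanese_bracket s powr b * norm (of_real (2 powr b) * g s)" for s
  proof -
    have "(1 + \<bar>s\<bar>) powr b \<le> (2 * japanese_bracket s) powr b"
      using assms le_japanese_bracket[of s] by (intro powr_mono2) auto
    also have "\<dots> = japanese_bracket s powr b * 2 powr b"
      using japanese_bracket_ge_1[of s] by (simp add: powr_mult)
    finally have "(1 + \<bar>s\<bar>) powr b * norm (g s) \<le> (japanese_bracket s powr b * 2 powr b) * norm (g s)" by (rule mult_right_mono) simp
    then show ?thesis by (simp add: norm_mult)
  qed
  then show "(\<integral>\<^sup>+s. ennreal (((1 + \<bar>s\<bar>) powr b * norm (g s)) powr q) \<partial>lborel) \<le> wnorm b q (\<lambda>s. of_real (2 powr b) * g s)"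
    unfolding wnorm_def using assms by (intro nn_integral_mono ennreal_leI powr_mono2) auto
qed

lemma schwartz_weight_integrable:
  assumes g: "\<gamma> \<in> schwartz" and b: "b \<le> 1"
  shows "integrable lborel (\<lambda>s. of_real ((1 + \<bar>s\<bar>) powr b) * \<gamma> s)"
proof (rule Bochner_Integration.integrable_bound[OF integrable_norm[OF schwartz_integrable[OF schwartz_add[OF g schwartz_times_x[OF schwartz_times_x[OF g]]]], THEN integrable_mult_right[of 2]]])
  note [measurable] = schwartz_measurable[OF g]
  show "(\<lambda>s. of_real ((1 + \<bar>s\<bar>) powr b) * \<gamma> s) \<in> borel_measurable lborel" by measurable
  show "AE s in lborel. norm (of_real ((1 + \<bar>s\<bar>) powr b) * \<gamma> s) \<le> norm (2 * norm (\<gamma> s + of_real s * (of_real s * \<gamma> s)))"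
  proof (rule AE_I2)
    fix s :: real
    have "(1 + \<bar>s\<bar>) powr b \<le> (1 + \<bar>s\<bar>) powr 1" using b by (intro powr_mono) auto
    also have "\<dots> = 1 + \<bar>s\<bar>" by simp
    also have "\<dots> \<le> 2 * (1 + s\<^sup>2)"
    proof -
      have "2 * \<bar>s\<bar> \<le> s\<^sup>2 + 1" using sum_squares_bound[of "\<bar>s\<bar>" 1] by simp
      then show ?thesis using zero_le_power2[of s] by argo
    qed
    finally have "(1 + \<bar>s\<bar>) powr b * norm (\<gamma> s) \<le> 2 * (1 + s\<^sup>2) * norm (\<gamma> s)" by (rule mult_right_mono) simp
    have "\<gamma> s + of_real s * (of_real s * \<gamma> s) = of_real (1 + s\<^sup>2) * \<gamma> s"
      by (simp add: algebra_simps power2_eq_square)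
    then have N: "norm (\<gamma> s + of_real s * (of_real s * \<gamma> s)) = (1 + s\<^sup>2) * norm (\<gamma> s)"
      by (simp only: norm_mult norm_of_real abs_of_nonneg[OF add_nonneg_nonneg[OF zero_le_one zero_le_power2]])
    have R: "norm (2 * norm (\<gamma> s + of_real s * (of_real s * \<gamma> s))) = 2 * (1 + s\<^sup>2) * norm (\<gamma> s)"
      unfolding N by (simp add: abs_mult)
    have L: "norm (of_real ((1 + \<bar>s\<bar>) powr b) * \<gamma> s) = (1 + \<bar>s\<bar>) powr b * norm (\<gamma> s)"
      by (simp add: norm_mult)
    show "norm (of_real ((1 + \<bar>s\<bar>) powr b) * \<gamma> s) \<le> norm (2 * norm (\<gamma> s + of_real s * (of_real s * \<gamma> s)))"
      unfolding L R by fact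
  qed
qed

text \<open>
  Fatou's lemma as the line approaches the imaginary axis; the estimate on the lines is independent of
  their distance from it.
\<close>

lemma halfline_cut_bound:
  fixes b q :: real
  assumes q: "1 < q" and b: "0 \<le> b" "b < 1 - 1 / q"
  obtains C where "C \<ge> 0" "\<And>a \<gamma>. \<gamma> \<in> schwartz \<Longrightarrow> wnorm b q (fourier (cut {a<..} (ifourier \<gamma>))) \<le> ennreal C * wnorm b q \<gamma>"
proof -
  obtain C where C: "C \<ge> 0" "\<And>e \<gamma>. e > 0 \<Longrightarrow> integrable lborel \<gamma> \<Longrightarrow> integrable lborel (\<lambda>s. of_real ((1 + \<bar>s\<bar>) powr b) * \<gamma> s) \<Longrightarrow>
    (\<integral>\<^sup>+t. ennreal (((1 + \<bar>t\<bar>) powr b * norm (cauchy \<gamma> (of_real e + \<i> * of_real t))) powr q) \<partial>lborel)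
      \<le> ennreal C * (\<integral>\<^sup>+s. ennreal (((1 + \<bar>s\<bar>) powr b * norm (\<gamma> s)) powr q) \<partial>lborel)"
    by (rule cauchy_weighted_Lp[OF q b]) blast
  have b1: "b \<le> 1" using b q by (simp add: order_trans[OF less_imp_le[OF b(2)]])
  define D where "D = C * ((2 powr b) powr q)"
  have D: "D \<ge> 0" using C by (simp add: D_def)
  have origin: "wnorm b q (fourier (cut {0<..} (ifourier \<gamma>))) \<le> ennreal D * wnorm b q \<gamma>" if g: "\<gamma> \<in> schwartz" for \<gamma>
  proof (rule wnorm_tendsto_le[OF _ _ _ tendsto_const])
    let ?f = "\<lambda>n t. cauchy \<gamma> (of_real (1 / real (Suc n)) + \<i> * of_real t) / (2 * pi)"
    note gi = schwartz_integrable[OF g] and gw = schwartz_weight_integrable[OF g b1]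
    show m: "?f n \<in> borel_measurable borel" for n
      using measurable_cauchy_line[OF gi, of "1 / real (Suc n)"] by measurable
    show "AE \<tau> in lborel. (\<lambda>n. ?f n \<tau>) \<longlonglongrightarrow> fourier (cut {0<..} (ifourier \<gamma>)) \<tau>"
      by (intro AE_I2 fourier_cut_tendsto g)
    fix n
    have "wnorm b q (?f n) \<le> wnorm b q (\<lambda>t. cauchy \<gamma> (of_real (1 / real (Suc n)) + \<i> * of_real t))"
    proof (rule wnorm_mono)
      have "1 \<le> 2 * pi" using pi_ge_two by simp
      then have "x / (2 * pi) \<le> x" if "x \<ge> 0" for x using that by (simp add: divide_le_eq mult_le_cancel_left1)
      then show "AE \<tau> in lborel. norm (?f n \<tau>) \<le> norm (cauchy \<gamma> (of_real (1 / real (Suc n)) + \<i> * of_real \<tau>))"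
        by (intro AE_I2) (simp add: norm_divide)
    qed (use q in simp)
    also have "\<dots> \<le> (\<integral>\<^sup>+t. ennreal (((1 + \<bar>t\<bar>) powr b * norm (cauchy \<gamma> (of_real (1 / real (Suc n)) + \<i> * of_real t))) powr q) \<partial>lborel)"
      using q b by (intro weight_comparison(1)) auto
    also have "\<dots> \<le> ennreal C * (\<integral>\<^sup>+s. ennreal (((1 + \<bar>s\<bar>) powr b * norm (\<gamma> s)) powr q) \<partial>lborel)"
      by (intro C gi gw) simp
    also have "\<dots> \<le> ennreal C * wnorm b q (\<lambda>s. of_real (2 powr b) * \<gamma> s)"
      using q b by (intro mult_left_mono weight_comparison(2)) auto
    also have "\<dots> = ennreal D * wnorm b q \<gamma>"
      using q C schwartz_measurable[OF g] by (subst wnorm_cmult) (auto simp: D_def ennreal_mult mult.assoc)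
    finally show "wnorm b q (?f n) \<le> ennreal D * wnorm b q \<gamma>" .
  qed (use q in simp)
  show thesis
  proof (rule that[OF D])
    fix a and \<gamma> :: "real \<Rightarrow> complex" assume g: "\<gamma> \<in> schwartz"
    have "wnorm b q (fourier (cut {a<..} (ifourier \<gamma>))) = wnorm b q (fourier (cut {0<..} (ifourier (\<lambda>s. cis (a * s) * \<gamma> s))))"
      unfolding wnorm_def fourier_cut_shift[OF g] norm_mult norm_cis by simp
    also have "\<dots> \<le> ennreal D * wnorm b q (\<lambda>s. cis (a * s) * \<gamma> s)" by (intro origin schwartz_modulate g)
    also have "wnorm b q (\<lambda>s. cis (a * s) * \<gamma> s) = wnorm b q \<gamma>" unfolding wnorm_def norm_mult norm_cis by simp
    finally show "wnorm b q (fourier (cut {a<..} (ifourier \<gamma>))) \<le> ennreal D * wnorm b q \<gamma>" .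
  qed
qed

text \<open>
  The points \<open>a\<close> and \<open>b\<close> are the endpoints of \<open>I\<close> where these exist. Excluding them removes the
  distinction between open and closed ends.
\<close>

lemma interval_indicator:
  fixes I :: "real set"
  assumes I: "is_interval I"
  obtains a b c0 c1 c2 :: real where "\<bar>c0\<bar> \<le> 1" "\<bar>c1\<bar> \<le> 1" "\<bar>c2\<bar> \<le> 1"
    "\<And>x. x \<noteq> a \<Longrightarrow> x \<noteq> b \<Longrightarrow> indicator I x = c0 + c1 * indicator {a<..} x + c2 * indicator {b<..} x"
proof (cases "I = {}")
  case True
  then show ?thesis by (intro that[of 0 0 0]) auto
next
  case ne: False
  have mid: "x \<in> I" if "u \<in> I" "v \<in> I" "u < x" "x < v" for u v x
    using I that unfolding is_interval_1 by (meson less_imp_le)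
  have lo: "\<exists>u\<in>I. u < x" if "bdd_below I \<longrightarrow> Inf I < x" for x
    using that ne by (cases "bdd_below I") (auto simp: cInf_less_iff bdd_below_def not_le intro: less_imp_le)
  have hi: "\<exists>u\<in>I. x < u" if "bdd_above I \<longrightarrow> x < Sup I" for x
    using that ne by (cases "bdd_above I") (auto simp: less_cSup_iff bdd_above_def not_le)
  have in1: "x \<in> I" if "bdd_below I \<longrightarrow> Inf I < x" "bdd_above I \<longrightarrow> x < Sup I" for x
    using lo[OF that(1)] hi[OF that(2)] mid by blast
  have out1: "x \<notin> I" if "bdd_below I" "x < Inf I" for x using that cInf_lower[of x I] by auto
  have out2: "x \<notin> I" if "bdd_above I" "Sup I < x" for x using that cSup_upper[of x I] by auto
  consider "bdd_below I" "bdd_above I" | "bdd_below I" "\<not> bdd_above I" | "\<not> bdd_below I" "bdd_above I" | "\<not> bdd_below I" "\<not> bdd_above I"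
    by metis
  then show ?thesis
  proof cases
    case 1
    have "Inf I \<le> Sup I" using cInf_le_cSup[OF ne 1(2,1)] .
    moreover have "x \<in> I \<longleftrightarrow> Inf I < x \<and> x < Sup I" if "x \<noteq> Inf I" "x \<noteq> Sup I" for x
      using in1[of x] out1[of x] out2[of x] 1 that by (meson not_less_iff_gr_or_eq)
    ultimately show ?thesis by (intro that[of 0 1 "-1" "Inf I" "Sup I"]) (auto simp: indicator_def)
  next
    case 2
    have "x \<in> I \<longleftrightarrow> Inf I < x" if "x \<noteq> Inf I" for x
      using in1[of x] out1[of x] 2 that by (meson not_less_iff_gr_or_eq)
    then show ?thesis by (intro that[of 0 1 0 "Inf I" 0]) (auto simp: indicator_def)
  next
    case 3
    have "x \<in> I \<longleftrightarrow> x < Sup I" if "x \<noteq> Sup I" for x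
      using in1[of x] out2[of x] 3 that by (meson not_less_iff_gr_or_eq)
    then show ?thesis by (intro that[of 1 0 "-1" 0 "Sup I"]) (auto simp: indicator_def)
  next
    case 4
    have "x \<in> I" for x using 4 by (intro in1) simp_all
    then show ?thesis by (intro that[of 1 0 0]) auto
  qed
qed

text \<open>
  The cut-off to \<open>I\<close> is a combination of the identity and two cut-offs to half-lines. The bound does not
  see \<open>I\<close> because the coefficients are at most 1 in absolute value.
\<close>

lemma interval_cut_bound:
  fixes b q :: real
  assumes q: "1 < q" and b: "0 \<le> b" "b < 1 - 1 / q"
  obtains C where "C \<ge> 0" "\<And>I \<gamma>. is_interval I \<Longrightarrow> \<gamma> \<in> schwartz \<Longrightarrow> wnorm b q (fourier (cut I (ifourier \<gamma>))) \<le> ennreal C * wnorm b q \<gamma>"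
proof -
  obtain C where C: "C \<ge> 0" "\<And>a \<gamma>. \<gamma> \<in> schwartz \<Longrightarrow> wnorm b q (fourier (cut {a<..} (ifourier \<gamma>))) \<le> ennreal C * wnorm b q \<gamma>"
    by (rule halfline_cut_bound[OF q b]) blast
  define K where "K = 2 powr q * (1 + 2 powr q * (C + C))"
  show thesis
  proof (rule that)
    show "K \<ge> 0" using C by (simp add: K_def)
    fix I :: "real set" and \<gamma> :: "real \<Rightarrow> complex" assume I: "is_interval I" and g: "\<gamma> \<in> schwartz"
    let ?f = "ifourier \<gamma>"
    note f = schwartz_ifourier[OF g]
    note [measurable] = schwartz_measurable[OF g] schwartz_measurable[OF f] real_interval_borel_measurable[OF I]
    obtain a d c0 c1 c2 where c: "\<bar>c0\<bar> \<le> 1" "\<bar>c1\<bar> \<le> 1" "\<bar>c2\<bar> \<le> (1::real)"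
      and ind: "\<And>x. x \<noteq> a \<Longrightarrow> x \<noteq> d \<Longrightarrow> indicator I x = c0 + c1 * indicator {a<..} x + c2 * indicator {d<..} x"
      by (rule interval_indicator[OF I]) blast
    let ?ga = "fourier (cut {a<..} ?f)" and ?gd = "fourier (cut {d<..} ?f)"
    note ic = integrable_cut[OF schwartz_integrable[OF f]]
    have ia: "integrable lborel (cut {a<..} ?f)" and id: "integrable lborel (cut {d<..} ?f)" by (intro ic; simp)+
    have "AE x in lborel. cut I ?f x = of_real c0 * ?f x + (of_real c1 * cut {a<..} ?f x + of_real c2 * cut {d<..} ?f x)"
      using AE_lborel_singleton[of a] AE_lborel_singleton[of d]
    proof eventually_elim
      case (elim x)
      have "cut I ?f x = of_real (indicator I x) * ?f x" by (simp add: cut_def indicator_def)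
      also have "\<dots> = of_real c0 * ?f x + (of_real c1 * cut {a<..} ?f x + of_real c2 * cut {d<..} ?f x)"
        unfolding ind[OF elim] by (simp add: cut_def indicator_def algebra_simps)
      finally show ?case .
    qed
    then have "fourier (cut I ?f) \<tau> = fourier (\<lambda>x. of_real c0 * ?f x + (of_real c1 * cut {a<..} ?f x + of_real c2 * cut {d<..} ?f x)) \<tau>" for \<tau>
      unfolding fourier_def cut_def by (intro integral_cong_AE) (auto elim: eventually_mono)
    then have eq: "fourier (cut I ?f) = (\<lambda>\<tau>. of_real c0 * \<gamma> \<tau> + (of_real c1 * ?ga \<tau> + of_real c2 * ?gd \<tau>))"
      by (auto simp: fourier_add fourier_cmult fourier_ifourier[OF g] schwartz_integrable[OF f] ia id)
    have m [measurable]: "?ga \<in> borel_measurable borel" "?gd \<in> borel_measurable borel" unfolding cut_def by measurable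
    have le1: "wnorm b q (\<lambda>\<tau>. of_real r * h \<tau>) \<le> wnorm b q h" if "\<bar>r\<bar> \<le> 1" for r :: real and h
      using that q by (intro wnorm_mono) (auto simp: norm_mult intro!: mult_left_le_one_le)
    have "wnorm b q (fourier (cut I ?f)) \<le> ennreal (2 powr q) * (wnorm b q (\<lambda>\<tau>. of_real c0 * \<gamma> \<tau>) + wnorm b q (\<lambda>\<tau>. of_real c1 * ?ga \<tau> + of_real c2 * ?gd \<tau>))"
      unfolding eq using q by (intro wnorm_add) auto
    also have "\<dots> \<le> ennreal (2 powr q) * (wnorm b q \<gamma> + ennreal (2 powr q) * (ennreal C * wnorm b q \<gamma> + ennreal C * wnorm b q \<gamma>))"
    proof (intro mult_left_mono add_mono le1 c)
      have "wnorm b q (\<lambda>\<tau>. of_real c1 * ?ga \<tau> + of_real c2 * ?gd \<tau>) \<le> ennreal (2 powr q) * (wnorm b q (\<lambda>\<tau>. of_real c1 * ?ga \<tau>) + wnorm b q (\<lambda>\<tau>. of_real c2 * ?gd \<tau>))"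
        using q by (intro wnorm_add) auto
      also have "\<dots> \<le> ennreal (2 powr q) * (ennreal C * wnorm b q \<gamma> + ennreal C * wnorm b q \<gamma>)"
        by (intro mult_left_mono add_mono order_trans[OF le1 C(2)] c g) auto
      finally show "wnorm b q (\<lambda>\<tau>. of_real c1 * ?ga \<tau> + of_real c2 * ?gd \<tau>) \<le> ennreal (2 powr q) * (ennreal C * wnorm b q \<gamma> + ennreal C * wnorm b q \<gamma>)" .
    qed simp
    also have "\<dots> = ennreal K * wnorm b q \<gamma>"
    proof -
      have "ennreal K = ennreal (2 powr q) * (1 + ennreal (2 powr q) * (2 * ennreal C))"
        using C(1) by (simp add: K_def ennreal_mult ennreal_plus)
      moreover have "ennreal C * wnorm b q \<gamma> + ennreal C * wnorm b q \<gamma> = (2 * ennreal C) * wnorm b q \<gamma>"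
        by (simp only: mult_2 distrib_right)
      ultimately show ?thesis by (simp only: distrib_right mult_1 mult.assoc)
    qed
    finally show "wnorm b q (fourier (cut I ?f)) \<le> ennreal K * wnorm b q \<gamma>" .
  qed
qed

section \<open>Pairings with slowly decaying functions\<close>

text \<open>
  The \<open>L^p\<close> norm of \<open>1 / (1 + |\<tau>|)\<close> for the exponent \<open>p\<close> conjugate to \<open>q\<close>.
\<close>

definition pairing_const :: "real \<Rightarrow> real" where
  "pairing_const q = (2 * (q - 1)) powr (1 - 1 / q)"

lemma pairing_const_nonneg: "pairing_const q \<ge> 0"
  by (simp add: pairing_const_def)

text \<open>
  Hoelder's inequality. As \<open>b \<ge> 0\<close>, the weighted norm of \<open>g\<close> dominates the unweighted one.
\<close>

lemma pairing_bound:
  fixes b q :: real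
  assumes q: "1 < q" and b: "0 \<le> b"
    and m [measurable]: "g \<in> borel_measurable borel" "\<phi> \<in> borel_measurable borel"
    and fin: "wnorm b q g < \<infinity>" and C: "C \<ge> 0" and \<phi>: "\<And>\<tau>. (1 + \<bar>\<tau>\<bar>) * norm (\<phi> \<tau>) \<le> C"
  shows "(\<integral>\<^sup>+\<tau>. ennreal (norm (g \<tau> * \<phi> \<tau>)) \<partial>lborel) \<le> ennreal (pairing_const q * C * enn2real (wnorm b q g) powr (1 / q))"
proof -
  define p where "p = q / (q - 1)"
  have pq: "p > 1" "1 / q + 1 / p = 1" using q by (simp_all add: p_def diff_divide_distrib)
  define K where "K = pairing_const q"
  have K0: "K \<ge> 0" by (simp add: K_def pairing_const_nonneg)
  have "(1 - 1 / q) * p = 1" "2 * (q - 1) = 2 / (p - 1)" using q by (simp_all add: p_def field_simps)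
  then have K: "K powr p = 2 / (p - 1)" using q pq(1) by (simp add: K_def pairing_const_def powr_powr)
  define w where "w = enn2real (wnorm b q g)"
  have w: "w \<ge> 0" "wnorm b q g = ennreal w" using fin by (auto simp: w_def)
  have "(\<integral>\<^sup>+\<tau>. ennreal (norm (g \<tau>) * norm (\<phi> \<tau>)) \<partial>lborel) \<le> ennreal (w powr (1 / q) * (K * C))"
  proof (rule nn_Hoelder[OF q pq])
    have "(\<integral>\<^sup>+\<tau>. ennreal (norm (g \<tau>) powr q) \<partial>lborel) \<le> wnorm b q g"
      unfolding wnorm_def
    proof (intro nn_integral_mono ennreal_leI powr_mono2)
      fix \<tau>
      have "1 \<le> japanese_bracket \<tau> powr b" using japanese_bracket_ge_1 b by (rule ge_one_powr_ge_zero)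
      then have "1 * norm (g \<tau>) \<le> japanese_bracket \<tau> powr b * norm (g \<tau>)" by (rule mult_right_mono) simp
      then show "norm (g \<tau>) \<le> japanese_bracket \<tau> powr b * norm (g \<tau>)" by simp
    qed (use q in auto)
    also have "\<dots> = ennreal ((w powr (1 / q)) powr q)" using w q by (simp add: powr_powr)
    finally show "(\<integral>\<^sup>+\<tau>. ennreal (norm (g \<tau>) powr q) \<partial>lborel) \<le> ennreal ((w powr (1 / q)) powr q)" .
    have "(\<integral>\<^sup>+\<tau>. ennreal (norm (\<phi> \<tau>) powr p) \<partial>lborel) \<le> (\<integral>\<^sup>+\<tau>. ennreal (C powr p) * ennreal ((1 + \<bar>\<tau>\<bar>) powr (- 1 - (p - 1)) * indicator {0..} \<bar>\<tau>\<bar>) \<partial>lborel)"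
    proof (rule nn_integral_mono)
      fix \<tau> :: real
      have "norm (\<phi> \<tau>) \<le> C / (1 + \<bar>\<tau>\<bar>)" using \<phi>[of \<tau>] by (simp add: pos_le_divide_eq mult.commute)
      then have "norm (\<phi> \<tau>) powr p \<le> (C / (1 + \<bar>\<tau>\<bar>)) powr p" using pq by (intro powr_mono2) auto
      also have "\<dots> = C powr p * (1 + \<bar>\<tau>\<bar>) powr (- 1 - (p - 1))" using C by (simp add: powr_divide powr_minus_divide)
      finally show "ennreal (norm (\<phi> \<tau>) powr p) \<le> ennreal (C powr p) * ennreal ((1 + \<bar>\<tau>\<bar>) powr (- 1 - (p - 1)) * indicator {0..} \<bar>\<tau>\<bar>)"
        by (simp add: ennreal_leI flip: ennreal_mult)
    qed
    also have "\<dots> = ennreal (C powr p) * (\<integral>\<^sup>+\<tau>. ennreal ((1 + \<bar>\<tau>\<bar>) powr (- 1 - (p - 1)) * indicator {0..} \<bar>\<tau>\<bar>) \<partial>lborel)"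
      by (intro nn_integral_cmult) measurable
    also have "\<dots> \<le> ennreal (C powr p) * ennreal (2 / (p - 1) * (1 + 0) powr (- (p - 1)))"
      using pq by (intro mult_left_mono nn_integral_weight_tail) auto
    also have "\<dots> = ennreal ((K * C) powr p)"
      using C K K0 pq by (simp add: powr_mult mult.commute flip: ennreal_mult)
    finally show "(\<integral>\<^sup>+\<tau>. ennreal (norm (\<phi> \<tau>) powr p) \<partial>lborel) \<le> ennreal ((K * C) powr p)" .
  qed (use C K0 in auto)
  then show "(\<integral>\<^sup>+\<tau>. ennreal (norm (g \<tau> * \<phi> \<tau>)) \<partial>lborel) \<le> ennreal (pairing_const q * C * enn2real (wnorm b q g) powr (1 / q))"
    by (simp add: norm_mult w_def K_def mult.commute)
qed

lemma pairing_integrable: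
  fixes b q :: real
  assumes q: "1 < q" and b: "0 \<le> b"
    and [measurable]: "g \<in> borel_measurable borel" "\<phi> \<in> borel_measurable borel" and fin: "wnorm b q g < \<infinity>"
    and \<phi>: "\<And>\<tau>. (1 + \<bar>\<tau>\<bar>) * norm (\<phi> \<tau>) \<le> C"
  shows "integrable lborel (\<lambda>\<tau>. g \<tau> * \<phi> \<tau>)"
proof (rule integrableI_bounded)
  have C: "C \<ge> 0" using order_trans[OF norm_ge_zero, of "\<phi> 0" C] \<phi>[of 0] by simp
  have "(\<integral>\<^sup>+\<tau>. ennreal (norm (g \<tau> * \<phi> \<tau>)) \<partial>lborel) \<le> ennreal (pairing_const q * C * enn2real (wnorm b q g) powr (1 / q))"
    by (rule pairing_bound[OF q b _ _ fin C \<phi>]) measurable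
  also have "\<dots> < \<infinity>" by simp
  finally show "(\<integral>\<^sup>+\<tau>. ennreal (norm (g \<tau> * \<phi> \<tau>)) \<partial>lborel) < \<infinity>" .
qed measurable

lemma schwartz_decay1:
  assumes "\<phi> \<in> schwartz" obtains C where "C \<ge> 0" "\<And>\<tau>. (1 + \<bar>\<tau>\<bar>) * norm (\<phi> \<tau>) \<le> C"
proof -
  obtain C0 where C0: "C0 \<ge> 0" "\<And>x. \<bar>x\<bar> ^ 0 * norm (\<phi> x) \<le> C0" using schwartz_boundE[OF assms] by blast
  obtain C1 where C1: "C1 \<ge> 0" "\<And>x. \<bar>x\<bar> ^ 1 * norm (\<phi> x) \<le> C1" using schwartz_boundE[OF assms] by blast
  have "(1 + \<bar>\<tau>\<bar>) * norm (\<phi> \<tau>) \<le> C0 + C1" for \<tau> using C0(2)[of \<tau>] C1(2)[of \<tau>] by (simp add: distrib_right)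
  then show thesis using C0(1) C1(1) by (intro that[of "C0 + C1"]) auto
qed

lemma pairing_schwartz_integrable:
  assumes "1 < q" "0 \<le> b" "g \<in> borel_measurable borel" "wnorm b q g < \<infinity>" "\<phi> \<in> schwartz"
  shows "integrable lborel (\<lambda>\<tau>. g \<tau> * \<phi> \<tau>)"
proof -
  obtain C where "\<And>\<tau>. (1 + \<bar>\<tau>\<bar>) * norm (\<phi> \<tau>) \<le> C" using schwartz_decay1[OF assms(5)] by blast
  then show ?thesis by (intro pairing_integrable[OF assms(1,2,3) schwartz_measurable[OF assms(5)] assms(4)])
qed

section \<open>Fourier-Lebesgue spaces\<close>

text \<open>
  The distribution with Fourier transform \<open>g\<close>.
\<close>

definition FL_dist :: "(real \<Rightarrow> complex) \<Rightarrow> functional" where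
  "FL_dist g = (\<lambda>\<psi>. if \<psi> \<in> schwartz then (\<integral>\<tau>. g \<tau> * ifourier \<psi> \<tau> \<partial>lborel) else 0)"

lemma schwartz_seminorm_upper:
  assumes "\<phi> \<in> schwartz" shows "\<bar>x\<bar> ^ j * norm (\<phi> x) \<le> schwartz_seminorm j 0 \<phi>"
proof -
  have "bounded (range (\<lambda>x. x ^ j *\<^sub>R schwartz_deriv 0 \<phi> x))" using assms unfolding schwartz_def by blast
  then obtain B where "\<And>x. norm (x ^ j *\<^sub>R schwartz_deriv 0 \<phi> x) \<le> B" unfolding bounded_iff by blast
  then have "bdd_above (range (\<lambda>x. norm (x ^ j *\<^sub>R schwartz_deriv 0 \<phi> x)))"
    by (rule bdd_aboveI2)
  from cSUP_upper[OF UNIV_I this, of x] show ?thesis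
    unfolding schwartz_seminorm_def by (simp add: schwartz_deriv_def power_abs)
qed

lemma schwartz_seminorm_vderiv: "schwartz_seminorm j k (vderiv \<phi>) = schwartz_seminorm j (Suc k) \<phi>"
  unfolding schwartz_seminorm_def schwartz_deriv_vderiv ..

lemma schwartz_seminorm_nonneg:
  assumes "\<phi> \<in> schwartz" shows "schwartz_seminorm j k \<phi> \<ge> 0"
  using assms
proof (induction k arbitrary: \<phi>)
  case 0
  show ?case by (rule order_trans[OF _ schwartz_seminorm_upper[OF 0, of 0]]) simp
next
  case (Suc k)
  show ?case using Suc.IH[OF schwartz_vderiv[OF Suc.prems]] unfolding schwartz_seminorm_vderiv .
qed

lemma integral_norm_le_seminorm:
  assumes p: "\<phi> \<in> schwartz"
  shows "(\<integral>x. norm (\<phi> x) \<partial>lborel) \<le> pi * (schwartz_seminorm 0 0 \<phi> + schwartz_seminorm 2 0 \<phi>)"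
proof -
  let ?S = "schwartz_seminorm 0 0 \<phi> + schwartz_seminorm 2 0 \<phi>"
  have "(\<integral>x. norm (\<phi> x) \<partial>lborel) \<le> (\<integral>x. ?S * inverse (1 + x\<^sup>2) \<partial>lborel)"
  proof (rule integral_mono)
    show "integrable lborel (\<lambda>x. norm (\<phi> x))" by (intro integrable_norm schwartz_integrable p)
    show "integrable lborel (\<lambda>x. ?S * inverse (1 + x\<^sup>2))" by (intro integrable_mult_right integrable_inverse_1_plus_square)
    fix x :: real
    have "norm (\<phi> x) * (1 + x\<^sup>2) \<le> ?S"
      using schwartz_seminorm_upper[OF p, of x 0] schwartz_seminorm_upper[OF p, of x 2] by (simp add: algebra_simps)
    then show "norm (\<phi> x) \<le> ?S * inverse (1 + x\<^sup>2)" by (simp add: pos_le_divide_eq add_pos_nonneg flip: divide_inverse)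
  qed
  also have "\<dots> = ?S * (\<integral>x. inverse (1 + x\<^sup>2) \<partial>lborel)" by (rule integral_mult_right_zero)
  also have "\<dots> = pi * ?S" unfolding integral_inverse_1_plus_square by simp
  finally show ?thesis .
qed

lemma ifourier_add:
  "integrable lborel \<phi> \<Longrightarrow> integrable lborel \<psi> \<Longrightarrow> ifourier (\<lambda>x. \<phi> x + \<psi> x) \<tau> = ifourier \<phi> \<tau> + ifourier \<psi> \<tau>"
  by (simp add: ifourier_def fourier_add add_divide_distrib)

lemma ifourier_cmult: "ifourier (\<lambda>x. c * \<phi> x) \<tau> = c * ifourier \<phi> \<tau>"
  by (simp add: ifourier_def fourier_cmult)

lemma FL_dist_tempered:
  assumes q: "1 < q" and b: "0 \<le> b" and m [measurable]: "g \<in> borel_measurable borel" and fin: "wnorm b q g < \<infinity>"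
  shows "tempered_distribution (FL_dist g)"
  unfolding tempered_distribution_def
proof (intro conjI allI ballI impI)
  fix \<phi> assume "\<phi> \<notin> schwartz" then show "FL_dist g \<phi> = 0" by (simp add: FL_dist_def)
next
  fix \<phi> \<psi> assume p: "\<phi> \<in> schwartz" "\<psi> \<in> schwartz"
  then show "FL_dist g (\<lambda>x. \<phi> x + \<psi> x) = FL_dist g \<phi> + FL_dist g \<psi>"
    by (simp add: FL_dist_def schwartz_add ifourier_add schwartz_integrable distrib_left
        pairing_schwartz_integrable[OF q b m fin] schwartz_ifourier)
next
  fix c \<phi> assume "\<phi> \<in> schwartz"
  then show "FL_dist g (\<lambda>x. c * \<phi> x) = c * FL_dist g \<phi>"
    by (simp add: FL_dist_def schwartz_cmult ifourier_cmult mult.left_commute[of _ c])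
next
  let ?K = "pairing_const q"
  define w where "w = enn2real (wnorm b q g) powr (1 / q)"
  show "\<exists>C N. \<forall>\<phi>\<in>schwartz. norm (FL_dist g \<phi>) \<le> C * (\<Sum>j\<le>N. \<Sum>k\<le>N. schwartz_seminorm j k \<phi>)"
  proof (intro exI ballI)
    fix \<phi> assume p: "\<phi> \<in> schwartz"
    let ?s = "\<lambda>j k. schwartz_seminorm j k \<phi>"
    let ?S = "\<Sum>j\<le>2. \<Sum>k\<le>2. ?s j k"
    note nn = schwartz_seminorm_nonneg[OF p]
    have S0: "?S \<ge> 0" by (intro sum_nonneg nn)
    have "?s 0 0 + ?s 2 0 + (?s 0 1 + ?s 2 1) \<le> ?S"
      using nn by (simp add: numeral_2_eq_2 add_nonneg_nonneg)
    then have "pi * (?s 0 0 + ?s 2 0 + (?s 0 1 + ?s 2 1)) \<le> pi * ?S" by (intro mult_left_mono) auto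
    moreover have "(\<integral>x. norm (vderiv \<phi> x) \<partial>lborel) \<le> pi * (?s 0 1 + ?s 2 1)"
      using integral_norm_le_seminorm[OF schwartz_vderiv[OF p]] unfolding schwartz_seminorm_vderiv by simp
    ultimately have dec: "(1 + \<bar>\<tau>\<bar>) * norm (ifourier \<phi> \<tau>) \<le> pi * ?S" for \<tau>
      using ifourier_decay1[OF p, of \<tau>] integral_norm_le_seminorm[OF p] by (simp only: distrib_left)
    have "ennreal (norm (FL_dist g \<phi>)) \<le> (\<integral>\<^sup>+\<tau>. ennreal (norm (g \<tau> * ifourier \<phi> \<tau>)) \<partial>lborel)"
      using p by (simp add: FL_dist_def integral_norm_bound_ennreal pairing_schwartz_integrable[OF q b m fin] schwartz_ifourier)
    also have "\<dots> \<le> ennreal (?K * (pi * ?S) * w)"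
      unfolding w_def using S0 by (intro pairing_bound q b dec fin m schwartz_measurable schwartz_ifourier p) auto
    finally have "norm (FL_dist g \<phi>) \<le> ?K * (pi * ?S) * w"
      using pairing_const_nonneg[of q] S0 by (subst (asm) ennreal_le_iff) (auto simp: w_def)
    then show "norm (FL_dist g \<phi>) \<le> (?K * pi * w) * ?S" by (simp add: mult_ac)
  qed
qed

lemma is_function_fourier_FL_dist:
  assumes q: "1 < q" and b: "0 \<le> b" and m: "g \<in> borel_measurable borel" and fin: "wnorm b q g < \<infinity>"
  shows "is_function (fourier_dist (FL_dist g)) g"
  unfolding is_function_def
proof (intro conjI ballI m ext)
  show "integrable lborel (\<lambda>x. g x * \<phi> x)" if "\<phi> \<in> schwartz" for \<phi>
    by (rule pairing_schwartz_integrable[OF q b m fin that])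
  show "fourier_dist (FL_dist g) \<phi> = dist_of g \<phi>" for \<phi>
    by (simp add: fourier_dist_def FL_dist_def dist_of_def schwartz_fourier fourier_inversion)
qed

text \<open>
  This makes the choice in the definition of the norm immaterial.
\<close>

lemma is_function_unique:
  assumes "is_function u g" "is_function u h" shows "AE x in lborel. g x = h x"
proof -
  note a = assms[unfolded is_function_def]
  have e: "dist_of g = dist_of h" using a by metis
  have "AE x in lborel. g x - h x = 0"
  proof (rule AE_zero_of_schwartz_pairings)
    show "(\<lambda>x. g x - h x) \<in> borel_measurable borel" using a by (intro borel_measurable_diff) auto
    fix \<phi> assume p: "\<phi> \<in> schwartz"
    have i: "integrable lborel (\<lambda>x. g x * \<phi> x)" "integrable lborel (\<lambda>x. h x * \<phi> x)" using a p by auto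
    show "integrable lborel (\<lambda>x. (g x - h x) * \<phi> x)" unfolding left_diff_distrib by (intro Bochner_Integration.integrable_diff i)
    have "(\<integral>x. g x * \<phi> x \<partial>lborel) = (\<integral>x. h x * \<phi> x \<partial>lborel)"
      using fun_cong[OF e, of \<phi>] p by (simp add: dist_of_def)
    then show "(\<integral>x. (g x - h x) * \<phi> x \<partial>lborel) = 0"
      unfolding left_diff_distrib by (simp add: Bochner_Integration.integral_diff[OF i])
  qed
  then show ?thesis by eventually_elim simp
qed

lemma FL_norm_eq:
  assumes "is_function (fourier_dist u) g"
  shows "FL_norm b q u = enn2real (wnorm b q g) powr (1 / q)"
proof -
  let ?g = "SOME g. is_function (fourier_dist u) g"
  have s: "is_function (fourier_dist u) ?g" using assms by (rule someI[where P = "is_function (fourier_dist u)"])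
  have [measurable]: "?g \<in> borel_measurable borel" using s by (simp add: is_function_def)
  have "(\<integral>\<tau>. (japanese_bracket \<tau> powr b * norm (?g \<tau>)) powr q \<partial>lborel) = enn2real (wnorm b q ?g)"
    unfolding wnorm_def by (rule integral_eq_nn_integral) auto
  also have "wnorm b q ?g = wnorm b q g" by (rule wnorm_cong[OF is_function_unique[OF s assms]])
  finally show ?thesis by (simp add: FL_norm_def)
qed

lemma integrable_iff_wnorm:
  assumes [measurable]: "g \<in> borel_measurable borel"
  shows "integrable lborel (\<lambda>\<tau>. (japanese_bracket \<tau> powr b * norm (g \<tau>)) powr q) \<longleftrightarrow> wnorm b q g < \<infinity>"
  unfolding wnorm_def by (subst integrable_iff_bounded) simp

text \<open>
  As every Schwartz function is a Fourier transform, a distribution is recovered from the function that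
  represents its transform.
\<close>

lemma FL_iff:
  assumes q: "1 < q" and b: "0 \<le> b"
  shows "u \<in> FL b q \<longleftrightarrow> (\<exists>g. g \<in> borel_measurable borel \<and> wnorm b q g < \<infinity> \<and> u = FL_dist g)"
proof
  assume "u \<in> FL b q"
  then obtain g where t: "tempered_distribution u" and g: "is_function (fourier_dist u) g"
    and i: "integrable lborel (\<lambda>\<tau>. (japanese_bracket \<tau> powr b * norm (g \<tau>)) powr q)"
    by (auto simp: FL_def)
  have m: "g \<in> borel_measurable borel" using g by (simp add: is_function_def)
  have "u = FL_dist g"
  proof
    fix \<psi>
    show "u \<psi> = FL_dist g \<psi>"
    proof (cases "\<psi> \<in> schwartz")
      case True
      have "u \<psi> = fourier_dist u (ifourier \<psi>)"
        by (simp add: fourier_dist_def schwartz_ifourier[OF True] fourier_ifourier[OF True])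
      also have "fourier_dist u = dist_of g" using g by (simp add: is_function_def)
      finally show ?thesis by (simp add: dist_of_def FL_dist_def True schwartz_ifourier[OF True])
    next
      case False
      then show ?thesis using t by (simp add: tempered_distribution_def FL_dist_def)
    qed
  qed
  then show "\<exists>g. g \<in> borel_measurable borel \<and> wnorm b q g < \<infinity> \<and> u = FL_dist g"
    using m i integrable_iff_wnorm[OF m] by blast
next
  assume "\<exists>g. g \<in> borel_measurable borel \<and> wnorm b q g < \<infinity> \<and> u = FL_dist g"
  then obtain g where g: "g \<in> borel_measurable borel" "wnorm b q g < \<infinity>" "u = FL_dist g" by blast
  then show "u \<in> FL b q"
    unfolding FL_def using FL_dist_tempered[OF q b g(1,2)] is_function_fourier_FL_dist[OF q b g(1,2)] integrable_iff_wnorm[OF g(1)]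
    by blast
qed

lemma FL_norm_FL_dist:
  assumes "1 < q" "0 \<le> b" "g \<in> borel_measurable borel" "wnorm b q g < \<infinity>"
  shows "FL_norm b q (FL_dist g) = enn2real (wnorm b q g) powr (1 / q)"
  by (rule FL_norm_eq[OF is_function_fourier_FL_dist[OF assms]])

lemma FL_dist_diff:
  assumes "1 < q" "0 \<le> b" "g \<in> borel_measurable borel" "wnorm b q g < \<infinity>" "h \<in> borel_measurable borel" "wnorm b q h < \<infinity>"
  shows "(\<lambda>\<phi>. FL_dist g \<phi> - FL_dist h \<phi>) = FL_dist (\<lambda>\<tau>. g \<tau> - h \<tau>)"
proof
  fix \<phi>
  show "FL_dist g \<phi> - FL_dist h \<phi> = FL_dist (\<lambda>\<tau>. g \<tau> - h \<tau>) \<phi>"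
    by (cases "\<phi> \<in> schwartz")
      (simp_all add: FL_dist_def left_diff_distrib schwartz_ifourier pairing_schwartz_integrable[OF assms(1-4)] pairing_schwartz_integrable[OF assms(1,2,5,6)])
qed

lemma FL_dist_cong:
  assumes "AE \<tau> in lborel. g \<tau> = h \<tau>" "g \<in> borel_measurable borel" "h \<in> borel_measurable borel"
  shows "FL_dist g = FL_dist h"
proof
  fix \<psi>
  have "(\<integral>\<tau>. g \<tau> * ifourier \<psi> \<tau> \<partial>lborel) = (\<integral>\<tau>. h \<tau> * ifourier \<psi> \<tau> \<partial>lborel)" if p: "\<psi> \<in> schwartz"
  proof (rule integral_cong_AE)
    note [measurable] = assms(2,3) schwartz_measurable[OF schwartz_ifourier[OF p]]
    show "(\<lambda>\<tau>. g \<tau> * ifourier \<psi> \<tau>) \<in> borel_measurable lborel" "(\<lambda>\<tau>. h \<tau> * ifourier \<psi> \<tau>) \<in> borel_measurable lborel" by measurable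
  qed (use assms(1) in \<open>auto elim: eventually_mono\<close>)
  then show "FL_dist g \<psi> = FL_dist h \<psi>" by (simp add: FL_dist_def)
qed

lemma wnorm_diff_finite:
  assumes "q > 0" and [measurable]: "g \<in> borel_measurable borel" "h \<in> borel_measurable borel"
    and fin: "wnorm b q g < \<infinity>" "wnorm b q h < \<infinity>"
  shows "wnorm b q (\<lambda>\<tau>. g \<tau> - h \<tau>) < \<infinity>"
proof -
  have "wnorm b q (\<lambda>\<tau>. g \<tau> - h \<tau>) = wnorm b q (\<lambda>\<tau>. g \<tau> + (- 1) * h \<tau>)" by simp
  also have "\<dots> \<le> ennreal (2 powr q) * (wnorm b q g + wnorm b q (\<lambda>\<tau>. (- 1) * h \<tau>))"
    using assms(1) by (intro wnorm_add) auto
  also have "wnorm b q (\<lambda>\<tau>. (- 1) * h \<tau>) = wnorm b q h" unfolding wnorm_def by simp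
  also have "ennreal (2 powr q) * (wnorm b q g + wnorm b q h) < \<infinity>" using fin by (simp add: ennreal_mult_less_top)
  finally show ?thesis .
qed

lemma FL_tendsto_iff:
  assumes q: "1 < q" and b: "0 \<le> b"
    and g: "\<And>n. g n \<in> borel_measurable borel" "\<And>n. wnorm b q (g n) < \<infinity>" and h: "h \<in> borel_measurable borel" "wnorm b q h < \<infinity>"
  shows "FL_tendsto b q (\<lambda>n. FL_dist (g n)) (FL_dist h) \<longleftrightarrow> (\<lambda>n. wnorm b q (\<lambda>\<tau>. g n \<tau> - h \<tau>)) \<longlonglongrightarrow> 0"
proof -
  define w where "w n = enn2real (wnorm b q (\<lambda>\<tau>. g n \<tau> - h \<tau>))" for n
  have fin: "wnorm b q (\<lambda>\<tau>. g n \<tau> - h \<tau>) < \<infinity>" for n using q g h by (intro wnorm_diff_finite) auto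
  have w: "wnorm b q (\<lambda>\<tau>. g n \<tau> - h \<tau>) = ennreal (w n)" "w n \<ge> 0" for n
    using fin[of n] by (auto simp: w_def)
  have m: "(\<lambda>\<tau>. g n \<tau> - h \<tau>) \<in> borel_measurable borel" for n using g h by (intro borel_measurable_diff)
  have "FL_norm b q (\<lambda>\<phi>. FL_dist (g n) \<phi> - FL_dist h \<phi>) = w n powr (1 / q)" for n
    unfolding FL_dist_diff[OF q b g h] w_def by (rule FL_norm_FL_dist[OF q b m fin])
  moreover have "FL_dist (g n) \<in> FL b q" "FL_dist h \<in> FL b q" for n
    using FL_iff[OF q b] g h by blast+
  ultimately have "FL_tendsto b q (\<lambda>n. FL_dist (g n)) (FL_dist h) \<longleftrightarrow> (\<lambda>n. w n powr (1 / q)) \<longlonglongrightarrow> 0"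
    by (simp add: FL_tendsto_def)
  also have "\<dots> \<longleftrightarrow> w \<longlonglongrightarrow> 0"
  proof
    assume "(\<lambda>n. w n powr (1 / q)) \<longlonglongrightarrow> 0"
    from tendsto_powr_zero[OF this, of q] show "w \<longlonglongrightarrow> 0" using q w(2) by (simp add: powr_powr)
  next
    assume "w \<longlonglongrightarrow> 0"
    from tendsto_powr_zero[OF this, of "1 / q"] show "(\<lambda>n. w n powr (1 / q)) \<longlonglongrightarrow> 0" using q w(2) by simp
  qed
  also have "\<dots> \<longleftrightarrow> (\<lambda>n. ennreal (w n)) \<longlonglongrightarrow> 0"
    using tendsto_ennreal_iff[of w sequentially 0] w(2) by simp
  finally show ?thesis unfolding w(1) .
qed

text \<open>
  For Schwartz functions the pointwise cut-off is integrable, and its Fourier transform as a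
  distribution is the classical one.
\<close>

lemma dist_of_cut_schwartz:
  assumes p: "\<phi> \<in> schwartz" and I: "I \<in> sets borel"
  shows "dist_of (cut I \<phi>) = FL_dist (fourier (cut I \<phi>))"
proof
  fix \<psi>
  have "(\<integral>x. cut I \<phi> x * \<psi> x \<partial>lborel) = (\<integral>\<tau>. fourier (cut I \<phi>) \<tau> * ifourier \<psi> \<tau> \<partial>lborel)" if \<psi>: "\<psi> \<in> schwartz"
    using fourier_swap[OF integrable_cut[OF schwartz_integrable[OF p] I] schwartz_integrable[OF schwartz_ifourier[OF \<psi>]]]
    by (simp add: fourier_ifourier[OF \<psi>])
  then show "dist_of (cut I \<phi>) \<psi> = FL_dist (fourier (cut I \<phi>)) \<psi>" by (simp add: dist_of_def FL_dist_def)
qed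

lemma dist_of_schwartz: "\<phi> \<in> schwartz \<Longrightarrow> dist_of \<phi> = FL_dist (fourier \<phi>)"
  using dist_of_cut_schwartz[of \<phi> UNIV] by (simp add: cut_def)

section \<open>Smooth cut-offs\<close>

lemma integral_DERIV_logistic:
  assumes "n > 0"
  shows "integrable lborel (\<lambda>x. n * (logistic n a x * (1 - logistic n a x)))"
    and "(\<integral>x. n * (logistic n a x * (1 - logistic n a x)) \<partial>lborel) = 1"
proof -
  let ?f = "\<lambda>x. n * (logistic n a x * (1 - logistic n a x))"
  have "isCont ?f x" for x
    using DERIV_isCont[OF DERIV_logistic[of n a x]] by (intro continuous_intros)
  moreover have "(logistic n a \<longlongrightarrow> 0) at_bot" "(logistic n a \<longlongrightarrow> 1) at_top"
    unfolding logistic_def using assms by real_asymp+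
  then have "((logistic n a \<circ> real_of_ereal) \<longlongrightarrow> 0) (at_right (- \<infinity>))" "((logistic n a \<circ> real_of_ereal) \<longlongrightarrow> 1) (at_left \<infinity>)"
    unfolding at_right_MInf at_left_PInf filterlim_filtermap o_def by simp_all
  moreover have "?f x \<ge> 0" for x using assms logistic_bounds[of n a x] by simp
  ultimately have "set_integrable lborel (einterval (-\<infinity>) \<infinity>) ?f \<and> (LBINT x=-\<infinity>..\<infinity>. ?f x) = 1 - 0"
    by (intro conjI interval_integral_FTC_nonneg[where F = "logistic n a"] DERIV_logistic AE_I2) auto
  then show "integrable lborel ?f" "(\<integral>x. ?f x \<partial>lborel) = 1"
    by (simp_all add: set_integrable_def interval_lebesgue_integral_def set_lebesgue_integral_def einterval_def)
qed

text \<open>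
  The derivative of a step has integral 1 whatever its slope, so the \<open>L^1\<close> norm of \<open>(L \<psi>)'\<close> is bounded independently
  of the step.
\<close>

lemma logistic_mult_decay:
  assumes p: "\<psi> \<in> schwartz"
  obtains D where "D \<ge> 0" "\<And>n a \<tau>. n > 0 \<Longrightarrow> (1 + \<bar>\<tau>\<bar>) * norm (ifourier (\<lambda>x. of_real (logistic n a x) * \<psi> x) \<tau>) \<le> D"
proof -
  obtain M where M: "M \<ge> 0" "\<And>x. \<bar>x\<bar> ^ 0 * norm (\<psi> x) \<le> M" using schwartz_boundE[OF p] by blast
  define A where "A = (\<integral>x. norm (\<psi> x) \<partial>lborel)"
  define B where "B = (\<integral>x. norm (vderiv \<psi> x) \<partial>lborel)"
  have AB: "A \<ge> 0" "B \<ge> 0" by (auto simp: A_def B_def)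
  show thesis
  proof (rule that[of "A + (M + B)"])
    fix n a \<tau> :: real assume n: "n > 0"
    let ?L = "logistic n a" and ?u = "\<lambda>x. of_real (logistic n a x) * \<psi> x"
    let ?d = "\<lambda>x. n * (?L x * (1 - ?L x))"
    note u = schwartz_logistic_mult[OF p, of n a]
    have i: "integrable lborel (\<lambda>x. norm (\<psi> x))" "integrable lborel (\<lambda>x. norm (vderiv \<psi> x))"
      by (intro integrable_norm schwartz_integrable schwartz_vderiv p)+
    have L: "\<bar>?L x\<bar> \<le> 1" for x using logistic_bounds[of n a x] by simp
    have "(\<integral>x. norm (?u x) \<partial>lborel) \<le> A"
      unfolding A_def
      by (intro integral_mono integrable_norm schwartz_integrable u i)
        (auto simp: norm_mult intro!: mult_left_le_one_le L)
    moreover have "(\<integral>x. norm (vderiv ?u x) \<partial>lborel) \<le> (\<integral>x. M * ?d x + norm (vderiv \<psi> x) \<partial>lborel)"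
    proof (rule integral_mono)
      show "integrable lborel (\<lambda>x. norm (vderiv ?u x))" by (intro integrable_norm schwartz_integrable schwartz_vderiv u)
      show "integrable lborel (\<lambda>x. M * ?d x + norm (vderiv \<psi> x))"
        by (intro Bochner_Integration.integrable_add integrable_mult_right integral_DERIV_logistic n i)
      fix x
      have "vderiv ?u x = of_real (?L x) * vderiv \<psi> x + of_real (?d x) * \<psi> x"
        by (rule vector_derivative_at[OF has_vector_derivative_mult[OF has_vector_derivative_of_real[OF DERIV_logistic] schwartz_has_vderiv[OF p]]])
      also have "norm \<dots> \<le> \<bar>?L x\<bar> * norm (vderiv \<psi> x) + \<bar>?d x\<bar> * norm (\<psi> x)"
        by (rule order_trans[OF norm_triangle_ineq]) (simp only: norm_mult norm_of_real order_refl)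
      also have "\<bar>?d x\<bar> = ?d x" using n logistic_bounds[of n a x] by simp
      also have "\<bar>?L x\<bar> * norm (vderiv \<psi> x) + ?d x * norm (\<psi> x) \<le> 1 * norm (vderiv \<psi> x) + ?d x * M"
        using n logistic_bounds[of n a x] M(2)[of x] by (intro add_mono mult_right_mono mult_left_mono L) auto
      finally show "norm (vderiv ?u x) \<le> M * ?d x + norm (vderiv \<psi> x)" by (simp add: mult.commute)
    qed
    moreover have "(\<integral>x. M * ?d x + norm (vderiv \<psi> x) \<partial>lborel) = M + B"
      unfolding B_def
      by (simp only: Bochner_Integration.integral_add integrable_mult_right integral_DERIV_logistic[OF n] i integral_mult_right_zero[of _ M] mult_1_right)
    ultimately show "(1 + \<bar>\<tau>\<bar>) * norm (ifourier ?u \<tau>) \<le> A + (M + B)"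
      using ifourier_decay1[OF u, of \<tau>] by linarith
  qed (use M AB in simp)
qed

text \<open>
  Replacing the half-line indicators in the decomposition of the indicator of \<open>I\<close> by logistic steps.
\<close>

lemma smooth_cut:
  assumes p: "\<psi> \<in> schwartz" and I: "is_interval I"
  obtains u :: "nat \<Rightarrow> real \<Rightarrow> complex" and D where "D \<ge> 0" "\<And>n. u n \<in> schwartz" "\<And>n x. norm (u n x) \<le> 3 * norm (\<psi> x)"
    "AE x in lborel. (\<lambda>n. u n x) \<longlonglongrightarrow> cut I \<psi> x" "\<And>n \<tau>. (1 + \<bar>\<tau>\<bar>) * norm (ifourier (u n) \<tau>) \<le> D"
proof -
  obtain a d c0 c1 c2 where c: "\<bar>c0\<bar> \<le> 1" "\<bar>c1\<bar> \<le> 1" "\<bar>c2\<bar> \<le> (1::real)"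
    and ind: "\<And>x. x \<noteq> a \<Longrightarrow> x \<noteq> d \<Longrightarrow> indicator I x = c0 + c1 * indicator {a<..} x + c2 * indicator {d<..} x"
    by (rule interval_indicator[OF I]) blast
  obtain D where D: "D \<ge> 0" "\<And>n a \<tau>. n > 0 \<Longrightarrow> (1 + \<bar>\<tau>\<bar>) * norm (ifourier (\<lambda>x. of_real (logistic n a x) * \<psi> x) \<tau>) \<le> D"
    using logistic_mult_decay[OF p] by blast
  obtain D' where D': "D' \<ge> 0" "\<And>\<tau>. (1 + \<bar>\<tau>\<bar>) * norm (ifourier \<psi> \<tau>) \<le> D'"
    using schwartz_decay1[OF schwartz_ifourier[OF p]] by blast
  let ?L = "\<lambda>n a x. complex_of_real (logistic (real (Suc n)) a x) * \<psi> x"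
  define u where "u n x = of_real c0 * \<psi> x + (of_real c1 * ?L n a x + of_real c2 * ?L n d x)" for n x
  have c3: "norm (of_real c0 * x + (of_real c1 * y + of_real c2 * z)) \<le> norm x + (norm y + norm z)" for x y z :: complex
    using c by (intro order_trans[OF norm_triangle_ineq] add_mono) (auto simp: norm_mult intro!: mult_left_le_one_le)
  have L: "?L n a \<in> schwartz" for n a by (rule schwartz_logistic_mult[OF p])
  note Li = schwartz_integrable[OF L]
  show thesis
  proof (rule that[of "D' + (D + D)" u])
    show "D' + (D + D) \<ge> 0" using D D' by simp
    show "u n \<in> schwartz" for n unfolding u_def[abs_def] by (intro schwartz_add schwartz_cmult p L)
    show "norm (u n x) \<le> 3 * norm (\<psi> x)" for n x
    proof -
      have l: "norm (?L n a x) \<le> norm (\<psi> x)" for a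
        unfolding norm_mult using norm_logistic by (intro mult_left_le_one_le) auto
      show ?thesis unfolding u_def using c3[of "\<psi> x" "?L n a x" "?L n d x"] l[of a] l[of d] by linarith
    qed
    show "AE x in lborel. (\<lambda>n. u n x) \<longlonglongrightarrow> cut I \<psi> x"
      using AE_lborel_singleton[of a] AE_lborel_singleton[of d]
    proof eventually_elim
      case (elim x)
      have "(\<lambda>n. u n x) \<longlonglongrightarrow> of_real c0 * \<psi> x + (of_real c1 * (of_real (indicator {a<..} x) * \<psi> x) + of_real c2 * (of_real (indicator {d<..} x) * \<psi> x))"
        unfolding u_def
        by (intro tendsto_intros LIMSEQ_Suc[OF logistic_tendsto_indicator] elim)
      also have "of_real c0 * \<psi> x + (of_real c1 * (of_real (indicator {a<..} x) * \<psi> x) + of_real c2 * (of_real (indicator {d<..} x) * \<psi> x)) = of_real (indicator I x) * \<psi> x"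
        unfolding ind[OF elim] of_real_add of_real_mult by (simp only: distrib_right mult.assoc add.assoc)
      also have "of_real (indicator I x) * \<psi> x = cut I \<psi> x" by (simp add: cut_def indicator_def)
      finally show ?case .
    qed
    show "(1 + \<bar>\<tau>\<bar>) * norm (ifourier (u n) \<tau>) \<le> D' + (D + D)" for n \<tau>
    proof -
      have e: "ifourier (u n) \<tau> = of_real c0 * ifourier \<psi> \<tau> + (of_real c1 * ifourier (?L n a) \<tau> + of_real c2 * ifourier (?L n d) \<tau>)"
        unfolding u_def[abs_def]
        by (simp only: ifourier_add ifourier_cmult Bochner_Integration.integrable_add integrable_mult_right Li schwartz_integrable[OF p])
      have "(1 + \<bar>\<tau>\<bar>) * norm (ifourier (u n) \<tau>) \<le> (1 + \<bar>\<tau>\<bar>) * (norm (ifourier \<psi> \<tau>) + (norm (ifourier (?L n a) \<tau>) + norm (ifourier (?L n d) \<tau>)))"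
        unfolding e by (intro mult_left_mono c3) simp
      also have "\<dots> \<le> D' + (D + D)" unfolding distrib_left by (intro add_mono D D') simp_all
      finally show ?thesis .
    qed
  qed
qed

section \<open>Extending the cut-off by completeness\<close>

text \<open>
  Even after multiplication with \<open>2^n\<close> the increments have summable norms, so at almost every point
  they are \<open>O(2^(-n))\<close>. This gives completeness of the weighted space in the form needed here.
\<close>

lemma geometric_wnorm_convergent:
  fixes U :: "nat \<Rightarrow> real \<Rightarrow> complex" and b q M :: real
  assumes q: "q > 0" and M: "M \<ge> 0" and [measurable]: "\<And>n. U n \<in> borel_measurable borel"
    and le: "\<And>n. wnorm b q (\<lambda>\<tau>. U (Suc n) \<tau> - U n \<tau>) \<le> ennreal (M * (4 powr (- q)) ^ n)"
  shows "AE \<tau> in lborel. convergent (\<lambda>n. U n \<tau>)"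
proof -
  let ?V = "\<lambda>n \<tau>. U (Suc n) \<tau> - U n \<tau>"
  let ?j = "\<lambda>\<tau>. japanese_bracket \<tau> powr b"
  let ?t = "\<lambda>n \<tau>. ennreal ((2 powr q) ^ n) * ennreal ((?j \<tau> * norm (?V n \<tau>)) powr q)"
  define r where "r = (2::real) powr (- q)"
  have r: "0 \<le> r" "r < 1" using q powr_less_mono[of "- q" 0 2] by (simp_all add: r_def)
  have rr: "(2 powr q) ^ n * (4 powr (- q)) ^ n = r ^ n" for n
  proof -
    have "(4::real) powr (- q) = (2 * 2) powr (- q)" by simp
    also have "\<dots> = 2 powr (- q) * 2 powr (- q)" by (subst powr_mult) auto
    finally have "(2::real) powr q * 4 powr (- q) = r" by (simp add: r_def powr_minus)
    then show ?thesis by (simp flip: power_mult_distrib)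
  qed
  have "(\<integral>\<^sup>+\<tau>. (\<Sum>n. ?t n \<tau>) \<partial>lborel) = (\<Sum>n. \<integral>\<^sup>+\<tau>. ?t n \<tau> \<partial>lborel)"
    by (rule nn_integral_suminf) measurable
  also have "\<dots> = (\<Sum>n. ennreal ((2 powr q) ^ n) * wnorm b q (?V n))"
    by (simp add: nn_integral_cmult wnorm_def)
  also have "\<dots> \<le> (\<Sum>n. ennreal (M * r ^ n))"
  proof (intro suminf_le summableI)
    fix n
    have "ennreal ((2 powr q) ^ n) * wnorm b q (?V n) \<le> ennreal ((2 powr q) ^ n) * ennreal (M * (4 powr (- q)) ^ n)"
      by (intro mult_left_mono le) simp
    also have "\<dots> = ennreal (M * ((2 powr q) ^ n * (4 powr (- q)) ^ n))"
      using M by (simp add: mult_ac flip: ennreal_mult)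
    finally show "ennreal ((2 powr q) ^ n) * wnorm b q (?V n) \<le> ennreal (M * r ^ n)" unfolding rr .
  qed
  also have "\<dots> < \<infinity>"
  proof -
    have "summable (\<lambda>n. M * r ^ n)" using r by (intro summable_mult summable_geometric) auto
    then show ?thesis using M r by (simp add: suminf_ennreal_eq[OF _ summable_sums] less_top)
  qed
  finally have "(\<integral>\<^sup>+\<tau>. (\<Sum>n. ?t n \<tau>) \<partial>lborel) \<noteq> \<infinity>" by simp
  then have "AE \<tau> in lborel. (\<Sum>n. ?t n \<tau>) \<noteq> \<infinity>"
    by (intro nn_integral_noteq_infinite) auto
  then show ?thesis
  proof eventually_elim
    case (elim \<tau>)
    obtain S where S: "S \<ge> 0" "(\<Sum>n. ?t n \<tau>) = ennreal S" using elim by (cases "\<Sum>n. ?t n \<tau>") auto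
    have j: "?j \<tau> > 0" using japanese_bracket_ge_1[of \<tau>] by simp
    have "norm (?V n \<tau>) \<le> S powr (1 / q) / ?j \<tau> * (1 / 2) ^ n" for n
    proof -
      have "?t n \<tau> \<le> ennreal S"
        unfolding S(2)[symmetric] using sum_le_suminf[of "\<lambda>n. ?t n \<tau>" "{n}"] by simp
      then have "(2 powr q) ^ n * (?j \<tau> * norm (?V n \<tau>)) powr q \<le> S"
        using S by (simp flip: ennreal_mult)
      moreover have "(2 powr q) ^ n = (2 ^ n) powr q"
        by (simp add: powr_powr mult.commute flip: powr_realpow)
      ultimately have "(2 ^ n * (?j \<tau> * norm (?V n \<tau>))) powr q \<le> S" by (simp add: powr_mult)
      then have "((2 ^ n * (?j \<tau> * norm (?V n \<tau>))) powr q) powr (1 / q) \<le> S powr (1 / q)"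
        using q by (intro powr_mono2) auto
      then have "2 ^ n * (?j \<tau> * norm (?V n \<tau>)) \<le> S powr (1 / q)" using q by (simp add: powr_powr)
      then show ?thesis using j by (simp add: field_simps power_one_over)
    qed
    note le = this
    have "summable (\<lambda>n. S powr (1 / q) / ?j \<tau> * (1 / 2) ^ n)"
      by (rule summable_mult, rule summable_geometric) simp
    then have "summable (\<lambda>n. norm (?V n \<tau>))"
      by (rule summable_comparison_test'[where N = 0]) (simp only: real_norm_def abs_norm_cancel le)
    then have "summable (\<lambda>n. ?V n \<tau>)" by (rule summable_norm_cancel)
    then have "(\<lambda>n. (\<Sum>k<n. ?V k \<tau>) + U 0 \<tau>) \<longlonglongrightarrow> suminf (\<lambda>n. ?V n \<tau>) + U 0 \<tau>"
      by (intro tendsto_add summable_LIMSEQ tendsto_const)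
    moreover have "(\<Sum>k<n. ?V k \<tau>) + U 0 \<tau> = U n \<tau>" for n using sum_lessThan_telescope[of "\<lambda>k. U k \<tau>" n] by simp
    ultimately show "convergent (\<lambda>n. U n \<tau>)" by (auto simp: convergent_def)
  qed
qed

lemma fourier_cut_diff:
  assumes "\<gamma> \<in> schwartz" "\<eta> \<in> schwartz" "I \<in> sets borel"
  shows "fourier (cut I (ifourier \<gamma>)) \<tau> - fourier (cut I (ifourier \<eta>)) \<tau> = fourier (cut I (ifourier (\<lambda>s. \<gamma> s - \<eta> s))) \<tau>"
proof -
  have "cut I (ifourier (\<lambda>s. \<gamma> s - \<eta> s)) = (\<lambda>x. cut I (ifourier \<gamma>) x - cut I (ifourier \<eta>) x)"
    by (auto simp: cut_def ifourier_def fourier_diff schwartz_integrable assms diff_divide_distrib right_diff_distrib)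
  then show ?thesis
    by (simp add: fourier_diff integrable_cut schwartz_integrable schwartz_ifourier assms)
qed

lemma measurable_fourier_cut:
  assumes "\<phi> \<in> schwartz" "I \<in> sets borel" shows "fourier (cut I \<phi>) \<in> borel_measurable borel"
  using borel_measurable_integrable[OF integrable_cut[OF schwartz_integrable[OF assms(1)] assms(2)]] by measurable

lemma schwartz_approx:
  assumes q: "q \<ge> 1" and g: "g \<in> borel_measurable borel" "wnorm b q g < \<infinity>" and d: "\<And>n. d n > 0"
  obtains \<gamma> where "\<And>n. \<gamma> n \<in> schwartz" "\<And>n::nat. wnorm b q (\<lambda>\<tau>. g \<tau> - \<gamma> n \<tau>) \<le> ennreal (d n)"
proof -
  have "\<forall>n. \<exists>\<gamma>. \<gamma> \<in> schwartz \<and> wnorm b q (\<lambda>\<tau>. g \<tau> - \<gamma> \<tau>) \<le> ennreal (d n)"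
    using schwartz_dense[OF g q] d unfolding approximable_def by (meson less_imp_le)
  from choice[OF this] show thesis using that by blast
qed

text \<open>
  The bound is stated for all Schwartz functions \<open>\<gamma>\<close> at once: for \<open>\<gamma> = 0\<close> it is the boundedness of the
  extension, and for \<open>\<gamma>\<close> close to \<open>g\<close> its continuity at \<open>g\<close>.
\<close>

lemma interval_cut_extension:
  fixes b q :: real
  assumes q: "1 < q" and b: "0 \<le> b" "b < 1 - 1 / q"
  obtains C where "C \<ge> 0" "\<And>I g. is_interval I \<Longrightarrow> g \<in> borel_measurable borel \<Longrightarrow> wnorm b q g < \<infinity> \<Longrightarrow>
    \<exists>G. G \<in> borel_measurable borel \<and> (\<forall>\<gamma>\<in>schwartz. wnorm b q (\<lambda>\<tau>. G \<tau> - fourier (cut I (ifourier \<gamma>)) \<tau>) \<le> ennreal C * wnorm b q (\<lambda>\<tau>. g \<tau> - \<gamma> \<tau>))"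
proof -
  obtain C where C: "C \<ge> 0" "\<And>I \<gamma>. is_interval I \<Longrightarrow> \<gamma> \<in> schwartz \<Longrightarrow> wnorm b q (fourier (cut I (ifourier \<gamma>))) \<le> ennreal C * wnorm b q \<gamma>"
    by (rule interval_cut_bound[OF q b]) blast
  show thesis
  proof (rule that)
    show "C * 2 powr q \<ge> 0" using C by simp
    fix I :: "real set" and g assume I: "is_interval I" and g [measurable]: "g \<in> borel_measurable borel" and fin: "wnorm b q g < \<infinity>"
    note Ib = real_interval_borel_measurable[OF I]
    \<comment> \<open>Errors below 4^(-qn) leave the increments summable after multiplication with 2^(qn).\<close>
    define \<delta> where "\<delta> n = (4 powr (- q)) ^ n" for n
    have \<delta>: "\<delta> n > 0" "\<delta> (Suc n) \<le> \<delta> n" for n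
    proof -
      have "(4::real) powr (- q) \<le> 4 powr 0" using q by (intro powr_mono) auto
      then show "\<delta> n > 0" "\<delta> (Suc n) \<le> \<delta> n" by (auto simp: \<delta>_def intro!: mult_left_le_one_le)
    qed
    have "(\<lambda>n. \<delta> n) \<longlonglongrightarrow> 0"
      unfolding \<delta>_def using q powr_less_mono[of "- q" 0 4] by (intro LIMSEQ_realpow_zero) simp_all
    then have \<delta>0: "(\<lambda>n. ennreal (\<delta> n)) \<longlonglongrightarrow> 0" using tendsto_ennrealI by fastforce
    obtain \<gamma> where \<gamma>: "\<And>n. \<gamma> n \<in> schwartz" "\<And>n. wnorm b q (\<lambda>\<tau>. g \<tau> - \<gamma> n \<tau>) \<le> ennreal (\<delta> n)"
      by (rule schwartz_approx[of q g b \<delta>, OF less_imp_le[OF q] g fin \<delta>(1)]) (rule that)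
    let ?T = "\<lambda>\<gamma>. fourier (cut I (ifourier \<gamma>))"
    have mT [measurable]: "?T \<eta> \<in> borel_measurable borel" if "\<eta> \<in> schwartz" for \<eta>
      by (intro measurable_fourier_cut schwartz_ifourier that Ib)
    note m\<gamma> [measurable] = schwartz_measurable[OF \<gamma>(1)]
    have T: "wnorm b q (\<lambda>\<tau>. ?T (\<gamma> n) \<tau> - ?T \<eta> \<tau>) \<le> ennreal (C * 2 powr q) * (ennreal (\<delta> n) + wnorm b q (\<lambda>\<tau>. g \<tau> - \<eta> \<tau>))"
      if \<eta>: "\<eta> \<in> schwartz" for n \<eta>
    proof -
      note [measurable] = schwartz_measurable[OF \<eta>]
      have "wnorm b q (\<lambda>\<tau>. ?T (\<gamma> n) \<tau> - ?T \<eta> \<tau>) \<le> ennreal C * wnorm b q (\<lambda>\<tau>. \<gamma> n \<tau> - \<eta> \<tau>)"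
        unfolding fourier_cut_diff[OF \<gamma>(1) \<eta> Ib] by (intro C I schwartz_diff \<gamma> \<eta>)
      also have "wnorm b q (\<lambda>\<tau>. \<gamma> n \<tau> - \<eta> \<tau>) \<le> ennreal (2 powr q) * (wnorm b q (\<lambda>\<tau>. \<gamma> n \<tau> - g \<tau>) + wnorm b q (\<lambda>\<tau>. g \<tau> - \<eta> \<tau>))"
        using q by (intro wnorm_triangle) auto
      also have "\<dots> \<le> ennreal (2 powr q) * (ennreal (\<delta> n) + wnorm b q (\<lambda>\<tau>. g \<tau> - \<eta> \<tau>))"
        using \<gamma>(2)[of n] by (intro mult_left_mono add_mono) (simp_all add: wnorm_minus_commute[of b q "\<gamma> n"])
      finally show ?thesis using C(1) by (simp add: ennreal_mult mult.assoc mult_left_mono)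
    qed
    have step: "wnorm b q (\<lambda>\<tau>. ?T (\<gamma> (Suc n)) \<tau> - ?T (\<gamma> n) \<tau>) \<le> ennreal ((C * 2 powr q * 2) * (4 powr (- q)) ^ n)" for n
    proof -
      have "wnorm b q (\<lambda>\<tau>. ?T (\<gamma> (Suc n)) \<tau> - ?T (\<gamma> n) \<tau>) \<le> ennreal (C * 2 powr q) * (ennreal (\<delta> (Suc n)) + wnorm b q (\<lambda>\<tau>. g \<tau> - \<gamma> n \<tau>))"
        by (rule T[OF \<gamma>(1)])
      also have "\<dots> \<le> ennreal (C * 2 powr q) * (ennreal (\<delta> n) + ennreal (\<delta> n))"
        by (intro mult_left_mono add_mono \<gamma> ennreal_leI \<delta>) simp
      also have "\<dots> = ennreal (C * 2 powr q * (\<delta> n + \<delta> n))"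
      proof -
        have "ennreal (\<delta> n) + ennreal (\<delta> n) = ennreal (\<delta> n + \<delta> n)"
          using \<delta>(1)[of n] by (intro ennreal_plus[symmetric]) auto
        then show ?thesis using C(1) \<delta>(1)[of n] by (simp only:) (intro ennreal_mult[symmetric]; simp)
      qed
      finally show ?thesis by (simp add: \<delta>_def mult.assoc)
    qed
    have conv: "AE \<tau> in lborel. convergent (\<lambda>n. ?T (\<gamma> n) \<tau>)"
      by (rule geometric_wnorm_convergent[OF _ _ _ step]) (use q C \<gamma> mT in auto)
    define G where "G \<tau> = lim (\<lambda>n. ?T (\<gamma> n) \<tau>)" for \<tau>
    have [measurable]: "?T (\<gamma> n) \<in> borel_measurable borel" for n by (intro mT \<gamma>)
    have mG: "G \<in> borel_measurable borel" unfolding G_def[abs_def] by measurable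
    have lim: "AE \<tau> in lborel. (\<lambda>n. ?T (\<gamma> n) \<tau>) \<longlonglongrightarrow> G \<tau>"
      using conv by eventually_elim (simp add: G_def convergent_LIMSEQ_iff)
    show "\<exists>G. G \<in> borel_measurable borel \<and> (\<forall>\<eta>\<in>schwartz. wnorm b q (\<lambda>\<tau>. G \<tau> - ?T \<eta> \<tau>) \<le> ennreal (C * 2 powr q) * wnorm b q (\<lambda>\<tau>. g \<tau> - \<eta> \<tau>))"
    proof (intro exI[of _ G] conjI mG ballI)
      fix \<eta> assume \<eta>: "\<eta> \<in> schwartz"
      note [measurable] = mT[OF \<eta>]
      show "wnorm b q (\<lambda>\<tau>. G \<tau> - ?T \<eta> \<tau>) \<le> ennreal (C * 2 powr q) * wnorm b q (\<lambda>\<tau>. g \<tau> - \<eta> \<tau>)"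
      proof (rule wnorm_tendsto_le[OF _ _ T[OF \<eta>]])
        show "AE \<tau> in lborel. (\<lambda>n. ?T (\<gamma> n) \<tau> - ?T \<eta> \<tau>) \<longlonglongrightarrow> G \<tau> - ?T \<eta> \<tau>"
          using lim by eventually_elim (intro tendsto_intros)
        have "(\<lambda>n. ennreal (C * 2 powr q) * (ennreal (\<delta> n) + wnorm b q (\<lambda>\<tau>. g \<tau> - \<eta> \<tau>))) \<longlonglongrightarrow> ennreal (C * 2 powr q) * (0 + wnorm b q (\<lambda>\<tau>. g \<tau> - \<eta> \<tau>))"
          by (intro ennreal_tendsto_cmult tendsto_add \<delta>0 tendsto_const) simp
        then show "(\<lambda>n. ennreal (C * 2 powr q) * (ennreal (\<delta> n) + wnorm b q (\<lambda>\<tau>. g \<tau> - \<eta> \<tau>))) \<longlonglongrightarrow> ennreal (C * 2 powr q) * wnorm b q (\<lambda>\<tau>. g \<tau> - \<eta> \<tau>)"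
          by simp
      qed (use q in auto)
    qed
  qed
qed

section \<open>Identification of the cut-off with the extension\<close>

text \<open>
  Uniform decay of the approximants survives in the limit.
\<close>

lemma ifourier_cut_decay:
  assumes p: "\<psi> \<in> schwartz" and u: "\<And>n::nat. u n \<in> schwartz" "\<And>n x. norm (u n x) \<le> 3 * norm (\<psi> x)"
    "AE x in lborel. (\<lambda>n. u n x) \<longlonglongrightarrow> cut I \<psi> x" "\<And>n \<tau>. (1 + \<bar>\<tau>\<bar>) * norm (ifourier (u n) \<tau>) \<le> D" and I: "I \<in> sets borel"
  shows "(\<lambda>n. ifourier (u n) \<tau>) \<longlonglongrightarrow> ifourier (cut I \<psi>) \<tau>"
    and "(1 + \<bar>\<tau>\<bar>) * norm (ifourier (cut I \<psi>) \<tau>) \<le> D"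
proof -
  note [measurable] = schwartz_measurable[OF p] schwartz_measurable[OF u(1)] I
  have "(\<lambda>n. fourier (u n) (- \<tau>)) \<longlonglongrightarrow> fourier (cut I \<psi>) (- \<tau>)"
    unfolding fourier_def
  proof (rule integral_dominated_convergence[where w = "\<lambda>x. 3 * norm (\<psi> x)"])
    show "AE x in lborel. (\<lambda>n. cis (- (- \<tau> * x)) * u n x) \<longlonglongrightarrow> cis (- (- \<tau> * x)) * cut I \<psi> x"
      using u(3) by eventually_elim (intro tendsto_intros)
    show "AE x in lborel. norm (cis (- (- \<tau> * x)) * u n x) \<le> 3 * norm (\<psi> x)" for n
      using u(2) by (simp add: norm_mult)
    show "integrable lborel (\<lambda>x. 3 * norm (\<psi> x))" by (intro integrable_mult_right integrable_norm schwartz_integrable p)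
    show "(\<lambda>x. cis (- (- \<tau> * x)) * cut I \<psi> x) \<in> borel_measurable lborel" unfolding cut_def by measurable
  qed measurable
  then show lim: "(\<lambda>n. ifourier (u n) \<tau>) \<longlonglongrightarrow> ifourier (cut I \<psi>) \<tau>"
    unfolding ifourier_def by (intro tendsto_divide tendsto_const) simp_all
  have "(\<lambda>n. (1 + \<bar>\<tau>\<bar>) * norm (ifourier (u n) \<tau>)) \<longlonglongrightarrow> (1 + \<bar>\<tau>\<bar>) * norm (ifourier (cut I \<psi>) \<tau>)"
    by (intro tendsto_intros lim)
  then show "(1 + \<bar>\<tau>\<bar>) * norm (ifourier (cut I \<psi>) \<tau>) \<le> D"
    by (rule LIMSEQ_le_const2) (use u(4) in auto)
qed

text \<open>
  On the smooth approximants \<open>u n\<close> of \<open>1_I \<psi>\<close> both sides are the value of the distribution at \<open>u n\<close>. The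
  left side converges since \<open>F \<psi>\<close> is integrable, the right side since the transforms of the approximants are uniformly \<open>O(1/|\<tau>|)\<close>.
\<close>

lemma function_cut_pairing:
  fixes b q :: real
  assumes q: "1 < q" and b: "0 \<le> b" and m [measurable]: "g \<in> borel_measurable borel" and fin: "wnorm b q g < \<infinity>"
    and F: "is_function (FL_dist g) F" and I: "is_interval I" and p: "\<psi> \<in> schwartz"
  shows "(\<integral>x. cut I F x * \<psi> x \<partial>lborel) = (\<integral>\<tau>. g \<tau> * ifourier (cut I \<psi>) \<tau> \<partial>lborel)"
proof -
  obtain u :: "nat \<Rightarrow> real \<Rightarrow> complex" and D where D: "D \<ge> 0" and u: "\<And>n. u n \<in> schwartz" "\<And>n x. norm (u n x) \<le> 3 * norm (\<psi> x)"
    "AE x in lborel. (\<lambda>n. u n x) \<longlonglongrightarrow> cut I \<psi> x" "\<And>n \<tau>. (1 + \<bar>\<tau>\<bar>) * norm (ifourier (u n) \<tau>) \<le> D"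
    by (rule smooth_cut[OF p I]) blast
  note Ib = real_interval_borel_measurable[OF I]
  have mF: "F \<in> borel_measurable borel" and iF: "\<And>\<phi>. \<phi> \<in> schwartz \<Longrightarrow> integrable lborel (\<lambda>x. F x * \<phi> x)" and eF: "FL_dist g = dist_of F"
    using F by (auto simp: is_function_def)
  note [measurable] = mF Ib schwartz_measurable[OF p] schwartz_measurable[OF u(1)]
  have eq: "(\<integral>x. F x * u n x \<partial>lborel) = (\<integral>\<tau>. g \<tau> * ifourier (u n) \<tau> \<partial>lborel)" for n
    using fun_cong[OF eF, of "u n"] u(1) by (simp add: FL_dist_def dist_of_def)
  have "(\<lambda>n. \<integral>x. F x * u n x \<partial>lborel) \<longlonglongrightarrow> (\<integral>x. F x * cut I \<psi> x \<partial>lborel)"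
  proof (rule integral_dominated_convergence[where w = "\<lambda>x. 3 * norm (F x * \<psi> x)"])
    show "integrable lborel (\<lambda>x. 3 * norm (F x * \<psi> x))" by (intro integrable_mult_right integrable_norm iF p)
    show "AE x in lborel. (\<lambda>n. F x * u n x) \<longlonglongrightarrow> F x * cut I \<psi> x"
      using u(3) by eventually_elim (intro tendsto_intros)
    show "AE x in lborel. norm (F x * u n x) \<le> 3 * norm (F x * \<psi> x)" for n
    proof (rule AE_I2)
      fix x
      show "norm (F x * u n x) \<le> 3 * norm (F x * \<psi> x)"
        using mult_left_mono[OF u(2)[of n x], of "norm (F x)"] by (simp add: norm_mult mult_ac)
    qed
    show "(\<lambda>x. F x * cut I \<psi> x) \<in> borel_measurable lborel" unfolding cut_def by measurable
  qed measurable
  moreover have "(\<lambda>n. \<integral>\<tau>. g \<tau> * ifourier (u n) \<tau> \<partial>lborel) \<longlonglongrightarrow> (\<integral>\<tau>. g \<tau> * ifourier (cut I \<psi>) \<tau> \<partial>lborel)"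
  proof (rule integral_dominated_convergence[where w = "\<lambda>\<tau>. norm (g \<tau> * of_real (D / (1 + \<bar>\<tau>\<bar>)))"])
    show "integrable lborel (\<lambda>\<tau>. norm (g \<tau> * of_real (D / (1 + \<bar>\<tau>\<bar>))))"
    proof (rule integrable_norm, rule pairing_integrable[OF q b m _ fin])
      show "(\<lambda>\<tau>. complex_of_real (D / (1 + \<bar>\<tau>\<bar>))) \<in> borel_measurable borel" by measurable
      show "(1 + \<bar>\<tau>\<bar>) * norm (complex_of_real (D / (1 + \<bar>\<tau>\<bar>))) \<le> D" for \<tau>
        unfolding norm_of_real using D by simp
    qed
    show "AE \<tau> in lborel. (\<lambda>n. g \<tau> * ifourier (u n) \<tau>) \<longlonglongrightarrow> g \<tau> * ifourier (cut I \<psi>) \<tau>"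
      by (intro AE_I2 tendsto_intros ifourier_cut_decay[OF p u Ib])
    show "AE \<tau> in lborel. norm (g \<tau> * ifourier (u n) \<tau>) \<le> norm (g \<tau> * of_real (D / (1 + \<bar>\<tau>\<bar>)))" for n
    proof (rule AE_I2)
      fix \<tau>
      have "norm (ifourier (u n) \<tau>) \<le> D / (1 + \<bar>\<tau>\<bar>)" using u(4)[of \<tau> n] by (simp add: pos_le_divide_eq mult.commute)
      then show "norm (g \<tau> * ifourier (u n) \<tau>) \<le> norm (g \<tau> * of_real (D / (1 + \<bar>\<tau>\<bar>)))"
        unfolding norm_mult norm_of_real using D by (intro mult_left_mono) auto
    qed
    show "(\<lambda>\<tau>. g \<tau> * ifourier (cut I \<psi>) \<tau>) \<in> borel_measurable lborel" unfolding cut_def by measurable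
  qed measurable
  ultimately have "(\<integral>x. F x * cut I \<psi> x \<partial>lborel) = (\<integral>\<tau>. g \<tau> * ifourier (cut I \<psi>) \<tau> \<partial>lborel)"
    unfolding eq by (rule LIMSEQ_unique)
  then show ?thesis by (simp add: cut_def mult_ac)
qed

text \<open>
  For Schwartz functions in place of \<open>g\<close> the multiplication formula moves the cut-off to \<open>\<psi>\<close>, and both sides are
  continuous in \<open>g\<close>.
\<close>

lemma extension_pairing:
  fixes b q :: real
  assumes q: "1 < q" and b: "0 \<le> b" and m: "g \<in> borel_measurable borel" "G \<in> borel_measurable borel"
    and fin: "wnorm b q g < \<infinity>" "wnorm b q G < \<infinity>"
    and G: "\<And>\<gamma>. \<gamma> \<in> schwartz \<Longrightarrow> wnorm b q (\<lambda>\<tau>. G \<tau> - fourier (cut I (ifourier \<gamma>)) \<tau>) \<le> ennreal C * wnorm b q (\<lambda>\<tau>. g \<tau> - \<gamma> \<tau>)"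
    and C: "C \<ge> 0" and I: "is_interval I" and p: "\<psi> \<in> schwartz"
  shows "(\<integral>\<tau>. G \<tau> * ifourier \<psi> \<tau> \<partial>lborel) = (\<integral>\<tau>. g \<tau> * ifourier (cut I \<psi>) \<tau> \<partial>lborel)"
proof -
  note Ib = real_interval_borel_measurable[OF I]
  obtain u :: "nat \<Rightarrow> real \<Rightarrow> complex" and D where D: "D \<ge> 0" and u: "\<And>n. u n \<in> schwartz" "\<And>n x. norm (u n x) \<le> 3 * norm (\<psi> x)"
    "AE x in lborel. (\<lambda>n. u n x) \<longlonglongrightarrow> cut I \<psi> x" "\<And>n \<tau>. (1 + \<bar>\<tau>\<bar>) * norm (ifourier (u n) \<tau>) \<le> D"
    by (rule smooth_cut[OF p I]) blast
  note cD = ifourier_cut_decay(2)[OF p u Ib]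
  obtain D' where D': "D' \<ge> 0" "\<And>\<tau>. (1 + \<bar>\<tau>\<bar>) * norm (ifourier \<psi> \<tau>) \<le> D'"
    using schwartz_decay1[OF schwartz_ifourier[OF p]] by blast
  define K where "K = pairing_const q"
  have K: "K \<ge> 0" by (simp add: K_def pairing_const_nonneg)
  let ?e = "\<lambda>n. 1 / real (Suc n)"
  have e0: "?e n > 0" for n by simp
  obtain \<gamma> where \<gamma>: "\<And>n. \<gamma> n \<in> schwartz" "\<And>n. wnorm b q (\<lambda>\<tau>. g \<tau> - \<gamma> n \<tau>) \<le> ennreal (?e n)"
    by (rule schwartz_approx[of q g b ?e, OF less_imp_le[OF q] m(1) fin(1) e0]) (rule that)
  let ?T = "\<lambda>n. fourier (cut I (ifourier (\<gamma> n)))"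
  have m\<gamma>: "\<gamma> n \<in> borel_measurable borel" "?T n \<in> borel_measurable borel" for n
    by (intro schwartz_measurable \<gamma> measurable_fourier_cut schwartz_ifourier Ib)+
  have [measurable]: "cut I \<psi> \<in> borel_measurable borel"
    using borel_measurable_integrable[OF integrable_cut[OF schwartz_integrable[OF p] Ib]] by simp
  have mc: "ifourier (cut I \<psi>) \<in> borel_measurable borel" "ifourier \<psi> \<in> borel_measurable borel"
    using schwartz_measurable[OF schwartz_ifourier[OF p]] by measurable
  \<comment> \<open>Convergence at a rate in the weighted norm gives convergence of the pairings.\<close>
  have general: "(\<lambda>n. \<integral>\<tau>. h n \<tau> * \<phi> \<tau> \<partial>lborel) \<longlonglongrightarrow> (\<integral>\<tau>. H \<tau> * \<phi> \<tau> \<partial>lborel)"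
    if mh: "\<And>n. h n \<in> borel_measurable borel" "H \<in> borel_measurable borel" "\<phi> \<in> borel_measurable borel"
      and fh: "wnorm b q H < \<infinity>" and w: "\<And>n. wnorm b q (\<lambda>\<tau>. H \<tau> - h n \<tau>) \<le> ennreal (B * ?e n)" and B: "B \<ge> 0"
      and \<phi>: "E \<ge> 0" "\<And>\<tau>. (1 + \<bar>\<tau>\<bar>) * norm (\<phi> \<tau>) \<le> E" for h H \<phi> B E
  proof (rule Lim_null[THEN iffD2], rule Lim_null_comparison)
    have diff: "norm ((\<integral>\<tau>. h n \<tau> * \<phi> \<tau> \<partial>lborel) - (\<integral>\<tau>. H \<tau> * \<phi> \<tau> \<partial>lborel)) \<le> K * E * (B * ?e n) powr (1 / q)" for n
    proof -
      have md: "(\<lambda>\<tau>. H \<tau> - h n \<tau>) \<in> borel_measurable borel" using mh by (intro borel_measurable_diff)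
      have fd: "wnorm b q (\<lambda>\<tau>. H \<tau> - h n \<tau>) < \<infinity>" using w[of n] by (rule le_less_trans) simp
      have iH: "integrable lborel (\<lambda>\<tau>. H \<tau> * \<phi> \<tau>)" and id: "integrable lborel (\<lambda>\<tau>. (H \<tau> - h n \<tau>) * \<phi> \<tau>)"
        using pairing_integrable[OF q b mh(2,3) fh \<phi>(2)] pairing_integrable[OF q b md mh(3) fd \<phi>(2)] by auto
      have "integrable lborel (\<lambda>\<tau>. H \<tau> * \<phi> \<tau> - (H \<tau> - h n \<tau>) * \<phi> \<tau>)" by (intro Bochner_Integration.integrable_diff iH id)
      then have ih: "integrable lborel (\<lambda>\<tau>. h n \<tau> * \<phi> \<tau>)" by (simp add: left_diff_distrib)
      have "norm ((\<integral>\<tau>. h n \<tau> * \<phi> \<tau> \<partial>lborel) - (\<integral>\<tau>. H \<tau> * \<phi> \<tau> \<partial>lborel)) = norm (\<integral>\<tau>. (H \<tau> - h n \<tau>) * \<phi> \<tau> \<partial>lborel)"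
        by (simp add: left_diff_distrib Bochner_Integration.integral_diff[OF iH ih] norm_minus_commute)
      also have "ennreal \<dots> \<le> (\<integral>\<^sup>+\<tau>. ennreal (norm ((H \<tau> - h n \<tau>) * \<phi> \<tau>)) \<partial>lborel)" by (rule integral_norm_bound_ennreal[OF id])
      also have "\<dots> \<le> ennreal (K * E * enn2real (wnorm b q (\<lambda>\<tau>. H \<tau> - h n \<tau>)) powr (1 / q))"
        unfolding K_def by (intro pairing_bound q b md mh fd \<phi>)
      finally have "norm ((\<integral>\<tau>. h n \<tau> * \<phi> \<tau> \<partial>lborel) - (\<integral>\<tau>. H \<tau> * \<phi> \<tau> \<partial>lborel)) \<le> K * E * enn2real (wnorm b q (\<lambda>\<tau>. H \<tau> - h n \<tau>)) powr (1 / q)"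
        using K \<phi>(1) by (subst (asm) ennreal_le_iff) auto
      also have "\<dots> \<le> K * E * (B * ?e n) powr (1 / q)"
        using K \<phi>(1) q B by (intro mult_left_mono powr_mono2 enn2real_leI w) auto
      finally show ?thesis .
    qed
    then show "\<forall>\<^sub>F n in sequentially. norm ((\<integral>\<tau>. h n \<tau> * \<phi> \<tau> \<partial>lborel) - (\<integral>\<tau>. H \<tau> * \<phi> \<tau> \<partial>lborel)) \<le> K * E * (B * ?e n) powr (1 / q)"
      by (intro always_eventually allI)
    have "(\<lambda>n. B * ?e n) \<longlonglongrightarrow> B * 0"
      by (intro tendsto_mult tendsto_const LIMSEQ_inverse_real_of_nat[unfolded inverse_eq_divide])
    then have "(\<lambda>n. \<bar>B * ?e n\<bar> powr (1 / q)) \<longlonglongrightarrow> 0"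
      using q by (intro tendsto_powr_zero) auto
    then have "(\<lambda>n. (B * ?e n) powr (1 / q)) \<longlonglongrightarrow> 0" using B by (simp add: abs_mult)
    from tendsto_mult_left[OF this, of "K * E"] show "(\<lambda>n. K * E * (B * ?e n) powr (1 / q)) \<longlonglongrightarrow> 0" by simp
  qed
  have "(\<lambda>n. \<integral>\<tau>. \<gamma> n \<tau> * ifourier (cut I \<psi>) \<tau> \<partial>lborel) \<longlonglongrightarrow> (\<integral>\<tau>. g \<tau> * ifourier (cut I \<psi>) \<tau> \<partial>lborel)"
    by (rule general[OF m\<gamma>(1) m(1) mc(1) fin(1) _ zero_le_one D cD]) (use \<gamma>(2) in simp)
  moreover have "(\<lambda>n. \<integral>\<tau>. ?T n \<tau> * ifourier \<psi> \<tau> \<partial>lborel) \<longlonglongrightarrow> (\<integral>\<tau>. G \<tau> * ifourier \<psi> \<tau> \<partial>lborel)"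
  proof (rule general[OF m\<gamma>(2) m(2) mc(2) fin(2) _ C D'])
    fix n
    have "wnorm b q (\<lambda>\<tau>. G \<tau> - ?T n \<tau>) \<le> ennreal C * wnorm b q (\<lambda>\<tau>. g \<tau> - \<gamma> n \<tau>)" by (rule G[OF \<gamma>(1)])
    also have "\<dots> \<le> ennreal C * ennreal (?e n)" by (intro mult_left_mono \<gamma>) simp
    also have "\<dots> = ennreal (C * ?e n)" using C by (intro ennreal_mult[symmetric]) auto
    finally show "wnorm b q (\<lambda>\<tau>. G \<tau> - ?T n \<tau>) \<le> ennreal (C * ?e n)" .
  qed
  moreover have "(\<integral>\<tau>. ?T n \<tau> * ifourier \<psi> \<tau> \<partial>lborel) = (\<integral>\<tau>. \<gamma> n \<tau> * ifourier (cut I \<psi>) \<tau> \<partial>lborel)" for n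
  proof -
    have "(\<integral>\<tau>. ?T n \<tau> * ifourier \<psi> \<tau> \<partial>lborel) = (\<integral>x. cut I (ifourier (\<gamma> n)) x * fourier (ifourier \<psi>) x \<partial>lborel)"
      by (intro fourier_swap integrable_cut schwartz_integrable schwartz_ifourier \<gamma> p Ib)
    also have "\<dots> = (\<integral>x. ifourier (\<gamma> n) x * cut I \<psi> x \<partial>lborel)"
      by (simp add: fourier_ifourier[OF p] cut_def mult_ac)
    also have "\<dots> = (\<integral>\<tau>. \<gamma> n \<tau> * ifourier (cut I \<psi>) \<tau> \<partial>lborel)"
      by (intro ifourier_swap integrable_cut schwartz_integrable \<gamma> p Ib)
    finally show ?thesis .
  qed
  ultimately show ?thesis using LIMSEQ_unique by simp
qed

text \<open>
  If \<open>f\<close> is a function, its pointwise cut-off and the extension have the same pairings. Otherwise the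
  extension has the property that defines the cut-off, and it is the only one: some sequence of
  Schwartz functions converges to \<open>f\<close>, and limits in the space are unique.
\<close>

lemma cutoff_eq_FL_dist:
  fixes b q :: real
  assumes q: "1 < q" and b: "0 \<le> b" and m: "g \<in> borel_measurable borel" "G \<in> borel_measurable borel"
    and fin: "wnorm b q g < \<infinity>" "wnorm b q G < \<infinity>"
    and G: "\<And>\<gamma>. \<gamma> \<in> schwartz \<Longrightarrow> wnorm b q (\<lambda>\<tau>. G \<tau> - fourier (cut I (ifourier \<gamma>)) \<tau>) \<le> ennreal C * wnorm b q (\<lambda>\<tau>. g \<tau> - \<gamma> \<tau>)"
    and C: "C \<ge> 0" and I: "is_interval I"
  shows "cutoff b q I (FL_dist g) = FL_dist G"
proof (cases "\<exists>F. is_function (FL_dist g) F")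
  case True
  define F where "F = (SOME F. is_function (FL_dist g) F)"
  have F: "is_function (FL_dist g) F" unfolding F_def using someI_ex[OF True] .
  have "dist_of (cut I F) \<psi> = FL_dist G \<psi>" for \<psi>
    using function_cut_pairing[OF q b m(1) fin(1) F I, of \<psi>] extension_pairing[OF q b m fin G C I, of \<psi>]
    by (simp add: dist_of_def FL_dist_def)
  then show ?thesis using True by (auto simp: cutoff_def F_def)
next
  case False
  note Ib = real_interval_borel_measurable[OF I]
  let ?T = "\<lambda>\<gamma>. fourier (cut I (ifourier \<gamma>))"
  let ?P = "\<lambda>h. h \<in> FL b q \<and> (\<forall>\<phi>. (\<forall>n. \<phi> n \<in> schwartz) \<longrightarrow> FL_tendsto b q (\<lambda>n. dist_of (\<phi> n)) (FL_dist g) \<longrightarrow>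
      FL_tendsto b q (\<lambda>n. dist_of (cut I (\<phi> n))) h)"
  have mT: "?T \<gamma> \<in> borel_measurable borel" if "\<gamma> \<in> schwartz" for \<gamma>
    by (intro measurable_fourier_cut schwartz_ifourier that Ib)
  have finT: "wnorm b q (?T \<gamma>) < \<infinity>" if \<gamma>: "\<gamma> \<in> schwartz" for \<gamma>
  proof -
    have md: "(\<lambda>\<tau>. G \<tau> - ?T \<gamma> \<tau>) \<in> borel_measurable borel" by (intro borel_measurable_diff m mT \<gamma>)
    have "wnorm b q (\<lambda>\<tau>. g \<tau> - \<gamma> \<tau>) < \<infinity>"
      by (intro wnorm_diff_finite m fin wnorm_schwartz schwartz_measurable \<gamma>) (use q in auto)
    then have "ennreal C * wnorm b q (\<lambda>\<tau>. g \<tau> - \<gamma> \<tau>) < \<infinity>" by (simp add: ennreal_mult_less_top)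
    then have "wnorm b q (\<lambda>\<tau>. G \<tau> - ?T \<gamma> \<tau>) < \<infinity>" using G[OF \<gamma>] by (rule le_less_trans[rotated])
    then have "wnorm b q (\<lambda>\<tau>. G \<tau> - (G \<tau> - ?T \<gamma> \<tau>)) < \<infinity>"
      using q by (intro wnorm_diff_finite[OF _ m(2) md fin(2)]) auto
    then show ?thesis by simp
  qed
  have tendsto_T: "(\<lambda>n. wnorm b q (\<lambda>\<tau>. ?T (\<gamma> n) \<tau> - G \<tau>)) \<longlonglongrightarrow> 0"
    if \<gamma>: "\<And>n. \<gamma> n \<in> schwartz" and lim: "(\<lambda>n. wnorm b q (\<lambda>\<tau>. \<gamma> n \<tau> - g \<tau>)) \<longlonglongrightarrow> 0" for \<gamma> :: "nat \<Rightarrow> real \<Rightarrow> complex"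
  proof (rule tendsto_sandwich[OF _ _ tendsto_const])
    show "\<forall>\<^sub>F n in sequentially. wnorm b q (\<lambda>\<tau>. ?T (\<gamma> n) \<tau> - G \<tau>) \<le> ennreal C * wnorm b q (\<lambda>\<tau>. \<gamma> n \<tau> - g \<tau>)"
      using G[OF \<gamma>] by (intro always_eventually allI) (simp add: wnorm_minus_commute[of b q "?T _"] wnorm_minus_commute[of b q "\<gamma> _"])
    show "(\<lambda>n. ennreal C * wnorm b q (\<lambda>\<tau>. \<gamma> n \<tau> - g \<tau>)) \<longlonglongrightarrow> 0"
      using ennreal_tendsto_cmult[OF _ lim, of "ennreal C"] by simp
  qed simp
  have exists: "?P (FL_dist G)"
  proof (intro conjI allI impI)
    show "FL_dist G \<in> FL b q" using FL_iff[OF q b] m fin by blast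
    fix \<phi> :: "nat \<Rightarrow> real \<Rightarrow> complex"
    assume "\<forall>n. \<phi> n \<in> schwartz" and t: "FL_tendsto b q (\<lambda>n. dist_of (\<phi> n)) (FL_dist g)"
    then have \<phi>: "\<phi> n \<in> schwartz" for n by blast
    note f = schwartz_fourier[OF \<phi>]
    have T: "fourier (cut I (\<phi> n)) = ?T (fourier (\<phi> n))" for n by (simp add: fourier_inversion[OF \<phi>])
    have "(\<lambda>n. wnorm b q (\<lambda>\<tau>. fourier (\<phi> n) \<tau> - g \<tau>)) \<longlonglongrightarrow> 0"
      using t unfolding dist_of_schwartz[OF \<phi>]
      by (subst (asm) FL_tendsto_iff[OF q b schwartz_measurable[OF f] wnorm_schwartz[OF f less_imp_le[OF q]] m(1) fin(1)])
    then show "FL_tendsto b q (\<lambda>n. dist_of (cut I (\<phi> n))) (FL_dist G)"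
      unfolding dist_of_cut_schwartz[OF \<phi> Ib] T
      by (subst FL_tendsto_iff[OF q b mT[OF f] finT[OF f] m(2) fin(2)]) (rule tendsto_T[OF f])
  qed
  have unique: "h = FL_dist G" if h: "?P h" for h
  proof -
    obtain H where H: "H \<in> borel_measurable borel" "wnorm b q H < \<infinity>" "h = FL_dist H" using h FL_iff[OF q b] by blast
    let ?e = "\<lambda>n. 1 / real (Suc n)"
    have e0: "?e n > 0" for n by simp
    obtain \<gamma> where \<gamma>: "\<And>n. \<gamma> n \<in> schwartz" "\<And>n. wnorm b q (\<lambda>\<tau>. g \<tau> - \<gamma> n \<tau>) \<le> ennreal (?e n)"
      by (rule schwartz_approx[of q g b ?e, OF less_imp_le[OF q] m(1) fin(1) e0]) (rule that)
    note i = schwartz_ifourier[OF \<gamma>(1)]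
    have elim: "(\<lambda>n. ennreal (?e n)) \<longlonglongrightarrow> ennreal 0"
      by (intro tendsto_ennrealI LIMSEQ_inverse_real_of_nat[unfolded inverse_eq_divide])
    have lim: "(\<lambda>n. wnorm b q (\<lambda>\<tau>. \<gamma> n \<tau> - g \<tau>)) \<longlonglongrightarrow> 0"
    proof (rule tendsto_sandwich[OF _ _ tendsto_const])
      show "\<forall>\<^sub>F n in sequentially. wnorm b q (\<lambda>\<tau>. \<gamma> n \<tau> - g \<tau>) \<le> ennreal (?e n)"
        unfolding wnorm_minus_commute[of b q "\<gamma> _"] by (intro always_eventually allI \<gamma>(2))
      show "(\<lambda>n. ennreal (?e n)) \<longlonglongrightarrow> 0" using elim by (simp only: ennreal_0)
    qed simp
    have t: "FL_tendsto b q (\<lambda>n. dist_of (ifourier (\<gamma> n))) (FL_dist g)"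
      unfolding dist_of_schwartz[OF i] fourier_ifourier[OF \<gamma>(1)]
      by (subst FL_tendsto_iff[OF q b schwartz_measurable[OF \<gamma>(1)] wnorm_schwartz[OF \<gamma>(1) less_imp_le[OF q]] m(1) fin(1)]) (rule lim)
    have "FL_tendsto b q (\<lambda>n. dist_of (cut I (ifourier (\<gamma> n)))) (FL_dist H)"
      using conjunct2[OF h, rule_format, of "\<lambda>n. ifourier (\<gamma> n)", OF i t] unfolding H(3) .
    then have limH: "(\<lambda>n. wnorm b q (\<lambda>\<tau>. ?T (\<gamma> n) \<tau> - H \<tau>)) \<longlonglongrightarrow> 0"
      unfolding dist_of_cut_schwartz[OF i Ib]
      by (subst (asm) FL_tendsto_iff[OF q b mT[OF \<gamma>(1)] finT[OF \<gamma>(1)] H(1,2)])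
    have le: "wnorm b q (\<lambda>\<tau>. H \<tau> - G \<tau>) \<le> ennreal (2 powr q) * (wnorm b q (\<lambda>\<tau>. ?T (\<gamma> n) \<tau> - H \<tau>) + wnorm b q (\<lambda>\<tau>. ?T (\<gamma> n) \<tau> - G \<tau>))" for n
      using wnorm_triangle[OF H(1) mT[OF \<gamma>(1)] m(2), of q b n] q by (simp add: wnorm_minus_commute[of b q H])
    have "(\<lambda>n. ennreal (2 powr q) * (wnorm b q (\<lambda>\<tau>. ?T (\<gamma> n) \<tau> - H \<tau>) + wnorm b q (\<lambda>\<tau>. ?T (\<gamma> n) \<tau> - G \<tau>))) \<longlonglongrightarrow> ennreal (2 powr q) * (0 + 0)"
      by (intro ennreal_tendsto_cmult tendsto_add limH tendsto_T \<gamma> lim) simp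
    then have "wnorm b q (\<lambda>\<tau>. H \<tau> - G \<tau>) \<le> ennreal (2 powr q) * (0 + 0)"
      by (rule LIMSEQ_le_const) (use le in blast)
    then have "AE \<tau> in lborel. H \<tau> - G \<tau> = 0"
      using q by (subst wnorm_0_iff[symmetric, of _ q b]) (auto intro!: borel_measurable_diff H m)
    then have "AE \<tau> in lborel. H \<tau> = G \<tau>" by eventually_elim simp
    then show ?thesis unfolding H(3) by (rule FL_dist_cong[OF _ H(1) m(2)])
  qed
  have "cutoff b q I (FL_dist g) = (THE h. ?P h)" unfolding cutoff_def by (rule if_not_P[OF False])
  also have "\<dots> = FL_dist G" using exists unique by (rule the_equality)
  finally show ?thesis .
qed

lemma cutoff_bounded:
  fixes b q :: real
  assumes q: "1 < q" and b: "0 \<le> b" "b < 1 - 1 / q"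
  shows "\<exists>C>0. \<forall>I::real set. is_interval I \<longrightarrow>
           (\<forall>f\<in>FL b q. cutoff b q I f \<in> FL b q \<and> FL_norm b q (cutoff b q I f) \<le> C * FL_norm b q f)"
proof -
  obtain C where C: "C \<ge> 0" "\<And>I g. is_interval I \<Longrightarrow> g \<in> borel_measurable borel \<Longrightarrow> wnorm b q g < \<infinity> \<Longrightarrow>
    \<exists>G. G \<in> borel_measurable borel \<and> (\<forall>\<gamma>\<in>schwartz. wnorm b q (\<lambda>\<tau>. G \<tau> - fourier (cut I (ifourier \<gamma>)) \<tau>) \<le> ennreal C * wnorm b q (\<lambda>\<tau>. g \<tau> - \<gamma> \<tau>))"
    by (rule interval_cut_extension[OF q b]) blast
  \<comment> \<open>The summand 1 makes the constant positive also for C = 0.\<close>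
  show ?thesis
  proof (intro exI[of _ "C powr (1 / q) + 1"] conjI allI impI ballI)
    show "C powr (1 / q) + 1 > 0" by (simp add: add_nonneg_pos)
    fix I :: "real set" and f assume I: "is_interval I" and "f \<in> FL b q"
    then obtain g where g: "g \<in> borel_measurable borel" "wnorm b q g < \<infinity>" "f = FL_dist g" using FL_iff[OF q b(1)] by blast
    obtain G where G: "G \<in> borel_measurable borel"
      "\<And>\<gamma>. \<gamma> \<in> schwartz \<Longrightarrow> wnorm b q (\<lambda>\<tau>. G \<tau> - fourier (cut I (ifourier \<gamma>)) \<tau>) \<le> ennreal C * wnorm b q (\<lambda>\<tau>. g \<tau> - \<gamma> \<tau>)"
      using C(2)[OF I g(1,2)] by blast
    have z: "(\<lambda>_. 0) \<in> schwartz" using schwartz_cmult[OF schwartz_bell, of 0] by simp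
    have le: "wnorm b q G \<le> ennreal C * wnorm b q g"
      using G(2)[OF z] by (simp add: cut_def ifourier_def fourier_def)
    have fin: "wnorm b q G < \<infinity>" using g(2) by (intro le_less_trans[OF le]) (simp add: ennreal_mult_less_top)
    have eq: "cutoff b q I f = FL_dist G"
      unfolding g(3) by (rule cutoff_eq_FL_dist[OF q b(1) g(1) G(1) g(2) fin G(2) C(1) I])
    show "cutoff b q I f \<in> FL b q" unfolding eq using FL_iff[OF q b(1)] G(1) fin by blast
    have "enn2real (wnorm b q G) \<le> enn2real (ennreal C * wnorm b q g)"
      using le g(2) by (intro enn2real_mono) (simp_all add: ennreal_mult_less_top)
    also have "\<dots> = C * enn2real (wnorm b q g)" using C(1) by (simp add: enn2real_mult)
    finally have "enn2real (wnorm b q G) powr (1 / q) \<le> (C * enn2real (wnorm b q g)) powr (1 / q)"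
      using q by (intro powr_mono2) auto
    also have "\<dots> = C powr (1 / q) * enn2real (wnorm b q g) powr (1 / q)" using C(1) by (simp add: powr_mult)
    also have "\<dots> \<le> (C powr (1 / q) + 1) * enn2real (wnorm b q g) powr (1 / q)" by (intro mult_right_mono) auto
    finally show "FL_norm b q (cutoff b q I f) \<le> (C powr (1 / q) + 1) * FL_norm b q f"
      unfolding eq unfolding g(3) by (simp only: FL_norm_FL_dist[OF q b(1) G(1) fin] FL_norm_FL_dist[OF q b(1) g(1,2)])
  qed
qed

theorem lemmaA1:
  fixes q q' b :: real
  assumes "1 < q" and "1 / q + 1 / q' = 1"
    and "0 \<le> b" and "b < 1 / q'"
  shows "\<exists>C>0. \<forall>I::real set. is_interval I \<longrightarrow>
           (\<forall>f\<in>FL b q. cutoff b q I f \<in> FL b q \<and>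
              FL_norm b q (cutoff b q I f) \<le> C * FL_norm b q f)"
proof (rule cutoff_bounded[OF assms(1,3)])
  show "b < 1 - 1 / q" using assms(2,4) by linarith
qed

end
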